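(* Let $\lambda\ge8$, $\theta\in[0,1)$, and let $H$ be the Fibonacci Hamiltonian on $\ell^2(\mathbb{Z})$ with coupling constant $\lambda$ and phase $\theta$, that is, $[Hu](n)=u(n+1)+u(n-1)+V(n)u(n)$ with $$V(n)=\lambda\,\chi_{[1-\phi^{-1},1)}(n\phi^{-1}+\theta \bmod 1),\qquad \phi=\frac{\sqrt5+1}{2}.$$ Let $$S_l(\lambda)=\frac12\left((\lambda-4)+\sqrt{(\lambda-4)^2-12}\right),\qquad \alpha(\lambda)=\frac{2\log\phi}{\log S_l(\lambda)}.$$ Then $\alpha_u^+\le\alpha(\lambda)$, and hence $\beta^+_{\delta_0}(p)\le\alpha(\lambda)$ for every $p>0$.
   Context: $\{\delta_n\}_{n\in\mathbb{Z}}$ is the standard basis of $\ell^2(\mathbb{Z})$ and $\chi_A$ is the indicator function of $A$. Outside probabilities: for real $N$, $P(N,t)=\sum_{n\ge N}|\langle e^{-itH}\delta_0,\delta_n\rangle|^2+\sum_{n\le -N}|\langle e^{-itH}\delta_0,\delta_n\rangle|^2$ (sums over integers $n$). For $\alpha\ge0$ let $$S^+(\alpha)=-\limsup_{t\to\infty}\frac{\log P(t^\alpha-1,t)}{\log t}\in[0,\infty],\qquad \alpha_u^+=\sup\{\alpha\ge0: S^+(\alpha)<\infty\}.$$ Moments and transport exponent: for $p>0$, $\langle|X|^p_{\delta_0}\rangle(t)=\sum_{n\in\mathbb{Z}}|n|^p|\langle e^{-itH}\delta_0,\delta_n\rangle|^2$ and $$\beta^+_{\delta_0}(p)=\limsup_{t\to\infty}\frac{\log\langle|X|^p_{\delta_0}\rangle(t)}{p\log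 t}.$$ *)

theory Defs
  imports "HOL-Analysis.Analysis"
begin

section \<open>The Hilbert space of square-summable two-sided sequences\<close>

lemma sq_summable_add:
  fixes f g :: "int \<Rightarrow> complex"
  assumes "(\<lambda>n. (cmod (f n))\<^sup>2) summable_on UNIV" and "(\<lambda>n. (cmod (g n))\<^sup>2) summable_on UNIV"
  shows "(\<lambda>n. (cmod (f n + g n))\<^sup>2) summable_on UNIV"
proof (rule summable_on_comparison_test)
  show "(\<lambda>n. 2 * (cmod (f n))\<^sup>2 + 2 * (cmod (g n))\<^sup>2) summable_on UNIV"
    using assms by (intro summable_on_add summable_on_cmult_right)
  show "(cmod (f n + g n))\<^sup>2 \<le> 2 * (cmod (f n))\<^sup>2 + 2 * (cmod (g n))\<^sup>2" for n
  proof -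
    have "(cmod (f n + g n))\<^sup>2 \<le> (cmod (f n) + cmod (g n))\<^sup>2"
      by (simp add: norm_triangle_ineq power_mono)
    also have "\<dots> \<le> 2 * (cmod (f n))\<^sup>2 + 2 * (cmod (g n))\<^sup>2"
      using sum_squares_bound[of "cmod (f n)" "cmod (g n)"] by (simp add: power2_sum)
    finally show ?thesis .
  qed
qed auto

lemma sq_summable_mult_bounded:
  fixes f g :: "int \<Rightarrow> complex"
  assumes "(\<lambda>n. (cmod (f n))\<^sup>2) summable_on UNIV" and "\<And>n. cmod (g n) \<le> C"
  shows "(\<lambda>n. (cmod (g n * f n))\<^sup>2) summable_on UNIV"
proof (rule summable_on_comparison_test)
  show "(\<lambda>n. C\<^sup>2 * (cmod (f n))\<^sup>2) summable_on UNIV"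
    using assms by (intro summable_on_cmult_right)
  show "(cmod (g n * f n))\<^sup>2 \<le> C\<^sup>2 * (cmod (f n))\<^sup>2" for n
    using assms(2)[of n] by (simp add: norm_mult power_mult_distrib mult_right_mono power_mono)
qed auto

lemma sq_summable_shift:
  fixes f :: "int \<Rightarrow> complex"
  assumes "(\<lambda>n. (cmod (f n))\<^sup>2) summable_on UNIV"
  shows "(\<lambda>n. (cmod (f (n + k)))\<^sup>2) summable_on UNIV"
proof -
  have "bij_betw (\<lambda>n::int. n + k) UNIV UNIV"
    by (rule bij_betw_byWitness[where f' = "\<lambda>n. n - k"]) auto
  from summable_on_reindex_bij_betw[OF this, of "\<lambda>n. (cmod (f n))\<^sup>2"] assms show ?thesis by simp
qed

typedef ell2 = "{f :: int \<Rightarrow> complex. (\<lambda>n. (cmod (f n))\<^sup>2) summable_on UNIV}"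
  morphisms ell2_nth Abs_ell2
  by (rule exI[of _ "\<lambda>_. 0"]) simp

setup_lifting type_definition_ell2

lemma sq_summable_ell2: "(\<lambda>n. (cmod (ell2_nth x n))\<^sup>2) summable_on UNIV"
  using ell2_nth by simp

lemma ell2_eqI: "(\<And>n. ell2_nth x n = ell2_nth y n) \<Longrightarrow> x = y"
  by (simp add: ell2_nth_inject[symmetric] fun_eq_iff)

lift_definition scaleC :: "complex \<Rightarrow> ell2 \<Rightarrow> ell2"  (infixr "*\<^sub>C" 75)
  is "\<lambda>c f n. c * f n"
  by (rule sq_summable_mult_bounded[where C = "cmod c" for c]) auto

lift_definition delta :: "int \<Rightarrow> ell2" is "\<lambda>m n. if n = m then 1 else 0"
proof -
  fix m :: int
  have "(\<lambda>n. (cmod (if n = m then 1 else 0))\<^sup>2) summable_on {m}"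
    by simp
  then show "(\<lambda>n. (cmod (if n = m then 1 else 0))\<^sup>2) summable_on UNIV"
    by (rule summable_on_cong_neutral[THEN iffD1, rotated -1]) auto
qed

definition cinner :: "ell2 \<Rightarrow> ell2 \<Rightarrow> complex" where
  "cinner x y = (\<Sum>\<^sub>\<infinity>n. cnj (ell2_nth x n) * ell2_nth y n)"

lemma cinner_summable: "(\<lambda>n. cnj (ell2_nth x n) * ell2_nth y n) summable_on UNIV"
proof (rule abs_summable_summable, rule summable_on_comparison_test)
  show "(\<lambda>n. (cmod (ell2_nth x n))\<^sup>2 + (cmod (ell2_nth y n))\<^sup>2) summable_on UNIV"
    by (intro summable_on_add sq_summable_ell2)
  show "norm (cnj (ell2_nth x n) * ell2_nth y n)
      \<le> (cmod (ell2_nth x n))\<^sup>2 + (cmod (ell2_nth y n))\<^sup>2" for n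
  proof -
    have "0 \<le> cmod (ell2_nth x n) * cmod (ell2_nth y n)" by simp
    with sum_squares_bound[of "cmod (ell2_nth x n)" "cmod (ell2_nth y n)"] show ?thesis
      unfolding norm_mult complex_mod_cnj by linarith
  qed
qed auto

lemma cinner_self: "cinner x x = of_real (\<Sum>\<^sub>\<infinity>n. (cmod (ell2_nth x n))\<^sup>2)"
proof -
  have "cinner x x = (\<Sum>\<^sub>\<infinity>n. of_real ((cmod (ell2_nth x n))\<^sup>2))"
    unfolding cinner_def by (intro infsum_cong) (simp only: complex_norm_square mult.commute)
  also have "\<dots> = of_real (\<Sum>\<^sub>\<infinity>n. (cmod (ell2_nth x n))\<^sup>2)"
    by (rule infsumI, rule has_sum_of_real, rule has_sum_infsum, rule sq_summable_ell2)
  finally show ?thesis .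
qed

text \<open>The real inner product is the real part of the complex one; both induce the same norm.\<close>

instantiation ell2 :: real_inner
begin

lift_definition zero_ell2 :: ell2 is "\<lambda>_. 0" by simp
lift_definition plus_ell2 :: "ell2 \<Rightarrow> ell2 \<Rightarrow> ell2" is "\<lambda>f g n. f n + g n"
  by (rule sq_summable_add)
lift_definition uminus_ell2 :: "ell2 \<Rightarrow> ell2" is "\<lambda>f n. - f n" by simp
lift_definition minus_ell2 :: "ell2 \<Rightarrow> ell2 \<Rightarrow> ell2" is "\<lambda>f g n. f n - g n"
  using sq_summable_add[of _ "\<lambda>n. - g n" for g] by simp
lift_definition scaleR_ell2 :: "real \<Rightarrow> ell2 \<Rightarrow> ell2" is "\<lambda>r f n. of_real r * f n"
  by (rule sq_summable_mult_bounded[where C = "\<bar>r\<bar>" for r]) auto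
definition inner_ell2 :: "ell2 \<Rightarrow> ell2 \<Rightarrow> real" where
  "inner_ell2 x y = Re (cinner x y)"
definition norm_ell2 :: "ell2 \<Rightarrow> real" where
  "norm_ell2 x = sqrt (\<Sum>\<^sub>\<infinity>n. (cmod (ell2_nth x n))\<^sup>2)"
definition dist_ell2 :: "ell2 \<Rightarrow> ell2 \<Rightarrow> real" where
  "dist_ell2 x y = norm (x - y)"
definition sgn_ell2 :: "ell2 \<Rightarrow> ell2" where
  "sgn_ell2 x = inverse (norm x) *\<^sub>R x"
definition uniformity_ell2 :: "(ell2 \<times> ell2) filter" where
  "uniformity_ell2 = (INF e\<in>{0<..}. principal {(x, y). dist x y < e})"
definition open_ell2 :: "ell2 set \<Rightarrow> bool" where
  "open_ell2 U = (\<forall>x\<in>U. \<forall>\<^sub>F (x', y) in uniformity. x' = x \<longrightarrow> y \<in> U)"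

instance
proof
  fix x y z :: ell2 and a b r :: real
  show "x + y + z = x + (y + z)" by transfer (simp add: add.assoc)
  show "x + y = y + x" by transfer (simp add: add.commute)
  show "0 + x = x" by transfer simp
  show "- x + x = 0" by transfer simp
  show "x - y = x + - y" by transfer simp
  show "a *\<^sub>R (x + y) = a *\<^sub>R x + a *\<^sub>R y" by transfer (simp add: algebra_simps)
  show "(a + b) *\<^sub>R x = a *\<^sub>R x + b *\<^sub>R x" by transfer (simp add: algebra_simps)
  show "a *\<^sub>R b *\<^sub>R x = (a * b) *\<^sub>R x" by transfer (simp add: algebra_simps)
  show "1 *\<^sub>R x = x" by transfer simp
  show "dist x y = norm (x - y)" by (rule dist_ell2_def)
  show "sgn x = inverse (norm x) *\<^sub>R x" by (rule sgn_ell2_def)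
  show "uniformity = (INF e\<in>{0<..}. principal {(x :: ell2, y). dist x y < e})"
    by (rule uniformity_ell2_def)
  show "open U = (\<forall>x\<in>U. \<forall>\<^sub>F (x', y) in uniformity. x' = x \<longrightarrow> y \<in> U)" for U :: "ell2 set"
    by (rule open_ell2_def)
  have "cinner y x = cnj (cinner x y)"
    unfolding cinner_def by (simp add: infsum_cnj[symmetric] mult.commute del: infsum_cnj)
  then show "inner x y = inner y x" by (simp add: inner_ell2_def)
  have "cinner (x + y) z = cinner x z + cinner y z"
    unfolding cinner_def
    by (subst infsum_add[symmetric])
       (auto simp: cinner_summable plus_ell2.rep_eq distrib_right)
  then show "inner (x + y) z = inner x z + inner y z" by (simp add: inner_ell2_def)
  have "cinner (r *\<^sub>R x) y = of_real r * cinner x y"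
    unfolding cinner_def
    by (subst infsum_cmult_right[symmetric])
       (auto simp: cinner_summable scaleR_ell2.rep_eq mult.assoc)
  then show "inner (r *\<^sub>R x) y = r * inner x y" by (simp add: inner_ell2_def)
  have nn: "0 \<le> (\<Sum>\<^sub>\<infinity>n. (cmod (ell2_nth x n))\<^sup>2)" by (rule infsum_nonneg) simp
  then show "0 \<le> inner x x" by (simp add: inner_ell2_def cinner_self)
  show "inner x x = 0 \<longleftrightarrow> x = 0"
  proof
    assume "inner x x = 0"
    then have 0: "(\<Sum>\<^sub>\<infinity>n. (cmod (ell2_nth x n))\<^sup>2) = 0" by (simp add: inner_ell2_def cinner_self)
    have "(cmod (ell2_nth x n))\<^sup>2 = 0" for n
      by (rule nonneg_infsum_le_0D[where A = UNIV]) (use 0 sq_summable_ell2 in auto)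
    then show "x = 0" by (intro ell2_eqI) (simp add: zero_ell2.rep_eq)
  qed (simp add: inner_ell2_def cinner_self zero_ell2.rep_eq)
  show "norm x = sqrt (inner x x)" by (simp add: norm_ell2_def inner_ell2_def cinner_self)
qed

end

lemma norm_ell2_le:
  assumes "0 \<le> C" and "\<And>F. finite F \<Longrightarrow> (\<Sum>n\<in>F. (cmod (ell2_nth x n))\<^sup>2) \<le> C\<^sup>2"
  shows "norm x \<le> C"
proof -
  have "(\<Sum>\<^sub>\<infinity>n. (cmod (ell2_nth x n))\<^sup>2) \<le> C\<^sup>2"
    by (rule infsum_le_finite_sums[OF sq_summable_ell2 assms(2)])
  then show ?thesis
    unfolding norm_ell2_def using assms(1) real_le_lsqrt by blast
qed

lemma sum_le_norm_ell2:
  assumes "finite F"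
  shows "(\<Sum>n\<in>F. (cmod (ell2_nth x n))\<^sup>2) \<le> (norm x)\<^sup>2"
proof -
  have "0 \<le> (\<Sum>\<^sub>\<infinity>n. (cmod (ell2_nth x n))\<^sup>2)" by (rule infsum_nonneg) simp
  moreover have "(\<Sum>n\<in>F. (cmod (ell2_nth x n))\<^sup>2) \<le> (\<Sum>\<^sub>\<infinity>n. (cmod (ell2_nth x n))\<^sup>2)"
    by (rule finite_sum_le_infsum) (use assms sq_summable_ell2 in auto)
  ultimately show ?thesis by (simp add: norm_ell2_def)
qed

lemma cmod_ell2_nth_le: "cmod (ell2_nth x n) \<le> norm x"
proof (rule power2_le_imp_le)
  show "(cmod (ell2_nth x n))\<^sup>2 \<le> (norm x)\<^sup>2"
    using sum_le_norm_ell2[of "{n}" x] by simp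
qed simp

instance ell2 :: banach
proof
  fix X :: "nat \<Rightarrow> ell2" assume X: "Cauchy X"
  have "Cauchy (\<lambda>k. ell2_nth (X k) n)" for n
  proof (rule metric_CauchyI)
    fix e :: real assume "e > 0"
    from metric_CauchyD[OF X this] obtain M where
      M: "\<forall>m\<ge>M. \<forall>k\<ge>M. dist (X m) (X k) < e" by blast
    have "dist (ell2_nth (X m) n) (ell2_nth (X k) n) \<le> dist (X m) (X k)" for m k
      using cmod_ell2_nth_le[of "X m - X k" n] by (simp add: dist_norm minus_ell2.rep_eq)
    with M show "\<exists>M. \<forall>m\<ge>M. \<forall>k\<ge>M. dist (ell2_nth (X m) n) (ell2_nth (X k) n) < e"
      by (meson le_less_trans)
  qed
  then have "\<exists>l. (\<lambda>k. ell2_nth (X k) n) \<longlonglongrightarrow> l" for n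
    by (simp add: Cauchy_convergent_iff convergent_def)
  then obtain f where f: "\<And>n. (\<lambda>k. ell2_nth (X k) n) \<longlonglongrightarrow> f n" by metis
  have bd: "(\<Sum>n\<in>F. (cmod (ell2_nth (X m) n - f n))\<^sup>2) \<le> e\<^sup>2"
    if "finite F" "\<forall>k\<ge>M. dist (X m) (X k) < e" for F m M e
  proof (rule tendsto_upperbound)
    show "(\<lambda>k. \<Sum>n\<in>F. (cmod (ell2_nth (X m) n - ell2_nth (X k) n))\<^sup>2)
        \<longlonglongrightarrow> (\<Sum>n\<in>F. (cmod (ell2_nth (X m) n - f n))\<^sup>2)"
      by (intro tendsto_intros f)
    have "(\<Sum>n\<in>F. (cmod (ell2_nth (X m) n - ell2_nth (X k) n))\<^sup>2) \<le> e\<^sup>2" if "k \<ge> M" for k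
    proof -
      have "(\<Sum>n\<in>F. (cmod (ell2_nth (X m) n - ell2_nth (X k) n))\<^sup>2) \<le> (norm (X m - X k))\<^sup>2"
        using sum_le_norm_ell2[OF \<open>finite F\<close>, of "X m - X k"] by (simp add: minus_ell2.rep_eq)
      also have "\<dots> \<le> e\<^sup>2"
        using \<open>\<forall>k\<ge>M. dist (X m) (X k) < e\<close> that
        by (intro power_mono) (auto simp: dist_norm less_imp_le)
      finally show ?thesis .
    qed
    then show "\<forall>\<^sub>F k in sequentially.
        (\<Sum>n\<in>F. (cmod (ell2_nth (X m) n - ell2_nth (X k) n))\<^sup>2) \<le> e\<^sup>2"
      by (auto simp: eventually_sequentially)
  qed simp
  from metric_CauchyD[OF X, of 1] obtain M where
    M: "\<forall>k\<ge>M. dist (X M) (X k) < 1" by auto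
  have "(\<lambda>n. (cmod (ell2_nth (X M) n - f n))\<^sup>2) summable_on UNIV"
  proof (rule nonneg_bdd_above_summable_on)
    have "y \<le> 1\<^sup>2" if "y \<in> sum (\<lambda>n. (cmod (ell2_nth (X M) n - f n))\<^sup>2) ` {F. F \<subseteq> UNIV \<and> finite F}"
      for y
      using that bd[OF _ M] by blast
    then show "bdd_above (sum (\<lambda>n. (cmod (ell2_nth (X M) n - f n))\<^sup>2) ` {F. F \<subseteq> UNIV \<and> finite F})"
      by (rule bdd_aboveI)
  qed simp
  then have "(\<lambda>n. (cmod (f n - ell2_nth (X M) n))\<^sup>2) summable_on UNIV"
    by (simp add: norm_minus_commute)
  from sq_summable_add[OF this sq_summable_ell2[of "X M"]]
  have "(\<lambda>n. (cmod (f n))\<^sup>2) summable_on UNIV" by simp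
  then have nth: "ell2_nth (Abs_ell2 f) = f" by (simp add: Abs_ell2_inverse)
  have "X \<longlonglongrightarrow> Abs_ell2 f"
  proof (rule metric_LIMSEQ_I)
    fix e :: real assume "e > 0"
    then have "e / 2 > 0" by simp
    from metric_CauchyD[OF X this] obtain M where
      M: "\<forall>m\<ge>M. \<forall>k\<ge>M. dist (X m) (X k) < e / 2" by blast
    have "dist (X m) (Abs_ell2 f) < e" if "m \<ge> M" for m
    proof -
      have "norm (X m - Abs_ell2 f) \<le> e / 2"
      proof (rule norm_ell2_le)
        have Mm: "\<forall>k\<ge>M. dist (X m) (X k) < e / 2" using M that by blast
        show "(\<Sum>n\<in>F. (cmod (ell2_nth (X m - Abs_ell2 f) n))\<^sup>2) \<le> (e / 2)\<^sup>2"
          if "finite F" for F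
          using bd[OF that Mm] by (simp only: minus_ell2.rep_eq nth)
      qed (use \<open>e > 0\<close> in simp)
      with \<open>e > 0\<close> show ?thesis by (simp add: dist_norm)
    qed
    then show "\<exists>M. \<forall>m\<ge>M. dist (X m) (Abs_ell2 f) < e" by blast
  qed
  then show "convergent X" by (auto simp: convergent_def)
qed

lemma norm_scaleC: "norm (c *\<^sub>C x) = cmod c * norm x"
  by (simp add: norm_ell2_def scaleC.rep_eq norm_mult power_mult_distrib infsum_cmult_right'
      real_sqrt_mult)

section \<open>Unitary evolution and transport exponents\<close>

text \<open>\<open>exp (-\<i>tH) x\<close> as a power series in \<open>H\<close>, converging in norm for bounded \<open>H\<close>.\<close>

definition evolution :: "(ell2 \<Rightarrow> ell2) \<Rightarrow> real \<Rightarrow> ell2 \<Rightarrow> ell2" where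
  "evolution H t x = (\<Sum>k. ((- \<i> * of_real t) ^ k / fact k) *\<^sub>C (H ^^ k) x)"

lemma summable_evolution:
  fixes H :: "ell2 \<Rightarrow> ell2"
  assumes "bounded_linear H"
  shows "summable (\<lambda>k. ((- \<i> * of_real t) ^ k / fact k) *\<^sub>C (H ^^ k) x)"
proof -
  from bounded_linear.nonneg_bounded[OF assms] obtain K where
    K: "0 \<le> K" "\<And>y. norm (H y) \<le> norm y * K" by blast
  have pow: "norm ((H ^^ k) x) \<le> K ^ k * norm x" for k
  proof (induction k)
    case (Suc k)
    have "norm ((H ^^ Suc k) x) \<le> norm ((H ^^ k) x) * K"
      using K(2)[of "(H ^^ k) x"] by simp
    also have "\<dots> \<le> (K ^ k * norm x) * K" by (intro mult_right_mono Suc K)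
    finally show ?case by (simp add: mult_ac)
  qed simp
  show ?thesis
  proof (rule summable_comparison_test')
    show "summable (\<lambda>k. norm x * (inverse (fact k) * (\<bar>t\<bar> * K) ^ k))"
      by (intro summable_mult summable_exp)
    show "norm (((- \<i> * of_real t) ^ k / fact k) *\<^sub>C (H ^^ k) x)
        \<le> norm x * (inverse (fact k) * (\<bar>t\<bar> * K) ^ k)" for k
    proof -
      have "norm (((- \<i> * of_real t) ^ k / fact k) *\<^sub>C (H ^^ k) x)
          = \<bar>t\<bar> ^ k / fact k * norm ((H ^^ k) x)"
        by (simp add: norm_scaleC norm_divide norm_power norm_mult)
      also have "\<dots> \<le> \<bar>t\<bar> ^ k / fact k * (K ^ k * norm x)"
        by (rule mult_left_mono[OF pow]) simp
      also have "\<dots> = norm x * (inverse (fact k) * (\<bar>t\<bar> * K) ^ k)"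
        by (simp add: power_mult_distrib divide_inverse mult_ac)
      finally show ?thesis .
    qed
  qed
qed

definition position_prob :: "(ell2 \<Rightarrow> ell2) \<Rightarrow> real \<Rightarrow> int \<Rightarrow> real" where
  "position_prob H t n = (cmod (cinner (evolution H t (delta 0)) (delta n)))\<^sup>2"

text \<open>Sums of nonnegative terms are taken in \<open>[0,\<infinity>]\<close>, where they always exist.\<close>

text \<open>For \<open>N \<le> 0\<close> the two index sets overlap, and the common terms count twice.\<close>

definition outside_prob :: "(ell2 \<Rightarrow> ell2) \<Rightarrow> real \<Rightarrow> real \<Rightarrow> ennreal" where
  "outside_prob H N t =
     (\<Sum>\<^sub>\<infinity>n\<in>{n :: int. of_int n \<ge> N}. ennreal (position_prob H t n)) +
     (\<Sum>\<^sub>\<infinity>n\<in>{n :: int. of_int n \<le> - N}. ennreal (position_prob H t n))"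

definition moment :: "(ell2 \<Rightarrow> ell2) \<Rightarrow> real \<Rightarrow> real \<Rightarrow> ennreal" where
  "moment H p t = (\<Sum>\<^sub>\<infinity>n::int. ennreal (\<bar>of_int n\<bar> powr p * position_prob H t n))"

text \<open>Logarithm on \<open>[0,\<infinity>]\<close> with \<open>log 0 = -\<infinity>\<close>, so that \<open>S_plus\<close> may take the value \<open>\<infinity>\<close>.\<close>

definition elog :: "ennreal \<Rightarrow> ereal" where
  "elog x = (if x = 0 then - \<infinity> else if x = \<infinity> then \<infinity> else ereal (ln (enn2real x)))"

definition S_plus :: "(ell2 \<Rightarrow> ell2) \<Rightarrow> real \<Rightarrow> ereal" where
  "S_plus H \<alpha> = - Limsup at_top (\<lambda>t::real. elog (outside_prob H (t powr \<alpha> - 1) t) / ereal (ln t))"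

definition alpha_u_plus :: "(ell2 \<Rightarrow> ell2) \<Rightarrow> ereal" where
  "alpha_u_plus H = Sup (ereal ` {\<alpha>. 0 \<le> \<alpha> \<and> S_plus H \<alpha> < \<infinity>})"

definition beta_plus :: "(ell2 \<Rightarrow> ell2) \<Rightarrow> real \<Rightarrow> ereal" where
  "beta_plus H p = Limsup at_top (\<lambda>t::real. elog (moment H p t) / ereal (p * ln t))"

section \<open>The Fibonacci Hamiltonian\<close>

definition golden :: real where
  "golden = (sqrt 5 + 1) / 2"

definition fib_potential :: "real \<Rightarrow> real \<Rightarrow> int \<Rightarrow> real" where
  "fib_potential l \<theta> n =
     l * indicat_real {1 - inverse golden..<1} (frac (of_int n * inverse golden + \<theta>))"

lemma abs_fib_potential_le: "\<bar>fib_potential l \<theta> n\<bar> \<le> \<bar>l\<bar>"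
  by (simp add: fib_potential_def indicator_def)

lift_definition fib_hamiltonian :: "real \<Rightarrow> real \<Rightarrow> ell2 \<Rightarrow> ell2"
  is "\<lambda>l \<theta> u n. u (n + 1) + u (n - 1) + of_real (fib_potential l \<theta> n) * u n"
proof -
  fix l \<theta> :: real and u :: "int \<Rightarrow> complex"
  assume u: "(\<lambda>n. (cmod (u n))\<^sup>2) summable_on UNIV"
  show "(\<lambda>n. (cmod (u (n + 1) + u (n - 1) + of_real (fib_potential l \<theta> n) * u n))\<^sup>2)
      summable_on UNIV"
    by (intro sq_summable_add sq_summable_shift[OF u] sq_summable_shift[OF u, of "-1", simplified]
        sq_summable_mult_bounded[OF u, where C = "\<bar>l\<bar>"])
       (simp add: abs_fib_potential_le)
qed

lemma norm_ell2_shift: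
  assumes "\<And>n. ell2_nth y n = ell2_nth x (n + k)"
  shows "norm y = norm x"
proof -
  have "bij_betw (\<lambda>n::int. n + k) UNIV UNIV"
    by (rule bij_betw_byWitness[where f' = "\<lambda>n. n - k"]) auto
  from infsum_reindex_bij_betw[OF this, of "\<lambda>n. (cmod (ell2_nth x n))\<^sup>2"] assms
  show ?thesis by (simp add: norm_ell2_def)
qed

lemma bounded_linear_fib_hamiltonian: "bounded_linear (fib_hamiltonian l \<theta>)"
proof (rule bounded_linear_intro)
  fix x y :: ell2 and r :: real
  show "fib_hamiltonian l \<theta> (x + y) = fib_hamiltonian l \<theta> x + fib_hamiltonian l \<theta> y"
    by transfer (simp add: algebra_simps)
  show "fib_hamiltonian l \<theta> (r *\<^sub>R x) = r *\<^sub>R fib_hamiltonian l \<theta> x"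
    by transfer (simp add: algebra_simps)
  define L where "L = Abs_ell2 (\<lambda>n. ell2_nth x (n + 1))"
  define R where "R = Abs_ell2 (\<lambda>n. ell2_nth x (n + - 1))"
  define W where "W = Abs_ell2 (\<lambda>n. of_real (fib_potential l \<theta> n) * ell2_nth x n)"
  have L: "ell2_nth L n = ell2_nth x (n + 1)" for n
    using sq_summable_shift[OF sq_summable_ell2, of x 1] by (simp add: L_def Abs_ell2_inverse)
  have R: "ell2_nth R n = ell2_nth x (n + - 1)" for n
    using sq_summable_shift[OF sq_summable_ell2, of x "- 1"] by (simp add: R_def Abs_ell2_inverse)
  have W: "ell2_nth W n = of_real (fib_potential l \<theta> n) * ell2_nth x n" for n
    using sq_summable_mult_bounded[OF sq_summable_ell2[of x],
        of "\<lambda>n. of_real (fib_potential l \<theta> n)" "\<bar>l\<bar>"]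
    by (simp add: W_def Abs_ell2_inverse abs_fib_potential_le)
  have "norm W \<le> \<bar>l\<bar> * norm x"
  proof (rule norm_ell2_le)
    fix F :: "int set" assume "finite F"
    have "(\<Sum>n\<in>F. (cmod (ell2_nth W n))\<^sup>2) \<le> (\<Sum>n\<in>F. \<bar>l\<bar>\<^sup>2 * (cmod (ell2_nth x n))\<^sup>2)"
      unfolding W norm_mult power_mult_distrib norm_of_real
      by (intro sum_mono mult_right_mono power_mono abs_fib_potential_le) auto
    also have "\<dots> \<le> \<bar>l\<bar>\<^sup>2 * (norm x)\<^sup>2"
      unfolding sum_distrib_left[symmetric]
      by (intro mult_left_mono sum_le_norm_ell2 \<open>finite F\<close>) simp
    finally show "(\<Sum>n\<in>F. (cmod (ell2_nth W n))\<^sup>2) \<le> (\<bar>l\<bar> * norm x)\<^sup>2"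
      by (simp add: power_mult_distrib)
  qed simp
  moreover have "fib_hamiltonian l \<theta> x = L + R + W"
    by (rule ell2_eqI) (simp add: fib_hamiltonian.rep_eq plus_ell2.rep_eq L R W)
  moreover have "norm L = norm x" "norm R = norm x"
    by (rule norm_ell2_shift, rule L) (rule norm_ell2_shift, rule R)
  moreover have "norm (L + R + W) \<le> norm L + norm R + norm W"
    using norm_triangle_ineq[of "L + R" W] norm_triangle_ineq[of L R] by linarith
  ultimately show "norm (fib_hamiltonian l \<theta> x) \<le> norm x * (2 + \<bar>l\<bar>)"
    by (simp add: algebra_simps)
qed

definition S_l :: "real \<Rightarrow> real" where
  "S_l l = ((l - 4) + sqrt ((l - 4)\<^sup>2 - 12)) / 2"

definition alpha_bound :: "real \<Rightarrow> real" where
  "alpha_bound l = 2 * ln golden / ln (S_l l)"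

end

theory Submission
  imports Defs
    "HOL-Probability.Probability"
    "HOL-Computational_Algebra.Computational_Algebra"
    "HOL-Number_Theory.Fib"
    "HOL-Real_Asymp.Real_Asymp"
begin

text \<open>
  Let \<open>\<psi>\<close> be the time evolution of the delta function at the origin. Its Laplace transform in time along
  \<open>Im z = 1 / t\<close> solves the difference equation of \<open>H - z\<close> away from the origin, is bounded by \<open>t\<close> and
  vanishes at infinity. The Fibonacci potential contains, on either side of the origin and within
  distance \<open>O (fib k)\<close>, a square of a word of length \<open>fib k\<close> whose transfer matrix has trace \<open>\<tau>\<^sub>k z\<close>;
  by Cayley-Hamilton the solution at the centre of the square is at most \<open>2 t / \<bar>\<tau>\<^sub>k z\<bar>\<close>, and a Wronskian
  identity carries this bound to all sites farther out. The traces obey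
  \<open>\<tau>\<^sub>k\<^sub>+\<^sub>3 = \<tau>\<^sub>k\<^sub>+\<^sub>2 \<tau>\<^sub>k\<^sub>+\<^sub>1 - \<tau>\<^sub>k\<close> and grow superexponentially once two consecutive ones exceed
  2.1 in modulus. On the real line the derivative of \<open>\<tau>\<^sub>k\<close> is at least \<open>(l - 4)\<close> to the power \<open>k/2\<close>, up to a
  constant, wherever \<open>\<bar>\<tau>\<^sub>k\<bar> \<le> 2.1\<close>; as all zeros of \<open>\<tau>\<^sub>k\<close> are real, this forces \<open>\<bar>\<tau>\<^sub>k z\<bar> > 2.1\<close> as soon as
  \<open>\<bar>Im z\<bar>\<close> exceeds a constant times \<open>(l - 4)\<close> to the power \<open>-k/2\<close>. Since \<open>S_l l \<le> l - 4\<close>, for \<open>Im z = 1 / t\<close>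
  this happens at the latest when \<open>fib k\<close> is of order \<open>t powr alpha_bound l\<close>. Averaging the Laplace
  transform over the line against a Gaussian recovers \<open>\<psi>\<close> at time \<open>t\<close>.
\<close>

section \<open>The trace map and its invariant\<close>

text \<open>Index \<open>k + 1\<close> belongs to the transfer matrix of level \<open>k\<close>. The
  constant 2 at index 0 is the trace at level -1, obtained by running the matrix recursion
  backwards; it starts every orbit with a small value. The ring is left open because the traces are
  needed over the reals and over the complex numbers.\<close>

fun trace_poly :: "'a::comm_ring_1 \<Rightarrow> nat \<Rightarrow> 'a poly" where
  "trace_poly l 0 = [:2:]"
| "trace_poly l (Suc 0) = [:0, 1:]"
| "trace_poly l (Suc (Suc 0)) = [:- l, 1:]"
| "trace_poly l (Suc (Suc (Suc k))) =
     trace_poly l (Suc (Suc k)) * trace_poly l (Suc k) - trace_poly l k"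

lemma poly_trace_poly_of_real:
  "poly (trace_poly (of_real l) k) (of_real x :: complex) = of_real (poly (trace_poly l k) x)"
  by (induction l k rule: trace_poly.induct) auto

lemma poly_trace_poly_cnj:
  "poly (trace_poly (of_real l) k) (cnj z) = cnj (poly (trace_poly (of_real l) k) z)"
  by (induction "of_real l :: complex" k rule: trace_poly.induct) auto

text \<open>This is the Fricke-Vogt invariant. As a quadratic in its first trace, the left side has
  roots summing to the product of the other two traces, so the recursion only swaps one root for the
  other.\<close>

lemma trace_invariant:
  fixes l z :: "'a::comm_ring_1"
  defines "\<tau> \<equiv> \<lambda>k. poly (trace_poly l k) z"
  shows "(\<tau> k)\<^sup>2 + (\<tau> (Suc k))\<^sup>2 + (\<tau> (Suc (Suc k)))\<^sup>2 - \<tau> k * \<tau> (Suc k) * \<tau> (Suc (Suc k)) = 4 + l\<^sup>2"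
proof (induction k)
  case 0
  show ?case by (simp add: \<tau>_def power2_eq_square algebra_simps)
next
  case (Suc k)
  have "\<tau> (Suc (Suc (Suc k))) = \<tau> (Suc (Suc k)) * \<tau> (Suc k) - \<tau> k"
    by (simp add: \<tau>_def)
  then have "(\<tau> (Suc k))\<^sup>2 + (\<tau> (Suc (Suc k)))\<^sup>2 + (\<tau> (Suc (Suc (Suc k))))\<^sup>2
        - \<tau> (Suc k) * \<tau> (Suc (Suc k)) * \<tau> (Suc (Suc (Suc k)))
      = (\<tau> k)\<^sup>2 + (\<tau> (Suc k))\<^sup>2 + (\<tau> (Suc (Suc k)))\<^sup>2 - \<tau> k * \<tau> (Suc k) * \<tau> (Suc (Suc k))"
    by (simp only:) (simp add: power2_eq_square algebra_simps)
  then show ?case using Suc.IH by simp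
qed

section \<open>Escape of traces\<close>

text \<open>The last conjunct drives the induction: it bounds the subtracted term of the recursion
  by 10/21 of the product, leaving 11/21 of it. In units of 21/11 each modulus is then at least the
  product of the two before, which makes the exponents Fibonacci numbers; 21/10 is one such unit
  times 11/10.\<close>

lemma escape:
  fixes x :: "nat \<Rightarrow> 'a::real_normed_field"
  assumes rec: "\<And>k. x (Suc (Suc (Suc k))) = x (Suc (Suc k)) * x (Suc k) - x k"
    and "norm (x k) \<le> 21/10" "norm (x (Suc k)) > 21/10" "norm (x (Suc (Suc k))) > 21/10"
  shows "norm (x (Suc k + i)) > 21/10 \<and> norm (x (Suc (Suc k) + i)) > 21/10
    \<and> norm (x (Suc k + i)) \<ge> (21/11) * (11/10) ^ fib (Suc i)
    \<and> norm (x (Suc (Suc k) + i)) \<ge> (21/11) * (11/10) ^ fib (Suc (Suc i))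
    \<and> norm (x (k + i)) * 21/10 \<le> norm (x (Suc k + i)) * norm (x (Suc (Suc k) + i))"
proof (induction i)
  case 0
  have "norm (x k) * (21/10) \<le> norm (x (Suc k)) * norm (x (Suc (Suc k)))"
    using assms by (intro mult_mono) auto
  then show ?case using assms by auto
next
  case (Suc i)
  let ?g0 = "norm (x (Suc k + i))" and ?g1 = "norm (x (Suc (Suc k) + i))"
    and ?g2 = "norm (x (Suc (Suc k) + Suc i))" and ?gm = "norm (x (k + i))"
  note IH = Suc.IH
  have "x (Suc (Suc k) + Suc i) = x (Suc (Suc k) + i) * x (Suc k + i) - x (k + i)"
    using rec[of "k + i"] by simp
  then have "?g2 \<ge> ?g1 * ?g0 - ?gm"
    using norm_triangle_ineq2[of "x (Suc (Suc k) + i) * x (Suc k + i)" "x (k + i)"]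
    by (simp add: norm_mult)
  with IH have g2: "?g2 \<ge> (11/21) * (?g1 * ?g0)" by (simp add: mult.commute)
  have a: "?g1 * ?g0 \<ge> (21/10) * ?g0" and b: "?g1 * ?g0 \<ge> ?g1 * (21/10)"
    using IH by (intro mult_right_mono mult_left_mono; simp)+
  have "(11/21) * (((21/11) * (11/10) ^ fib (Suc (Suc i))) * ((21/11) * (11/10) ^ fib (Suc i)))
      \<le> (11/21) * (?g1 * ?g0)"
    using IH by (intro mult_left_mono mult_mono) auto
  moreover have "(11/21) * (((21/11) * (11/10) ^ fib (Suc (Suc i))) * ((21/11) * (11/10) ^ fib (Suc i)))
      = (21/11) * (11/10 :: real) ^ fib (Suc (Suc (Suc i)))"
    by (simp add: power_add)
  ultimately have c: "?g2 \<ge> (21/11) * (11/10) ^ fib (Suc (Suc (Suc i)))"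
    using g2 by linarith
  have d: "?g2 > 21/10" "?g2 \<ge> (11/10) * ?g0" using g2 a b IH by auto
  have "?g0 * (21/10) \<le> ?g2 * ?g1"
    using IH d by (intro mult_mono) auto
  then show ?case using IH c d by (simp add: mult.commute)
qed

lemma last_small_index:
  fixes x :: "nat \<Rightarrow> 'a::real_normed_field"
  assumes "norm (x 0) \<le> 21/10" "norm (x k) > 21/10"
  obtains j where "j < k" "norm (x j) \<le> 21/10" "\<And>i. j < i \<Longrightarrow> i \<le> k \<Longrightarrow> norm (x i) > 21/10"
proof -
  let ?A = "{j. j < k \<and> norm (x j) \<le> 21/10}"
  have fin: "finite ?A" by simp
  have "k \<noteq> 0" using assms by (metis not_le)
  then have ne: "?A \<noteq> {}" using assms(1) by auto
  define j where "j = Max ?A"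
  have "j \<in> ?A" unfolding j_def by (rule Max_in[OF fin ne])
  moreover have "norm (x i) > 21/10" if "j < i" "i \<le> k" for i
  proof (rule ccontr)
    assume *: "\<not> norm (x i) > 21/10"
    then have "i \<noteq> k" using assms(2) by auto
    then have "i \<in> ?A" using * that by auto
    then have "i \<le> j" unfolding j_def by (rule Max_ge[OF fin])
    then show False using that by simp
  qed
  ultimately show ?thesis using that by blast
qed

text \<open>\<open>escape\<close> needs a small value just before the two large ones, so the
  argument goes back to the last small index. It lies before \<open>k\<close>, hence the true
  exponent is at least the one stated.\<close>

lemma trace_growth:
  fixes x :: "nat \<Rightarrow> 'a::real_normed_field"
  assumes rec: "\<And>k. x (Suc (Suc (Suc k))) = x (Suc (Suc k)) * x (Suc k) - x k"
    and "norm (x 0) \<le> 21/10" "norm (x k) > 21/10" "norm (x (Suc k)) > 21/10"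
  shows "norm (x (Suc k + m)) > 21/10" "norm (x (Suc k + m)) \<ge> (11/10) ^ fib (Suc m)"
proof -
  obtain j where j: "j < k" "norm (x j) \<le> 21/10" "\<And>i. j < i \<Longrightarrow> i \<le> k \<Longrightarrow> norm (x i) > 21/10"
    using last_small_index[of x k] assms by metis
  define i where "i = Suc k + m - Suc j"
  have i: "Suc k + m = Suc j + i" "Suc m \<le> Suc i" using j(1) by (auto simp: i_def)
  have "norm (x (Suc (Suc j))) > 21/10"
    using j assms(4) by (cases "Suc j = k") auto
  from escape[OF rec j(2) _ this, of i] j
  have *: "norm (x (Suc j + i)) > 21/10" "norm (x (Suc j + i)) \<ge> (21/11) * (11/10) ^ fib (Suc i)"
    by auto
  show "norm (x (Suc k + m)) > 21/10" using * i by simp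
  have "(11/10::real) ^ fib (Suc m) \<le> (11/10) ^ fib (Suc i)"
    using i by (intro power_increasing fib_mono) auto
  also have "\<dots> \<le> (21/11) * (11/10) ^ fib (Suc i)" by simp
  finally show "norm (x (Suc k + m)) \<ge> (11/10) ^ fib (Suc m)" using * i by simp
qed

section \<open>Derivatives of the traces on the real bands\<close>

text \<open>
  In the next two lemmas \<open>p\<close>, \<open>q\<close>, \<open>b\<close> are three traces on the invariant surface with \<open>p\<close>, \<open>q\<close>
  bounded and \<open>b\<close> large, and \<open>p'\<close>, \<open>q'\<close>, \<open>b'\<close> their derivatives, tied by the differentiated invariant.
\<close>

lemma derivative_ratio_bounds:
  fixes p q b p' q' b' :: real
  assumes inv': "(2*p - q*b)*p' + (2*q - p*b)*q' + (2*b - p*q)*b' = 0"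
    and D: "\<bar>2*b - p*q\<bar> \<ge> d" "d > 0"
    and A: "\<bar>w*(2*q - p*b)\<bar> \<le> A * d" and B: "\<bar>w*(2*p - q*b)\<bar> \<le> B * d"
  shows "\<bar>w*b'\<bar> \<le> A * \<bar>q'\<bar> + B * \<bar>p'\<bar>"
proof -
  \<comment> \<open>The differentiated invariant is solved for \<open>w*b'\<close>. In the two
    growth steps the weight \<open>w\<close> is the factor, \<open>q\<close> or
    \<open>q^2 - 1\<close>, with which \<open>b'\<close> enters the new derivative.\<close>
  have "(2*b - p*q)*(w*b') = - ((w*(2*p - q*b))*p') - (w*(2*q - p*b))*q'"
    using arg_cong[OF inv', of "\<lambda>x. w * x"] by (simp add: algebra_simps)
  then have "\<bar>2*b - p*q\<bar> * \<bar>w*b'\<bar> = \<bar>- ((w*(2*p - q*b))*p') - (w*(2*q - p*b))*q'\<bar>"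
    by (metis abs_mult)
  also have "\<dots> \<le> \<bar>w*(2*p - q*b)\<bar> * \<bar>p'\<bar> + \<bar>w*(2*q - p*b)\<bar> * \<bar>q'\<bar>"
    by (simp only: abs_mult[symmetric])
  also have "\<dots> \<le> (B * d) * \<bar>p'\<bar> + (A * d) * \<bar>q'\<bar>"
    using A B by (intro add_mono mult_right_mono) auto
  finally have "\<bar>2*b - p*q\<bar> * \<bar>w*b'\<bar> \<le> d * (A * \<bar>q'\<bar> + B * \<bar>p'\<bar>)"
    by (simp add: algebra_simps)
  moreover have "d * \<bar>w*b'\<bar> \<le> \<bar>2*b - p*q\<bar> * \<bar>w*b'\<bar>"
    using D by (intro mult_right_mono) auto
  ultimately have "d * \<bar>w*b'\<bar> \<le> d * (A * \<bar>q'\<bar> + B * \<bar>p'\<bar>)" by linarith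
  then show ?thesis using D(2) by simp
qed

lemma derivative_growth_step1:
  fixes l p q b p' q' b' :: real
  assumes l: "l \<ge> 8" and inv: "p\<^sup>2 + q\<^sup>2 + b\<^sup>2 - p*q*b = 4 + l\<^sup>2"
    and inv': "(2*p - q*b)*p' + (2*q - p*b)*q' + (2*b - p*q)*b' = 0"
    and small: "\<bar>p\<bar> \<le> 21/10" "\<bar>q\<bar> \<le> 21/10" "\<bar>b*q - p\<bar> \<le> 21/10"
    and ratio: "(l - 4) * \<bar>p'\<bar> \<le> \<bar>q'\<bar>"
  shows "(l - 4) * \<bar>q'\<bar> \<le> \<bar>b' * q + b * q' - p'\<bar>"
proof -
  have bq: "\<bar>b*q\<bar> \<le> 42/10" using small by linarith
  have "\<bar>p\<bar> * \<bar>b*q\<bar> \<le> (21/10) * (42/10)" using small bq by (intro mult_mono) auto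
  then have pqb: "\<bar>p*q*b\<bar> \<le> 882/100" by (simp add: abs_mult mult_ac)
  have sq: "p\<^sup>2 \<le> (21/10)\<^sup>2" "q\<^sup>2 \<le> (21/10)\<^sup>2"
    using small by (metis abs_ge_zero power2_abs power_mono)+
  \<comment> \<open>The invariant forces \<open>b\<close> to be large; smallness of
    \<open>b*q - p\<close> then forces \<open>q\<close> to be small.\<close>
  have "b\<^sup>2 \<ge> (l - 1)\<^sup>2"
    using inv pqb sq l by (simp add: power2_eq_square algebra_simps)
  then have b: "\<bar>b\<bar> \<ge> l - 1"
    using l by (metis abs_le_square_iff abs_of_nonneg diff_ge_0_iff_ge one_le_numeral order_trans)
  then have b7: "\<bar>b\<bar> \<ge> 7" using l by linarith
  have "7 * \<bar>q\<bar> \<le> \<bar>b*q\<bar>" unfolding abs_mult using b7 by (intro mult_right_mono) auto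
  then have q: "\<bar>q\<bar> \<le> 6/10" using bq by linarith
  have "\<bar>p\<bar> * \<bar>q\<bar> \<le> (21/10) * (6/10)" using small q by (intro mult_mono) auto
  then have pq: "\<bar>p*q\<bar> \<le> 126/100" by (simp add: abs_mult)
  define d where "d = 2*\<bar>b\<bar> - 126/100"
  have D: "\<bar>2*b - p*q\<bar> \<ge> d" "d > 0" "d \<ge> 1274/100" unfolding d_def using pq b7 by linarith+
  have "q*(2*q - p*b) = 2*(q*q) - p*q*b" by (simp add: algebra_simps)
  then have "\<bar>q*(2*q - p*b)\<bar> \<le> 2*\<bar>q*q\<bar> + \<bar>p*q*b\<bar>" by linarith
  moreover have "\<bar>q\<bar>*\<bar>q\<bar> \<le> (6/10)*(6/10)" using q by (intro mult_mono) auto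
  ultimately have A: "\<bar>q*(2*q - p*b)\<bar> \<le> (9/10) * d"
    using pqb D(3) by (simp add: abs_mult)
  have "q*(2*p - q*b) = 2*(p*q) - q*(b*q)" by (simp add: algebra_simps)
  then have "\<bar>q*(2*p - q*b)\<bar> \<le> 2*\<bar>p*q\<bar> + \<bar>q\<bar>*\<bar>b*q\<bar>"
    unfolding abs_mult[of q "b*q", symmetric] by linarith
  moreover have "\<bar>q\<bar>*\<bar>b*q\<bar> \<le> (6/10)*(42/10)" using q bq by (intro mult_mono) auto
  ultimately have B: "\<bar>q*(2*p - q*b)\<bar> \<le> (1/2) * d" using pq D(3) by simp
  from derivative_ratio_bounds[OF inv' D(1,2) A B]
  have qb': "\<bar>q*b'\<bar> \<le> (9/10) * \<bar>q'\<bar> + (1/2) * \<bar>p'\<bar>" .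
  have p': "4 * \<bar>p'\<bar> \<le> \<bar>q'\<bar>"
    using ratio mult_right_mono[of 4 "l - 4" "\<bar>p'\<bar>"] l by linarith
  \<comment> \<open>This is the leading term. The others cost at most
    \<open>9/10 + 1/8 + 1/4\<close> times the modulus of \<open>q'\<close>, less than the gap 3
    between \<open>l - 1\<close> and \<open>l - 4\<close>.\<close>
  have "(l - 1) * \<bar>q'\<bar> \<le> \<bar>b * q'\<bar>" unfolding abs_mult using b by (intro mult_right_mono) auto
  moreover have "\<bar>b' * q + b * q' - p'\<bar> \<ge> \<bar>b * q'\<bar> - \<bar>q*b'\<bar> - \<bar>p'\<bar>"
    by (simp add: mult.commute)
  ultimately show ?thesis
    using qb' p' abs_ge_zero[of q'] unfolding left_diff_distrib by linarith
qed

text \<open>Here the trace \<open>b*q - p\<close> is skipped and smallness is known only one level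
  later. As \<open>b\<close> is large, smallness of \<open>(q^2 - 1)*b - p*q\<close> forces the
  modulus of \<open>q\<close> to be near 1. So the new derivative is essentially
  \<open>2*q*b*q'\<close>, and \<open>b'\<close> enters only with the weight
  \<open>q^2 - 1\<close>.\<close>

lemma derivative_growth_step2:
  fixes l p q b p' q' b' :: real
  assumes l: "l \<ge> 8" and inv: "p\<^sup>2 + q\<^sup>2 + b\<^sup>2 - p*q*b = 4 + l\<^sup>2"
    and inv': "(2*p - q*b)*p' + (2*q - p*b)*q' + (2*b - p*q)*b' = 0"
    and small: "\<bar>p\<bar> \<le> 21/10" "\<bar>q\<bar> \<le> 21/10" "\<bar>(b*q - p)*q - b\<bar> \<le> 21/10"
    and ratio: "(l - 4) * \<bar>p'\<bar> \<le> \<bar>q'\<bar>"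
  shows "(l - 4) * \<bar>q'\<bar> \<le> \<bar>(b'*q + b*q' - p')*q + (b*q - p)*q' - b'\<bar>"
proof -
  have sq: "p\<^sup>2 \<le> 441/100" "q\<^sup>2 \<le> 441/100"
    using small power_mono[of "\<bar>p\<bar>" "21/10" 2] power_mono[of "\<bar>q\<bar>" "21/10" 2]
    by (simp_all add: power2_eq_square)
  \<comment> \<open>The threshold 21/10 exceeds 2, so \<open>4 - p^2\<close> and
    \<open>4 - q^2\<close> may have opposite signs; expanding around 441/100 limits the
    loss.\<close>
  have "(441/100 - p\<^sup>2) * (441/100 - q\<^sup>2) \<ge> 0" using sq by simp
  moreover have "(4 - p\<^sup>2) * (4 - q\<^sup>2) = (441/100 - p\<^sup>2) * (441/100 - q\<^sup>2)
      + (41/100) * p\<^sup>2 + (41/100) * q\<^sup>2 - 34481/10000"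
    by (simp add: algebra_simps)
  ultimately have prod: "(4 - p\<^sup>2) * (4 - q\<^sup>2) \<ge> - 364/100"
    using zero_le_power2[of p] zero_le_power2[of q] by linarith
  \<comment> \<open>Completing the square in \<open>b\<close> turns the invariant into a lower bound
    for \<open>2*b - p*q\<close>, the coefficient of \<open>b'\<close>.\<close>
  have "(b - p*q/2)\<^sup>2 = l\<^sup>2 + (4 - p\<^sup>2) * (4 - q\<^sup>2) / 4"
    using inv by (simp add: power2_eq_square field_simps)
  also have "\<dots> \<ge> (l - 1/10)\<^sup>2"
  proof -
    have "(l - 1/10)\<^sup>2 \<le> l\<^sup>2 - 91/100" using l by (simp add: power2_eq_square algebra_simps)
    then show ?thesis using prod by linarith
  qed
  finally have "\<bar>b - p*q/2\<bar> \<ge> \<bar>l - 1/10\<bar>"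
    by (simp add: abs_le_square_iff)
  then have D0: "\<bar>b - p*q/2\<bar> \<ge> l - 1/10" by linarith
  have "\<bar>p\<bar> * \<bar>q\<bar> \<le> (21/10) * (21/10)" using small by (intro mult_mono) auto
  then have "\<bar>p*q\<bar> \<le> 441/100" by (simp add: abs_mult)
  then have b0: "\<bar>b\<bar> \<ge> 569/100" using D0 l by linarith
  have pq: "\<bar>p*q\<bar> \<le> (21/10) * \<bar>q\<bar>" unfolding abs_mult using small by (intro mult_right_mono) auto
  have expand: "(b*q - p)*q - b = (q\<^sup>2 - 1)*b - p*q" by (simp add: power2_eq_square algebra_simps)
  have q2b: "\<bar>(q\<^sup>2 - 1)*b\<bar> \<le> (21/10) * (1 + \<bar>q\<bar>)" 
  proof -
    have "\<bar>(q\<^sup>2 - 1)*b\<bar> \<le> \<bar>(q\<^sup>2 - 1)*b - p*q\<bar> + \<bar>p*q\<bar>" by simp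
    then show ?thesis using small(3) pq unfolding expand distrib_left by linarith
  qed
  have "\<bar>q\<^sup>2 - 1\<bar> = \<bar>\<bar>q\<bar>*\<bar>q\<bar> - 1\<bar>" by (simp add: power2_eq_square)
  also have "\<dots> = \<bar>(\<bar>q\<bar> - 1) * (1 + \<bar>q\<bar>)\<bar>" by (simp add: algebra_simps)
  finally have fac: "\<bar>q\<^sup>2 - 1\<bar> = \<bar>\<bar>q\<bar> - 1\<bar> * (1 + \<bar>q\<bar>)" by (simp add: abs_mult)
  have "(\<bar>\<bar>q\<bar> - 1\<bar> * \<bar>b\<bar>) * (1 + \<bar>q\<bar>) \<le> (21/10) * (1 + \<bar>q\<bar>)"
    using q2b unfolding abs_mult fac by (simp add: mult_ac)
  moreover have "1 + \<bar>q\<bar> > 0" by simp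
  ultimately have qb1: "\<bar>\<bar>q\<bar> - 1\<bar> * \<bar>b\<bar> \<le> 21/10" by (metis mult_le_cancel_right_pos)
  define e \<beta> Q where "e = \<bar>\<bar>q\<bar> - 1\<bar>" and "\<beta> = \<bar>b\<bar>" and "Q = \<bar>q\<bar>"
  have e: "Q - 1 \<le> e" "1 - Q \<le> e" "e \<ge> 0" "Q \<ge> 0" by (auto simp: e_def Q_def)
  have eb: "e * \<beta> \<le> 21/10" using qb1 by (simp add: e_def \<beta>_def)
  \<comment> \<open>Bootstrap: a crude bound on \<open>b\<close> bounds \<open>Q\<close>, this
    improves the bound on \<open>b\<close>, and that in turn confines \<open>Q\<close> to a
    neighbourhood of 1.\<close>
  have "e * (569/100) \<le> e * \<beta>" using b0 e by (intro mult_left_mono) (auto simp: \<beta>_def)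
  then have "Q \<le> 137/100" using eb e by linarith
  then have b1: "\<bar>b\<bar> \<ge> l - 154/100" using D0 pq unfolding Q_def by linarith
  have "e * (646/100) \<le> e * \<beta>" using b1 l e by (intro mult_left_mono) (auto simp: \<beta>_def)
  then have e2: "e \<le> 326/1000" using eb by linarith
  then have "Q \<le> 1326/1000" using e by linarith
  with e2 have q1: "\<bar>\<bar>q\<bar> - 1\<bar> \<le> 326/1000" "\<bar>q\<bar> \<le> 1326/1000" by (simp_all add: e_def Q_def)
  define w where "w = q\<^sup>2 - 1"
  have "\<bar>w\<bar> \<le> (326/1000) * (1 + 1326/1000)"
    unfolding w_def fac using q1 by (intro mult_mono) auto
  then have w: "\<bar>w\<bar> \<le> 76/100" by simp
  have wb: "\<bar>w*b\<bar> \<le> 49/10" 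
  proof -
    have "(21/10) * (1 + \<bar>q\<bar>) \<le> 49/10" using q1(2) by simp
    then show ?thesis unfolding w_def using q2b by linarith
  qed
  define d where "d = 2*l - 2/10"
  have D: "\<bar>2*b - p*q\<bar> \<ge> d" "d > 0" "d \<ge> 158/10" unfolding d_def using D0 l by linarith+
  have "\<bar>w*q\<bar> \<le> (76/100)*(1326/1000)" unfolding abs_mult using w q1 by (intro mult_mono) auto
  moreover have "\<bar>p*(w*b)\<bar> \<le> (21/10)*(49/10)"
    unfolding abs_mult[of p] using small wb by (intro mult_mono) auto
  moreover have "w*(2*q - p*b) = 2*(w*q) - p*(w*b)" by (simp add: algebra_simps)
  then have "\<bar>w*(2*q - p*b)\<bar> \<le> 2*\<bar>w*q\<bar> + \<bar>p*(w*b)\<bar>" by linarith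
  ultimately have A: "\<bar>w*(2*q - p*b)\<bar> \<le> (8/10) * d" using D(3) by linarith
  have "\<bar>w*p\<bar> \<le> (76/100)*(21/10)" unfolding abs_mult using w small by (intro mult_mono) auto
  moreover have "\<bar>q*(w*b)\<bar> \<le> (1326/1000)*(49/10)"
    unfolding abs_mult[of q] using q1 wb by (intro mult_mono) auto
  moreover have "w*(2*p - q*b) = 2*(w*p) - q*(w*b)" by (simp add: algebra_simps)
  then have "\<bar>w*(2*p - q*b)\<bar> \<le> 2*\<bar>w*p\<bar> + \<bar>q*(w*b)\<bar>" by linarith
  ultimately have B: "\<bar>w*(2*p - q*b)\<bar> \<le> (7/10) * d" using D(3) by linarith
  from derivative_ratio_bounds[OF inv' D(1,2) A B]
  have wb': "\<bar>w*b'\<bar> \<le> (8/10) * \<bar>q'\<bar> + (7/10) * \<bar>p'\<bar>" .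
  have p': "4 * \<bar>p'\<bar> \<le> \<bar>q'\<bar>"
    using ratio mult_right_mono[of 4 "l - 4" "\<bar>p'\<bar>"] l by linarith
  have "(1 - Q) * \<beta> \<le> e * \<beta>" using e by (intro mult_right_mono) (auto simp: \<beta>_def)
  moreover have "\<beta> \<ge> l - 154/100" using b1 by (simp add: \<beta>_def)
  ultimately have "Q * \<beta> \<ge> l - 364/100" using eb unfolding left_diff_distrib by linarith
  then have "\<bar>q\<bar>*\<bar>b\<bar> \<ge> l - 364/100" by (simp add: Q_def \<beta>_def)
  then have "\<bar>2*q*b\<bar> \<ge> 2*l - 728/100" by (simp add: abs_mult)
  then have "\<bar>2*q*b - p\<bar> \<ge> 2*l - 938/100" using small by linarith
  then have "(2*l - 938/100) * \<bar>q'\<bar> \<le> \<bar>2*q*b - p\<bar> * \<bar>q'\<bar>" by (intro mult_right_mono) auto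
  moreover have "(l - 4) * \<bar>q'\<bar> \<le> (2*l - 938/100 - 18/10) * \<bar>q'\<bar>"
    using l by (intro mult_right_mono) auto
  moreover have "(2*l - 938/100 - 18/10) * \<bar>q'\<bar> = (2*l - 938/100) * \<bar>q'\<bar> - 18/10 * \<bar>q'\<bar>"
    by (rule left_diff_distrib)
  ultimately have M: "(l - 4) * \<bar>q'\<bar> + 18/10 * \<bar>q'\<bar> \<le> \<bar>(2*q*b - p) * q'\<bar>"
    unfolding abs_mult by linarith
  have Q': "\<bar>q*p'\<bar> \<le> (1326/1000) * \<bar>p'\<bar>"
    unfolding abs_mult using q1 by (intro mult_right_mono) auto
  have expand': "(b'*q + b*q' - p')*q + (b*q - p)*q' - b' = (2*q*b - p)*q' - q*p' + w*b'"
    by (simp add: w_def power2_eq_square algebra_simps)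
  \<comment> \<open>The losses are at most \<open>8/10 + (1326/1000 + 7/10) / 4\<close> times
    \<open>y\<close>, within the reserve of 18/10.\<close>
  have *: "G \<le> \<bar>m - s + r\<bar>"
    if "G + 18/10 * y \<le> \<bar>m\<bar>" "\<bar>s\<bar> \<le> (1326/1000) * P" "\<bar>r\<bar> \<le> (8/10) * y + (7/10) * P" "4 * P \<le> y" "0 \<le> y"
    for G m s r P y :: real
    using that by linarith
  show ?thesis unfolding expand' by (rule *[OF M Q' wb' p']) simp
qed

text \<open>
  If the trace at level \<open>k + 1\<close> is small, so is one of its two predecessors, and the derivative gains a
  factor \<open>l - 4\<close> over the nearest small predecessor. Three consecutive small traces contradict the
  invariant, so the induction only ever meets the two configurations treated above.
\<close>

lemma trace_deriv_bound:
  fixes l x :: real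
  assumes l: "l \<ge> 8"
  defines "\<tau> \<equiv> \<lambda>k. poly (trace_poly l k) x" and "\<tau>' \<equiv> \<lambda>k. poly (pderiv (trace_poly l k)) x"
  assumes "\<bar>\<tau> (Suc k)\<bar> \<le> 21/10"
  shows "\<bar>\<tau>' (Suc k)\<bar> \<ge> sqrt (l - 4) powr (real k - 1)"
proof -
  let ?sm = "\<lambda>k. \<bar>\<tau> k\<bar> \<le> 21/10"
  have rec: "\<tau> (Suc (Suc (Suc j))) = \<tau> (Suc (Suc j)) * \<tau> (Suc j) - \<tau> j" for j
    by (simp add: \<tau>_def)
  have rec': "\<tau>' (Suc (Suc (Suc j))) = \<tau>' (Suc (Suc j)) * \<tau> (Suc j) + \<tau> (Suc (Suc j)) * \<tau>' (Suc j) - \<tau>' j" for j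
    by (simp add: \<tau>_def \<tau>'_def pderiv_diff pderiv_mult)
  have inv: "(\<tau> j)\<^sup>2 + (\<tau> (Suc j))\<^sup>2 + (\<tau> (Suc (Suc j)))\<^sup>2 - \<tau> j * \<tau> (Suc j) * \<tau> (Suc (Suc j)) = 4 + l\<^sup>2" for j
    unfolding \<tau>_def by (rule trace_invariant)
  have inv': "(2 * \<tau> j - \<tau> (Suc j) * \<tau> (Suc (Suc j))) * \<tau>' j
      + (2 * \<tau> (Suc j) - \<tau> j * \<tau> (Suc (Suc j))) * \<tau>' (Suc j)
      + (2 * \<tau> (Suc (Suc j)) - \<tau> j * \<tau> (Suc j)) * \<tau>' (Suc (Suc j)) = 0" for j
  proof -
    let ?F = "\<lambda>x. (poly (trace_poly l j) x)\<^sup>2 + (poly (trace_poly l (Suc j)) x)\<^sup>2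
       + (poly (trace_poly l (Suc (Suc j))) x)\<^sup>2
       - poly (trace_poly l j) x * poly (trace_poly l (Suc j)) x * poly (trace_poly l (Suc (Suc j))) x"
    have "(?F has_real_derivative
       (2 * \<tau> j - \<tau> (Suc j) * \<tau> (Suc (Suc j))) * \<tau>' j
      + (2 * \<tau> (Suc j) - \<tau> j * \<tau> (Suc (Suc j))) * \<tau>' (Suc j)
      + (2 * \<tau> (Suc (Suc j)) - \<tau> j * \<tau> (Suc j)) * \<tau>' (Suc (Suc j))) (at x)"
      unfolding \<tau>_def \<tau>'_def
      by (auto intro!: derivative_eq_intros poly_DERIV simp: algebra_simps)
    moreover have "?F = (\<lambda>x. 4 + l\<^sup>2)" by (rule ext) (rule trace_invariant)
    then have "(?F has_real_derivative 0) (at x)" by simp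
    ultimately show ?thesis by (rule DERIV_unique)
  qed
  have not3: False if "?sm j" "?sm (Suc j)" "?sm (Suc (Suc j))" for j
  proof -
    have sq: "(\<tau> j)\<^sup>2 \<le> (21/10)\<^sup>2" "(\<tau> (Suc j))\<^sup>2 \<le> (21/10)\<^sup>2" "(\<tau> (Suc (Suc j)))\<^sup>2 \<le> (21/10)\<^sup>2"
      using that by (metis abs_ge_zero power2_abs power_mono)+
    have "\<bar>\<tau> j * \<tau> (Suc j) * \<tau> (Suc (Suc j))\<bar> \<le> (21/10) * (21/10) * (21/10)"
      unfolding abs_mult using that by (intro mult_mono) auto
    then have "l\<^sup>2 \<le> 30" using inv[of j] sq by (simp add: power2_eq_square)
    moreover have "8 * 8 \<le> l * l" using l by (intro mult_mono) auto
    ultimately show False by (simp add: power2_eq_square)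
  qed
  have sm0: "?sm 0" "\<tau>' 0 = 0" by (simp_all add: \<tau>_def \<tau>'_def pderiv_pCons)
  have esc: "?sm (Suc j) \<or> ?sm (Suc (Suc j))" if "?sm (Suc (Suc (Suc j)))" for j
  proof (rule ccontr)
    \<comment> \<open>Two consecutive large traces would keep all later ones large.\<close>
    assume "\<not> (?sm (Suc j) \<or> ?sm (Suc (Suc j)))"
    then have "norm (\<tau> (Suc (Suc j) + 1)) > 21/10"
      by (intro trace_growth(1)[where x = \<tau>]) (use sm0 rec in auto)
    then show False using that by simp
  qed
  have key: "(?sm k \<longrightarrow> (l - 4) * \<bar>\<tau>' k\<bar> \<le> \<bar>\<tau>' (Suc k)\<bar>)
    \<and> (\<not> ?sm k \<longrightarrow> k \<ge> 1 \<and> ?sm (k - 1) \<and> (l - 4) * \<bar>\<tau>' (k - 1)\<bar> \<le> \<bar>\<tau>' (Suc k)\<bar>)"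
    if "?sm (Suc k)" for k
    using that
  proof (induction k rule: less_induct)
    case (less k)
    consider "k = 0" | "k = 1" | j where "k = Suc (Suc j)"
      by (metis One_nat_def not0_implies_Suc)
    then show ?case
    proof cases
      case 1
      then show ?thesis using sm0 by simp
    next
      case 2
      \<comment> \<open>The traces \<open>x\<close> and \<open>x - l\<close> cannot both be small,
        so the small predecessor is index 0, where the derivative vanishes.\<close>
      then have "\<bar>x - l\<bar> \<le> 21/10" using less.prems by (simp add: \<tau>_def)
      then have "\<not> \<bar>x\<bar> \<le> 21/10" using l by linarith
      then have "\<not> ?sm 1" by (simp add: \<tau>_def)
      then show ?thesis using 2 sm0 by simp
    next
      case 3
      have j3: "?sm (Suc (Suc (Suc j)))" using less.prems 3 by simp
      show ?thesis
      proof (cases "?sm (Suc (Suc j))")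
        case True
        then have "\<not> ?sm (Suc j)" using not3[of "Suc j"] j3 by blast
        with less.IH[of "Suc j"] True 3
        have "?sm j" "(l - 4) * \<bar>\<tau>' j\<bar> \<le> \<bar>\<tau>' (Suc (Suc j))\<bar>" by auto
        from derivative_growth_step1[OF l _ _ this(1) True _ this(2), of "\<tau> (Suc j)" "\<tau>' (Suc j)"]
        have "(l - 4) * \<bar>\<tau>' (Suc (Suc j))\<bar> \<le> \<bar>\<tau>' (Suc (Suc (Suc j)))\<bar>"
          using inv[of j] inv'[of j] j3 rec[of j] rec'[of j] by (simp add: algebra_simps)
        then show ?thesis using True 3 by simp
      next
        case False
        then have s1: "?sm (Suc j)" using esc[OF j3] by blast
        have "(l - 4) * \<bar>\<tau>' (Suc j)\<bar> \<le> \<bar>\<tau>' (Suc (Suc (Suc j)))\<bar>"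
        proof (cases "?sm j")
          case True
          with less.IH[of j] s1 3 have "(l - 4) * \<bar>\<tau>' j\<bar> \<le> \<bar>\<tau>' (Suc j)\<bar>" by auto
          from derivative_growth_step1[OF l _ _ True s1 _ this, of "\<tau> (Suc (Suc j))" "\<tau>' (Suc (Suc j))"]
          show ?thesis
            using inv[of j] inv'[of j] j3 rec[of j] rec'[of j] by simp
        next
          case F: False
          with less.IH[of j] s1 3 obtain i where i: "j = Suc i" "?sm i"
            "(l - 4) * \<bar>\<tau>' i\<bar> \<le> \<bar>\<tau>' (Suc (Suc i))\<bar>"
            by (cases j) auto
          \<comment> \<open>The traces at \<open>i\<close> to \<open>i + 4\<close> are small, large,
            small, large, small.\<close>
          have q: "?sm (Suc (Suc i))" using s1 i by simp
          have r3: "\<tau> (Suc (Suc (Suc i))) = \<tau> (Suc i) * \<tau> (Suc (Suc i)) - \<tau> i"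
            "\<tau>' (Suc (Suc (Suc i))) = \<tau>' (Suc i) * \<tau> (Suc (Suc i)) + \<tau> (Suc i) * \<tau>' (Suc (Suc i)) - \<tau>' i"
            using rec[of i] rec'[of i] by (simp_all add: algebra_simps)
          have r4: "\<tau> (Suc (Suc (Suc (Suc i)))) = \<tau> (Suc (Suc (Suc i))) * \<tau> (Suc (Suc i)) - \<tau> (Suc i)"
            "\<tau>' (Suc (Suc (Suc (Suc i)))) = \<tau>' (Suc (Suc (Suc i))) * \<tau> (Suc (Suc i))
               + \<tau> (Suc (Suc (Suc i))) * \<tau>' (Suc (Suc i)) - \<tau>' (Suc i)"
            using rec[of "Suc i"] rec'[of "Suc i"] by simp_all
          have "\<bar>(\<tau> (Suc i) * \<tau> (Suc (Suc i)) - \<tau> i) * \<tau> (Suc (Suc i)) - \<tau> (Suc i)\<bar> \<le> 21/10"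
            using j3 unfolding i r4 r3 .
          from derivative_growth_step2[OF l _ _ i(2) q this i(3), of "\<tau>' (Suc i)"]
          show ?thesis
            unfolding i(1) r4 r3 using inv[of i] inv'[of i] by (simp add: algebra_simps)
        qed
        then show ?thesis using False s1 3 by simp
      qed
    qed
  qed
  define S where "S = sqrt (l - 4)"
  have S: "S \<ge> 1" "S * S = l - 4" using l by (auto simp: S_def)
  \<comment> \<open>A factor \<open>S * S\<close> is gained over at most two levels, that is, at
    least \<open>S\<close> per level; the offset -1 covers index 1, where the derivative is
    1.\<close>
  have main: "\<bar>\<tau>' (Suc k)\<bar> \<ge> S powr (real k - 1)" if "?sm (Suc k)" for k
    using that
  proof (induction k rule: less_induct)
    case (less k)
    have step: "(l - 4) * S powr (real k - 3) = S powr (real k - 1)"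
      using S powr_add[of S 2 "real k - 3"] by (simp add: power2_eq_square)
    have step': "(l - 4) * S powr (real k - 2) \<ge> S powr (real k - 1)"
    proof -
      have "(l - 4) * S powr (real k - 3) \<le> (l - 4) * S powr (real k - 2)"
        using S l by (intro mult_left_mono powr_mono) auto
      then show ?thesis using step by simp
    qed
    consider "k = 0" | "k = 1" | j where "k = Suc (Suc j)"
      by (metis One_nat_def not0_implies_Suc)
    then show ?case
    proof cases
      case 1
      then show ?thesis using S powr_mono[of "-1" 0 S] by (simp add: \<tau>'_def pderiv_pCons)
    next
      case 2
      then show ?thesis using S by (simp add: \<tau>'_def pderiv_pCons)
    next
      case 3
      show ?thesis
      proof (cases "?sm k")
        case True
        with less.IH[of "Suc j"] 3 have "S powr (real k - 2) \<le> \<bar>\<tau>' k\<bar>" by simp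
        then have "(l - 4) * S powr (real k - 2) \<le> (l - 4) * \<bar>\<tau>' k\<bar>"
          using l by (intro mult_left_mono) auto
        then show ?thesis using key[OF less.prems] True step' by linarith
      next
        case False
        with key[OF less.prems] 3 have a: "?sm (Suc j)" "(l - 4) * \<bar>\<tau>' (Suc j)\<bar> \<le> \<bar>\<tau>' (Suc k)\<bar>" by auto
        with less.IH[of j] 3 have "S powr (real k - 3) \<le> \<bar>\<tau>' (Suc j)\<bar>" by simp
        then have "(l - 4) * S powr (real k - 3) \<le> (l - 4) * \<bar>\<tau>' (Suc j)\<bar>"
          using l by (intro mult_left_mono) auto
        then show ?thesis using a step by linarith
      qed
    qed
  qed
  show ?thesis using main assms(4) by (simp add: S_def)
qed

section \<open>Transfer matrices\<close>

datatype mat2 = Mat2 (m11: complex) (m12: complex) (m21: complex) (m22: complex)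

instantiation mat2 :: monoid_mult
begin

definition one_mat2 :: mat2 where "one_mat2 = Mat2 1 0 0 1"

definition times_mat2 :: "mat2 \<Rightarrow> mat2 \<Rightarrow> mat2" where
  "times_mat2 A B = Mat2 (m11 A * m11 B + m12 A * m21 B) (m11 A * m12 B + m12 A * m22 B)
     (m21 A * m11 B + m22 A * m21 B) (m21 A * m12 B + m22 A * m22 B)"

instance
  by standard (auto simp: times_mat2_def one_mat2_def algebra_simps)

end

definition mat_app :: "mat2 \<Rightarrow> complex \<times> complex \<Rightarrow> complex \<times> complex" where
  "mat_app A U = (m11 A * fst U + m12 A * snd U, m21 A * fst U + m22 A * snd U)"

definition mat_trace :: "mat2 \<Rightarrow> complex" where "mat_trace A = m11 A + m22 A"

definition mat_det :: "mat2 \<Rightarrow> complex" where "mat_det A = m11 A * m22 A - m12 A * m21 A"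

lemma mat_app_mult: "mat_app (A * B) U = mat_app A (mat_app B U)"
  by (simp add: mat_app_def times_mat2_def algebra_simps)

lemma mat_app_one [simp]: "mat_app 1 U = U"
  by (simp add: mat_app_def one_mat2_def)

lemma mat_det_mult: "mat_det (A * B) = mat_det A * mat_det B"
  by (simp add: mat_det_def times_mat2_def algebra_simps)

lemma cayley_hamilton:
  assumes "mat_det A = 1"
  shows "mat_trace A * fst (mat_app A U) = fst U + fst (mat_app A (mat_app A U))"
    and "mat_trace A * snd (mat_app A U) = snd U + snd (mat_app A (mat_app A U))"
proof -
  have "m11 A * m22 A = 1 + m12 A * m21 A" using assms by (simp add: mat_det_def algebra_simps)
  then show "mat_trace A * fst (mat_app A U) = fst U + fst (mat_app A (mat_app A U))"
    and "mat_trace A * snd (mat_app A U) = snd U + snd (mat_app A (mat_app A U))"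
    unfolding mat_trace_def mat_app_def fst_conv snd_conv by algebra+
qed

text \<open>It sends \<open>(u n, u (n - 1))\<close> to \<open>(u (n + 1), u n)\<close> for a
  solution \<open>u\<close> of the difference equation with potential value \<open>v\<close> and
  energy \<open>z\<close>.\<close>

definition site_matrix :: "complex \<Rightarrow> complex \<Rightarrow> mat2" where
  "site_matrix z v = Mat2 (z - v) (-1) 1 0"

lemma mat_det_site_matrix: "mat_det (site_matrix z v) = 1"
  by (simp add: mat_det_def site_matrix_def)

text \<open>Later sites multiply from the left, so the word of level \<open>k + 2\<close> is the
  word of level \<open>k + 1\<close> followed by that of level \<open>k\<close>.\<close>

fun fib_matrix :: "complex \<Rightarrow> complex \<Rightarrow> nat \<Rightarrow> mat2" where
  "fib_matrix z l 0 = site_matrix z 0"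
| "fib_matrix z l (Suc 0) = site_matrix z l"
| "fib_matrix z l (Suc (Suc k)) = fib_matrix z l k * fib_matrix z l (Suc k)"

lemma mat_det_fib_matrix: "mat_det (fib_matrix z l k) = 1"
  by (induction z l k rule: fib_matrix.induct) (simp_all add: mat_det_site_matrix mat_det_mult)

text \<open>By cyclicity the left side is the trace of \<open>B * A * A\<close>, and Cayley-Hamilton
  reduces the square of \<open>A\<close>. For two consecutive Fibonacci matrices this is the
  recursion of \<open>trace_poly\<close>.\<close>

lemma mat_trace_mult_conj:
  assumes "mat_det A = 1"
  shows "mat_trace (A * (B * A)) = mat_trace (B * A) * mat_trace A - mat_trace B"
proof -
  have "m11 A * m22 A = 1 + m12 A * m21 A" using assms by (simp add: mat_det_def algebra_simps)
  then show ?thesis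
    unfolding mat_trace_def times_mat2_def mat2.sel by algebra
qed

lemma mat_trace_fib_matrix: "mat_trace (fib_matrix z l k) = poly (trace_poly l (Suc k)) z"
proof (induction k rule: less_induct)
  case (less k)
  consider "k = 0" | "k = Suc 0" | "k = Suc (Suc 0)" | j where "k = Suc (Suc (Suc j))"
    by (metis not0_implies_Suc)
  then show ?case
  proof cases
    case (4 j)
    have "mat_trace (fib_matrix z l k) = mat_trace (fib_matrix z l (Suc (Suc j)))
        * mat_trace (fib_matrix z l (Suc j)) - mat_trace (fib_matrix z l j)"
      using mat_trace_mult_conj[OF mat_det_fib_matrix, of z l "Suc j" "fib_matrix z l j"]
      by (simp add: 4)
    then show ?thesis using less.IH[of "Suc (Suc j)"] less.IH[of "Suc j"] less.IH[of j] 4 by simp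
  qed (simp_all add: mat_trace_def site_matrix_def times_mat2_def algebra_simps)
qed

section \<open>Real-rootedness of the traces\<close>

text \<open>Up to a constant factor this is the Wronskian of a solution with its complex
  conjugate.\<close>

definition current :: "complex \<times> complex \<Rightarrow> real" where "current U = Im (fst U * cnj (snd U))"

text \<open>The real potential contributes a real term and drops out; only the imaginary part of the
  energy creates current.\<close>

lemma current_site_matrix:
  "current (mat_app (site_matrix z (of_real v)) U) = current U + Im z * (cmod (fst U))\<^sup>2"
  unfolding current_def mat_app_def site_matrix_def cmod_power2
  by (simp add: algebra_simps power2_eq_square)

lemma current_fib_matrix_mono:
  assumes "Im z > 0"
  shows "current U \<le> current (mat_app (fib_matrix z (of_real l) k) U)"
  using assms
proof (induction z "of_real l :: complex" k arbitrary: U rule: fib_matrix.induct)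
  case (1 z)
  then show ?case using current_site_matrix[of z 0 U] by simp
next
  case (2 z)
  then show ?case using current_site_matrix[of z l U] by simp
next
  case (3 z k)
  then show ?case unfolding fib_matrix.simps mat_app_mult by (metis order_trans)
qed

text \<open>One site creates no current if the first component vanishes, but then the next site
  does. From level 2 on the word has at least two sites.\<close>

lemma current_fib_matrix_strict:
  assumes "Im z > 0" "U \<noteq> (0, 0)"
  shows "current U < current (mat_app (fib_matrix z (of_real l) (Suc (Suc k))) U)"
proof (induction k)
  case 0
  define U' where "U' = mat_app (site_matrix z (of_real l)) U"
  have 1: "current U' = current U + Im z * (cmod (fst U))\<^sup>2"
    unfolding U'_def by (rule current_site_matrix)
  have 2: "current (mat_app (site_matrix z 0) U') = current U' + Im z * (cmod (fst U'))\<^sup>2"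
    using current_site_matrix[of z 0 U'] by simp
  have "fst U \<noteq> 0 \<or> fst U' \<noteq> 0"
    using assms(2) by (cases U) (auto simp: U'_def mat_app_def site_matrix_def)
  then have "Im z * (cmod (fst U))\<^sup>2 + Im z * (cmod (fst U'))\<^sup>2 > 0"
    using assms(1) by (auto intro: add_pos_nonneg add_nonneg_pos)
  then show ?case using 1 2 by (simp add: mat_app_mult U'_def)
next
  case (Suc k)
  have "current (mat_app (fib_matrix z (of_real l) (Suc (Suc k))) U)
      \<le> current (mat_app (fib_matrix z (of_real l) (Suc k)) (mat_app (fib_matrix z (of_real l) (Suc (Suc k))) U))"
    by (rule current_fib_matrix_mono) fact
  then show ?case using Suc.IH
    by (simp add: mat_app_mult[of _ "fib_matrix z (of_real l) (Suc (Suc k))"] fib_matrix.simps(3)[of _ _ "Suc k"]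
        del: fib_matrix.simps(3))
qed

text \<open>A matrix of determinant 1 and trace 0 squares to -1. This preserves the current of
  \<open>U\<close>, whereas in the upper half plane each application strictly increases it.
  Conjugation covers the lower half plane.\<close>

lemma trace_poly_root_real:
  assumes "poly (trace_poly (of_real l) k) z = 0"
  shows "Im z = 0"
proof -
  have *: "\<not> Im z > 0" if "poly (trace_poly (of_real l) k) z = 0" for z
  proof
    assume z: "Im z > 0"
    consider "k = 0" | "k = Suc 0" | "k = Suc (Suc 0)" | j where "k = Suc (Suc (Suc j))"
      by (metis not0_implies_Suc)
    then show False
    proof cases
      case 1
      then show False using that by simp
    next
      case 2
      then show False using that z by simp
    next
      case 3
      then show False using that z by simp
    next
      case (4 j)
      let ?M = "fib_matrix z (of_real l) (Suc (Suc j))"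
      have tr: "mat_trace ?M = 0" using that 4 by (simp only: mat_trace_fib_matrix)
      define U :: "complex \<times> complex" where "U = (1, 0)"
      have nz: "mat_app ?M U \<noteq> (0, 0)"
        using mat_det_fib_matrix[of z "of_real l" "Suc (Suc j)"]
        by (auto simp: mat_app_def U_def mat_det_def)
      have "current U < current (mat_app ?M U)"
        by (rule current_fib_matrix_strict) (use z U_def in auto)
      also have "\<dots> < current (mat_app ?M (mat_app ?M U))"
        by (rule current_fib_matrix_strict) (use z nz in auto)
      also have "mat_app ?M (mat_app ?M U) = (- fst U, - snd U)"
        using cayley_hamilton[OF mat_det_fib_matrix, of z "of_real l" "Suc (Suc j)" U] tr
        by (simp add: prod_eq_iff eq_neg_iff_add_eq_0 add.commute)
      also have "current (- fst U, - snd U) = current U" by (simp add: current_def)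
      finally show False by simp
    qed
  qed
  have "poly (trace_poly (of_real l) k) (cnj z) = 0"
    using assms by (simp add: poly_trace_poly_cnj)
  from *[OF assms] *[OF this] show ?thesis by simp
qed

section \<open>Lower bounds for the traces off the real axis\<close>

text \<open>Each linear factor \<open>z - e\<close> with real \<open>e\<close> loses modulus when
  \<open>z\<close> is projected to the real axis.\<close>

lemma cmod_poly_real_roots_ge:
  fixes p :: "complex poly"
  assumes "\<And>z. poly p z = 0 \<Longrightarrow> Im z = 0"
  shows "cmod (poly p (of_real (Re z))) \<le> cmod (poly p z)"
  using assms
proof (induction "degree p" arbitrary: p)
  case 0
  then obtain c where "p = [:c:]" by (metis degree_eq_zeroE)
  then show ?case by simp
next
  case (Suc n)
  then obtain e where e: "poly p e = 0"
    using alg_closed_imp_poly_has_root[of p] by auto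
  then obtain q where q: "p = [:- e, 1:] * q" by (auto simp: poly_eq_0_iff_dvd)
  have "q \<noteq> 0" using Suc.hyps(2) q by auto
  then have "degree p = Suc (degree q)" unfolding q by (subst degree_mult_eq) auto
  then have "n = degree q" using Suc.hyps(2) by simp
  from Suc.hyps(1)[OF this] Suc.prems have IH: "cmod (poly q (of_real (Re z))) \<le> cmod (poly q z)"
    by (simp add: q)
  have "Im e = 0" using Suc.prems e by blast
  then have "cmod (of_real (Re z) - e) \<le> cmod (z - e)"
    by (simp add: cmod_def)
  then have "cmod (of_real (Re z) - e) * cmod (poly q (of_real (Re z))) \<le> cmod (z - e) * cmod (poly q z)"
    using IH by (intro mult_mono) auto
  then show ?case by (simp add: q norm_mult[symmetric] algebra_simps)
qed

text \<open>While \<open>f\<close> stays in the band up to \<open>c\<close>, its derivative cannot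
  vanish and so keeps its sign; \<open>f\<close> therefore descends with slope at least
  \<open>D\<close> until it reaches 0.\<close>

lemma root_near_steep_point:
  fixes f f' :: "real \<Rightarrow> real"
  assumes der: "\<And>x. (f has_real_derivative f' x) (at x)" and cont: "continuous_on UNIV f'"
    and D: "D > 0" "\<And>x. \<bar>f x\<bar> \<le> c \<Longrightarrow> \<bar>f' x\<bar> \<ge> D" and x: "0 \<le> f x" "f x \<le> c" "f' x < 0"
  obtains e where "x \<le> e" "f e = 0" "D * (e - x) \<le> f x"
proof -
  have contf: "isCont f y" for y by (rule DERIV_isCont[OF der])
  have dec: "f' y < 0 \<and> 0 < f y \<and> f y \<le> c"
    if y: "x \<le> y" "\<And>s. x \<le> s \<Longrightarrow> s \<le> y \<Longrightarrow> f s > 0" for y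
  proof -
    have neg: "f' y' < 0" if y': "x \<le> y'" "y' \<le> y" for y'
    proof (rule ccontr)
      assume "\<not> f' y' < 0"
      \<comment> \<open>Up to the first zero of \<open>f'\<close> the function has not risen above
        \<open>f x\<close>, so that zero lies in the band, where the slope bound excludes
        it.\<close>
      let ?Z = "{s \<in> {x..y'}. f' s = 0}"
      have "\<exists>s\<ge>x. s \<le> y' \<and> f' s = 0"
        by (rule IVT') (use x y' \<open>\<not> f' y' < 0\<close> continuous_on_subset[OF cont] in auto)
      then have ne: "?Z \<noteq> {}" by auto
      have "closed ?Z"
        using continuous_closed_preimage_constant[OF continuous_on_subset[OF cont, of "{x..y'}"]] by simp
      then have Inf: "Inf ?Z \<in> ?Z" by (intro closed_contains_Inf ne bdd_belowI[of _ x]) auto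
      define s where "s = Inf ?Z"
      have s: "x \<le> s" "s \<le> y'" "f' s = 0" using Inf by (auto simp: s_def)
      have lt: "f' r \<le> 0" if "x \<le> r" "r \<le> s" for r
      proof (rule ccontr)
        assume "\<not> f' r \<le> 0"
        then have "\<exists>q\<ge>x. q \<le> r \<and> f' q = 0"
          by (intro IVT') (use x that continuous_on_subset[OF cont] in auto)
        then obtain q where q: "x \<le> q" "q \<le> r" "f' q = 0" by blast
        then have "s \<le> q" unfolding s_def
          by (intro cInf_lower bdd_belowI[of _ x]) (use that s in auto)
        then have "q = r" using q that by auto
        then show False using q \<open>\<not> f' r \<le> 0\<close> by simp
      qed
      have "f s \<le> f x"
        by (rule DERIV_nonpos_imp_nonincreasing[OF s(1)]) (use lt der in blast)
      moreover have "f s > 0" using that s y' y(2)[of s] by auto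
      ultimately have "\<bar>f' s\<bar> \<ge> D" using D(2)[of s] x by auto
      then show False using s D by simp
    qed
    have "f y \<le> f x"
      by (rule DERIV_nonpos_imp_nonincreasing[OF y(1)]) (use neg der less_imp_le in blast)
    then show ?thesis using neg[of y] y x by auto
  qed
  have slope: "f y \<le> f x - D * (y - x)"
    if y: "x \<le> y" "\<And>s. x \<le> s \<Longrightarrow> s < y \<Longrightarrow> f s > 0" for y
  proof (cases "x = y")
    case False
    then have "x < y" using y by simp
    from MVT2[OF this, of f f'] der obtain z where z: "x < z" "z < y" "f y - f x = (y - x) * f' z"
      by blast
    have d: "f' z < 0 \<and> 0 < f z \<and> f z \<le> c" by (rule dec) (use z y in auto)
    then have "f' z \<le> - D" using D(2)[of z] by auto
    then have "(y - x) * f' z \<le> (y - x) * (- D)" using \<open>x < y\<close> by (intro mult_left_mono) auto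
    then show ?thesis using z(3) by (simp add: algebra_simps)
  qed simp
  let ?Z = "{s. x \<le> s \<and> f s = 0}"
  have ne: "?Z \<noteq> {}"
  proof
    assume E: "?Z = {}"
    have pos: "f s > 0" if "x \<le> s" for s
    proof (rule ccontr)
      assume "\<not> f s > 0"
      then have "\<exists>q\<ge>x. q \<le> s \<and> f q = 0"
        by (intro IVT2') (use x that contf in \<open>auto intro: continuous_at_imp_continuous_on\<close>)
      then show False using E by auto
    qed
    \<comment> \<open>By this point a descent of slope \<open>D\<close> has used up the whole height
      \<open>f x\<close>.\<close>
    have "f (x + f x / D) \<le> f x - D * (x + f x / D - x)"
      by (rule slope) (use x D pos in auto)
    then show False using pos[of "x + f x / D"] D x by simp
  qed
  have "closed ?Z"
  proof -
    have "?Z = {x..} \<inter> f -` {0}" by auto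
    then show ?thesis using contf by (simp add: continuous_closed_vimage closed_Int)
  qed
  then have Inf: "Inf ?Z \<in> ?Z" by (intro closed_contains_Inf ne bdd_belowI[of _ x]) auto
  define e where "e = Inf ?Z"
  have e: "x \<le> e" "f e = 0" using Inf by (auto simp: e_def)
  have "f s > 0" if s: "x \<le> s" "s < e" for s
  proof (rule ccontr)
    assume "\<not> f s > 0"
    then have "\<exists>q\<ge>x. q \<le> s \<and> f q = 0"
      by (intro IVT2') (use x s contf in \<open>auto intro: continuous_at_imp_continuous_on\<close>)
    then obtain q where q: "x \<le> q" "q \<le> s" "f q = 0" by blast
    then have "e \<le> q" unfolding e_def by (intro cInf_lower bdd_belowI[of _ x]) auto
    then show False using q s by simp
  qed
  from slope[OF e(1) this] e show ?thesis using that by (auto simp: algebra_simps)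
qed


lemma poly_pderiv_trace_poly_of_real:
  "poly (pderiv (trace_poly (of_real l) k)) (of_real x :: complex)
    = of_real (poly (pderiv (trace_poly l k)) x)"
  by (induction l k rule: trace_poly.induct)
    (simp_all add: pderiv_pCons pderiv_diff pderiv_mult poly_trace_poly_of_real del: of_real_numeral)

lemma trace_poly_near_root:
  fixes l x :: real
  assumes l: "l \<ge> 8" and small: "\<bar>poly (trace_poly l (Suc k)) x\<bar> \<le> 21/10"
  obtains e where "poly (trace_poly l (Suc k)) e = 0"
    "sqrt (l - 4) powr (real k - 1) * \<bar>x - e\<bar> \<le> \<bar>poly (trace_poly l (Suc k)) x\<bar>"
proof -
  let ?f = "poly (trace_poly l (Suc k))" and ?f' = "poly (pderiv (trace_poly l (Suc k)))"
  let ?D = "sqrt (l - 4) powr (real k - 1)"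
  have D: "?D > 0" "\<And>x. \<bar>?f x\<bar> \<le> 21/10 \<Longrightarrow> \<bar>?f' x\<bar> \<ge> ?D"
    using l trace_deriv_bound[OF l] by auto
  \<comment> \<open>\<open>\<sigma>\<close> makes the value nonnegative and \<open>\<rho>\<close>
    orients the axis so that it decreases to the right, as \<open>root_near_steep_point\<close>
    demands.\<close>
  define \<sigma> :: real where "\<sigma> = (if ?f x < 0 then -1 else 1)"
  define \<rho> :: real where "\<rho> = (if \<sigma> * ?f' x < 0 then 1 else -1)"
  have sg: "\<sigma> = 1 \<or> \<sigma> = -1" "\<rho> = 1 \<or> \<rho> = -1" by (auto simp: \<sigma>_def \<rho>_def)
  then have abs1: "\<bar>\<sigma>\<bar> = 1" "\<bar>\<rho>\<bar> = 1" "\<rho> * \<rho> = 1" by auto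
  have "?f' x \<noteq> 0" using D(1) D(2)[OF small] by auto
  then have "\<sigma> * \<rho> * ?f' x < 0" using sg by (auto simp: \<rho>_def split: if_splits)
  moreover have "0 \<le> \<sigma> * ?f x" "\<sigma> * ?f x \<le> 21/10" using small by (auto simp: \<sigma>_def)
  ultimately obtain e where e: "\<rho> * x \<le> e" "\<sigma> * ?f (\<rho> * e) = 0" "?D * (e - \<rho> * x) \<le> \<sigma> * ?f x"
  proof (rule_tac root_near_steep_point[where f = "\<lambda>s. \<sigma> * ?f (\<rho> * s)" and f' = "\<lambda>s. \<sigma> * \<rho> * ?f' (\<rho> * s)"
        and D = "?D" and c = "21/10" and x = "\<rho> * x"], goal_cases)
    case (1 y)
    then show ?case by (auto intro!: derivative_eq_intros poly_DERIV)
  next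
    case 2
    then show ?case by (intro continuous_intros)
  next
    case 3
    then show ?case using D by simp
  next
    case (4 y)
    then show ?case using D(2)[of "\<rho> * y"] abs1 by (simp add: abs_mult)
  qed (use abs1 in \<open>simp_all add: mult.assoc[symmetric]\<close>)
  have "\<bar>x - \<rho> * e\<bar> = \<bar>\<rho> * (\<rho> * x - e)\<bar>" using sg(2) by auto
  also have "\<dots> = e - \<rho> * x" using e abs1 by (simp add: abs_mult)
  finally have "?D * \<bar>x - \<rho> * e\<bar> \<le> \<bar>?f x\<bar>"
    using e(3) small sg by (auto simp: \<sigma>_def split: if_splits)
  moreover have "?f (\<rho> * e) = 0" using e(2) sg by auto
  ultimately show ?thesis using that by blast
qed

text \<open>If the trace is already large at \<open>Re z\<close>, real-rootedness suffices.
  Otherwise a real root \<open>e\<close> lies near \<open>Re z\<close>. After splitting off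
  \<open>e\<close>, the cofactor is at least the slope bound at \<open>Re z\<close> and not smaller
  at \<open>z\<close>, and the factor \<open>z - e\<close> has modulus at least that of
  \<open>Im z\<close>.\<close>

lemma trace_poly_large_off_axis:
  assumes l: "l \<ge> 8" and z: "\<bar>Im z\<bar> * sqrt (l - 4) powr (real k - 1) > 21/10"
  shows "cmod (poly (trace_poly (of_real l) (Suc k)) z) > 21/10"
proof (cases "\<bar>poly (trace_poly l (Suc k)) (Re z)\<bar> \<le> 21/10")
  case False
  have "cmod (poly (trace_poly (of_real l) (Suc k)) (of_real (Re z)))
      \<le> cmod (poly (trace_poly (of_real l) (Suc k)) z)"
    by (intro cmod_poly_real_roots_ge) (rule trace_poly_root_real)
  then show ?thesis using False by (simp only: poly_trace_poly_of_real norm_of_real)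
next
  case True
  define p :: "complex poly" where "p = trace_poly (of_real l) (Suc k)"
  define x where "x = Re z"
  define D where "D = sqrt (l - 4) powr (real k - 1)"
  obtain e where e: "poly (trace_poly l (Suc k)) e = 0"
    "D * \<bar>x - e\<bar> \<le> \<bar>poly (trace_poly l (Suc k)) x\<bar>"
    using trace_poly_near_root[OF l, of k x] True by (auto simp: x_def D_def)
  have D: "D > 0" using l by (simp add: D_def)
  have pe: "poly p (of_real e) = 0" by (simp only: p_def poly_trace_poly_of_real e of_real_0)
  then obtain q where q: "p = [:- of_real e, 1:] * q" by (auto simp: poly_eq_0_iff_dvd)
  have roots: "Im w = 0" if "poly q w = 0" for w
  proof -
    have "poly p w = 0" by (simp add: q that)
    then show ?thesis unfolding p_def by (rule trace_poly_root_real)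
  qed
  \<comment> \<open>The cofactor is the difference quotient between \<open>x\<close> and
    \<open>e\<close>, or the derivative at \<open>e\<close> if they coincide.\<close>
  have qx: "cmod (poly q (of_real x)) \<ge> D"
  proof (cases "x = e")
    case True
    have "poly (pderiv p) (of_real e) = poly q (of_real e)"
      unfolding q pderiv_mult by (simp add: pderiv_pCons)
    moreover have "poly (pderiv p) (of_real e) = of_real (poly (pderiv (trace_poly l (Suc k))) e)"
      unfolding p_def by (rule poly_pderiv_trace_poly_of_real)
    moreover have "\<bar>poly (pderiv (trace_poly l (Suc k))) e\<bar> \<ge> D"
      unfolding D_def by (rule trace_deriv_bound[OF l]) (simp add: e del: trace_poly.simps)
    ultimately show ?thesis using True by (metis norm_of_real)
  next
    case False
    have "poly p (of_real x) = (of_real (x - e)) * poly q (of_real x)"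
      by (simp add: q algebra_simps)
    moreover have "cmod (poly p (of_real x)) = \<bar>poly (trace_poly l (Suc k)) x\<bar>"
      by (simp only: p_def poly_trace_poly_of_real norm_of_real)
    ultimately have "\<bar>poly (trace_poly l (Suc k)) x\<bar> = \<bar>x - e\<bar> * cmod (poly q (of_real x))"
      by (simp add: norm_mult del: of_real_diff)
    then have "\<bar>x - e\<bar> * D \<le> \<bar>x - e\<bar> * cmod (poly q (of_real x))" using e by (simp add: mult.commute)
    then show ?thesis using False by simp
  qed
  have "21/10 < \<bar>Im z\<bar> * D" using z by (simp add: D_def)
  also have "\<dots> \<le> cmod (z - of_real e) * cmod (poly q (of_real x))"
    using abs_Im_le_cmod[of "z - of_real e"] qx D by (intro mult_mono) auto
  also have "\<dots> \<le> cmod (z - of_real e) * cmod (poly q z)"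
    unfolding x_def by (intro mult_left_mono cmod_poly_real_roots_ge roots) auto
  also have "\<dots> = cmod (poly p z)" by (simp add: q norm_mult[symmetric] algebra_simps)
  finally show ?thesis by (simp add: p_def)
qed

section \<open>Renormalisation of the Fibonacci potential\<close>

primrec transfer :: "complex \<Rightarrow> (int \<Rightarrow> real) \<Rightarrow> int \<Rightarrow> nat \<Rightarrow> mat2" where
  "transfer z v p 0 = 1"
| "transfer z v p (Suc L) = site_matrix z (of_real (v (p + int L))) * transfer z v p L"

lemma transfer_add: "transfer z v p (L + K) = transfer z v (p + int L) K * transfer z v p L"
  by (induction K) (simp_all add: mult.assoc add.assoc)

section \<open>Rauzy induction for the golden rotation\<close>

abbreviation rot :: real where "rot \<equiv> inverse golden"

lemma golden_bounds: "golden > 1" "golden \<le> 2"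
  using real_sqrt_less_mono[of 1 5] real_sqrt_le_mono[of 5 9] by (simp_all add: golden_def)

lemma rot_bounds: "0 < rot" "rot < 1"
  using golden_bounds by (auto simp: field_simps)

lemma golden_square: "golden\<^sup>2 = golden + 1"
  by (simp add: golden_def power2_eq_square field_simps)

lemma rot_square: "rot\<^sup>2 = 1 - rot"
  using golden_square golden_bounds by (simp add: power2_eq_square field_simps)

lemma rot_power_rec: "rot ^ Suc (Suc j) = rot ^ j - rot ^ Suc j"
  using arg_cong[OF rot_square, of "\<lambda>x. rot ^ j * x"]
  by (simp add: power2_eq_square algebra_simps)

text \<open>Modulo 1, \<open>fib (Suc j)\<close> steps of the rotation are a shift by
  \<open>rot ^ Suc j\<close>, with sign alternating in \<open>j\<close>.\<close>

lemma fib_rot: "real (fib (Suc j)) * rot = real (fib j) + (-1) ^ j * rot ^ Suc j"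
proof (induction j rule: fib.induct)
  case 2
  have "rot * rot = 1 - rot" using rot_square by (simp only: power2_eq_square)
  then show ?case by simp
next
  case (3 n)
  have "real (fib (Suc (Suc (Suc n)))) * rot
      = real (fib (Suc (Suc n))) * rot + real (fib (Suc n)) * rot"
    by (simp add: algebra_simps)
  also have "\<dots> = real (fib (Suc (Suc n))) + (-1) ^ n * (rot ^ Suc n - rot ^ Suc (Suc n))"
    unfolding 3 by (simp add: algebra_simps)
  finally show ?case unfolding rot_power_rec[of "Suc n"] by simp
qed simp

lemma rot_power_pos: "0 < rot ^ j"
  using rot_bounds by simp

text \<open>
  \<open>base j\<close> is the base, modulo 1, of the \<open>j\<close>-th Rauzy induction of the rotation by \<open>rot\<close>: an interval
  of length \<open>rot ^ j\<close>, on which \<open>base (Suc j)\<close> has return time \<open>fib (j + 2)\<close> and the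
  remainder has return time \<open>fib (j + 1)\<close>.
\<close>

primrec base_offset :: "nat \<Rightarrow> real" where
  "base_offset 0 = 0"
| "base_offset (Suc j) = (if even j then base_offset j + rot ^ Suc (Suc j) else base_offset j)"

lemma base_offset_Suc:
  "even j \<Longrightarrow> base_offset (Suc j) = base_offset j + rot ^ Suc (Suc j)"
  "odd j \<Longrightarrow> base_offset (Suc j) = base_offset j"
  by simp_all

definition base :: "nat \<Rightarrow> real set" where
  "base j = {y. \<exists>m::int. base_offset j \<le> y - m \<and> y - m < base_offset j + rot ^ j}"

lemma base_unique:
  assumes "base_offset j \<le> y - of_int m" "y - of_int m < base_offset j + rot ^ j"
    and "base_offset j \<le> y - of_int m'" "y - of_int m' < base_offset j + rot ^ j"
  shows "m = (m' :: int)"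
proof -
  have "rot ^ j \<le> 1" using rot_bounds by (simp add: power_le_one)
  then have "\<bar>real_of_int m - real_of_int m'\<bar> < 1" using assms by linarith
  then show ?thesis by linarith
qed

text \<open>The step from \<open>j\<close> to \<open>j + 1\<close> cuts off a piece of length
  \<open>rot ^ (j + 2)\<close>, on the left for even \<open>j\<close> and on the right for odd
  \<open>j\<close>.\<close>

lemma base_Suc_interval:
  fixes y :: real and m :: int
  assumes "base_offset (Suc j) \<le> y - m" "y - m < base_offset (Suc j) + rot ^ Suc j"
  shows "base_offset j \<le> y - m" "y - m < base_offset j + rot ^ j"
proof -
  have *: "rot ^ Suc (Suc j) = rot ^ j - rot ^ Suc j" "0 < rot ^ Suc j" "0 < rot ^ Suc (Suc j)"
    by (rule rot_power_rec rot_power_pos)+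
  have "base_offset j \<le> y - m \<and> y - m < base_offset j + rot ^ j"
  proof (cases "even j")
    case True
    show ?thesis using assms * unfolding base_offset_Suc(1)[OF True] by linarith
  next
    case False
    show ?thesis using assms * unfolding base_offset_Suc(2)[OF False] by linarith
  qed
  then show "base_offset j \<le> y - m" "y - m < base_offset j + rot ^ j" by auto
qed

lemma base_Suc_subset: "base (Suc j) \<subseteq> base j"
  unfolding base_def using base_Suc_interval by blast

lemma base_0: "y \<in> base 0"
  unfolding base_def by (auto intro!: exI[of _ "\<lfloor>y\<rfloor>"]) linarith

lemma base_diffE:
  assumes "y \<in> base j - base (Suc j)"
  obtains m :: int where "base_offset j \<le> y - m" "y - m < base_offset j + rot ^ j"
    "y - m < base_offset (Suc j) \<or> base_offset (Suc j) + rot ^ Suc j \<le> y - m"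
proof -
  from assms obtain m :: int where m: "base_offset j \<le> y - m" "y - m < base_offset j + rot ^ j"
    unfolding base_def by blast
  have "\<not> (base_offset (Suc j) \<le> y - m \<and> y - m < base_offset (Suc j) + rot ^ Suc j)"
    using assms unfolding base_def by blast
  then show ?thesis using that[OF m] by linarith
qed

lemma base_diffI:
  fixes y :: real and m :: int
  assumes "base_offset j \<le> y - m" "y - m < base_offset j + rot ^ j"
    "y - m < base_offset (Suc j) \<or> base_offset (Suc j) + rot ^ Suc j \<le> y - m"
  shows "y \<in> base j - base (Suc j)"
proof -
  have "y \<notin> base (Suc j)"
  proof
    assume "y \<in> base (Suc j)"
    then obtain m' :: int where m': "base_offset (Suc j) \<le> y - m'" "y - m' < base_offset (Suc j) + rot ^ Suc j"
      unfolding base_def by blast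
    have "m = m'" by (rule base_unique[OF assms(1,2) base_Suc_interval[OF m']])
    then show False using assms(3) m' by auto
  qed
  then show ?thesis using assms unfolding base_def by blast
qed

text \<open>The shift by \<open>rot ^ Suc j\<close> has the sign that carries the piece cut off into
  the piece kept.\<close>

lemma base_diff_return:
  assumes "y \<in> base j - base (Suc j)"
  shows "y + real (fib (Suc j)) * rot \<in> base (Suc j)"
proof -
  obtain m :: int where m: "base_offset j \<le> y - m" "y - m < base_offset j + rot ^ j"
    "y - m < base_offset (Suc j) \<or> base_offset (Suc j) + rot ^ Suc j \<le> y - m"
    using base_diffE[OF assms] .
  define m' where "m' = m + int (fib j)"
  have eq: "(y + real (fib (Suc j)) * rot) - of_int m' = (y - of_int m) + (-1) ^ j * rot ^ Suc j"
    unfolding fib_rot m'_def by simp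
  have *: "rot ^ Suc (Suc j) = rot ^ j - rot ^ Suc j"
      "rot ^ Suc (Suc (Suc j)) = rot ^ Suc j - rot ^ Suc (Suc j)" "0 < rot ^ Suc (Suc (Suc j))"
      "0 < rot ^ Suc (Suc j)"
    by (rule rot_power_rec rot_power_pos)+
  have "base_offset (Suc j) \<le> (y - of_int m) + (-1) ^ j * rot ^ Suc j
    \<and> (y - of_int m) + (-1) ^ j * rot ^ Suc j < base_offset (Suc j) + rot ^ Suc j"
  proof (cases "even j")
    case True
    then have s: "(-1) ^ j * rot ^ Suc j = rot ^ Suc j" by simp
    show ?thesis using m * unfolding s base_offset_Suc(1)[OF True] by linarith
  next
    case False
    then have s: "(-1) ^ j * rot ^ Suc j = - (rot ^ Suc j)" by simp
    show ?thesis using m * unfolding s base_offset_Suc(2)[OF False] by linarith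
  qed
  then have "base_offset (Suc j) \<le> (y + real (fib (Suc j)) * rot) - of_int m'
    \<and> (y + real (fib (Suc j)) * rot) - of_int m' < base_offset (Suc j) + rot ^ Suc j"
    unfolding eq .
  then show ?thesis unfolding base_def by blast
qed

text \<open>This makes the word read from \<open>base (Suc (Suc j))\<close> a word of level
  \<open>j + 1\<close> followed by one of level \<open>j\<close>.\<close>

lemma base_Suc_Suc_passes:
  assumes "y \<in> base (Suc (Suc j))"
  shows "y + real (fib (Suc (Suc j))) * rot \<in> base j - base (Suc j)"
proof -
  obtain m :: int where m: "base_offset (Suc (Suc j)) \<le> y - m"
    "y - m < base_offset (Suc (Suc j)) + rot ^ Suc (Suc j)"
    using assms unfolding base_def by blast
  define m' where "m' = m + int (fib (Suc j))"
  have eq: "(y + real (fib (Suc (Suc j))) * rot) - of_int m' = (y - of_int m) + (-1) ^ Suc j * rot ^ Suc (Suc j)"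
    unfolding fib_rot[of "Suc j"] m'_def by simp
  have *: "rot ^ Suc (Suc j) = rot ^ j - rot ^ Suc j"
      "rot ^ Suc (Suc (Suc j)) = rot ^ Suc j - rot ^ Suc (Suc j)" "0 < rot ^ Suc (Suc (Suc j))"
      "0 < rot ^ Suc (Suc j)"
    by (rule rot_power_rec rot_power_pos)+
  let ?w = "(y - of_int m) + (-1) ^ Suc j * rot ^ Suc (Suc j)"
  have "base_offset j \<le> ?w \<and> ?w < base_offset j + rot ^ j
    \<and> (?w < base_offset (Suc j) \<or> base_offset (Suc j) + rot ^ Suc j \<le> ?w)"
  proof (cases "even j")
    case True
    then have s: "(-1) ^ Suc j * rot ^ Suc (Suc j) = - (rot ^ Suc (Suc j))" by simp
    have "odd (Suc j)" using True by simp
    from base_offset_Suc(1)[OF True] base_offset_Suc(2)[OF this] show ?thesis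
      using m * unfolding s by linarith
  next
    case False
    then have s: "(-1) ^ Suc j * rot ^ Suc (Suc j) = rot ^ Suc (Suc j)" by simp
    have "even (Suc j)" using False by simp
    from base_offset_Suc(2)[OF False] base_offset_Suc(1)[OF this] show ?thesis
      using m * unfolding s by linarith
  qed
  then show ?thesis unfolding eq[symmetric] by (intro base_diffI[of j _ m']) auto
qed

text \<open>Since \<open>1 - rot\<close> is the square of \<open>rot\<close>, the interval coding
  the potential is the first induction base.\<close>

lemma indicator_base: "indicat_real {1 - rot..<1} (frac y) = indicat_real (base (Suc 0)) y"
proof -
  have "y \<in> base (Suc 0) \<longleftrightarrow> frac y \<in> {1 - rot..<1}"
  proof
    assume "y \<in> base (Suc 0)"
    then obtain m :: int where m: "1 - rot \<le> y - m" "y - m < 1"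
      using rot_square by (auto simp: base_def power2_eq_square)
    then have "\<lfloor>y\<rfloor> = m" using rot_bounds by linarith
    then show "frac y \<in> {1 - rot..<1}" using m by (simp add: frac_def)
  next
    assume "frac y \<in> {1 - rot..<1}"
    then show "y \<in> base (Suc 0)"
      using rot_square unfolding base_def
      by (auto intro!: exI[of _ "\<lfloor>y\<rfloor>"] simp: frac_def power2_eq_square)
  qed
  then show ?thesis by (auto simp: indicator_def)
qed

text \<open>An orbit from \<open>base (Suc (Suc j))\<close> reads level \<open>j + 1\<close> and
  then level \<open>j\<close>, matching the recursion of \<open>fib_matrix\<close>. The second
  conjunct for \<open>Suc j\<close> is contained in the first one for \<open>j\<close>.\<close>

lemma transfer_base:
  fixes l \<theta> :: real
  defines "v \<equiv> fib_potential l \<theta>" and "y \<equiv> \<lambda>p::int. of_int p * rot + \<theta>"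
  shows "(\<forall>p. y p \<in> base (Suc j) \<longrightarrow> transfer z v p (fib (Suc (Suc j))) = fib_matrix z (of_real l) (Suc j))
    \<and> (\<forall>p. y p \<in> base j - base (Suc j) \<longrightarrow> transfer z v p (fib (Suc j)) = fib_matrix z (of_real l) j)"
proof (induction j)
  case 0
  show ?case
    by (auto simp: v_def y_def fib_potential_def indicator_base base_0)
next
  case (Suc j)
  have y_add: "y (p + int n) = y p + real n * rot" for p n by (simp add: y_def algebra_simps)
  have "transfer z v p (fib (Suc (Suc (Suc j)))) = fib_matrix z (of_real l) (Suc (Suc j))"
    if p: "y p \<in> base (Suc (Suc j))" for p
  proof -
    have "transfer z v p (fib (Suc (Suc j))) = fib_matrix z (of_real l) (Suc j)"
      using Suc.IH p base_Suc_subset[of "Suc j"] by blast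
    moreover have "y (p + int (fib (Suc (Suc j)))) \<in> base j - base (Suc j)"
      unfolding y_add by (rule base_Suc_Suc_passes[OF p])
    then have "transfer z v (p + int (fib (Suc (Suc j)))) (fib (Suc j)) = fib_matrix z (of_real l) j"
      using Suc.IH by blast
    moreover have "fib (Suc (Suc (Suc j))) = fib (Suc (Suc j)) + fib (Suc j)" by simp
    ultimately show ?thesis by (simp only: transfer_add fib_matrix.simps(3))
  qed
  then show ?case using Suc.IH base_Suc_subset[of "Suc j"] by blast
qed

text \<open>Entering the next smaller base costs at most \<open>fib (Suc j)\<close> further steps,
  and these costs add up by the Fibonacci recursion.\<close>

lemma base_hit: "\<exists>n \<le> fib (Suc (Suc j)). y + real n * rot \<in> base j"
proof (induction j)
  case 0
  show ?case using base_0 by blast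
next
  case (Suc j)
  then obtain n where n: "n \<le> fib (Suc (Suc j))" "y + real n * rot \<in> base j" by blast
  show ?case
  proof (cases "y + real n * rot \<in> base (Suc j)")
    case True
    then show ?thesis using n fib_mono[of "Suc (Suc j)" "Suc (Suc (Suc j))"] by (intro exI[of _ n]) auto
  next
    case False
    then have "(y + real n * rot) + real (fib (Suc j)) * rot \<in> base (Suc j)"
      using n by (intro base_diff_return) auto
    then have "y + real (n + fib (Suc j)) * rot \<in> base (Suc j)" by (simp add: algebra_simps)
    moreover have "n + fib (Suc j) \<le> fib (Suc (Suc (Suc j)))" using n by simp
    ultimately show ?thesis by blast
  qed
qed

text \<open>After entering \<open>base (Suc j)\<close>, the orbit needs 0, 1 or 2 further runs of
  \<open>F\<close> steps, depending on how deep in the nested bases it has landed.\<close>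

lemma base_diff_hit: "\<exists>n \<le> 3 * fib (j + 3). y + real n * rot \<in> base (Suc j) - base (Suc (Suc j))"
proof -
  define F where "F = fib (Suc (Suc (Suc j)))"
  obtain n where n: "n \<le> F" "y + real n * rot \<in> base (Suc j)"
    using base_hit[of "Suc j" y] by (auto simp: F_def)
  define w where "w = y + real n * rot"
  have "\<exists>i \<le> 2 * F. w + real i * rot \<in> base (Suc j) - base (Suc (Suc j))"
  proof -
    consider "w \<notin> base (Suc (Suc j))" | "w \<in> base (Suc (Suc (Suc j)))"
      | "w \<in> base (Suc (Suc j)) - base (Suc (Suc (Suc j)))" by blast
    then show ?thesis
    proof cases
      case 1
      then show ?thesis using n by (intro exI[of _ 0]) (auto simp: w_def)
    next
      case 2
      from base_Suc_Suc_passes[OF this] show ?thesis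
        by (intro exI[of _ F]) (simp add: F_def)
    next
      case 3
      from base_diff_return[OF this] have "w + real F * rot \<in> base (Suc (Suc (Suc j)))"
        by (simp add: F_def)
      from base_Suc_Suc_passes[OF this]
      have "(w + real F * rot) + real F * rot \<in> base (Suc j) - base (Suc (Suc j))" by (simp only: F_def)
      then show ?thesis by (intro exI[of _ "2 * F"]) (simp add: algebra_simps)
    qed
  qed
  then obtain i where i: "i \<le> 2 * F" "w + real i * rot \<in> base (Suc j) - base (Suc (Suc j))" by blast
  have "fib (j + 3) = F" by (simp add: F_def numeral_3_eq_3)
  moreover have "y + real (n + i) * rot \<in> base (Suc j) - base (Suc (Suc j))"
    using i(2) by (simp add: w_def algebra_simps)
  moreover have "n + i \<le> 3 * F" using n i by linarith
  ultimately show ?thesis by auto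
qed

text \<open>A point of \<open>base (Suc j)\<close> outside \<open>base (Suc (Suc j))\<close> returns
  to \<open>base (Suc j)\<close> after reading one word of length \<open>fib (j + 2)\<close>, and
  then reads the same word again.\<close>

lemma fib_potential_square:
  fixes l \<theta> :: real and p0 :: int
  defines "v \<equiv> fib_potential l \<theta>"
  obtains p where "p0 \<le> p" "p \<le> p0 + 3 * int (fib (j + 3))"
    "transfer z v p (fib (j + 2)) = fib_matrix z (of_real l) (Suc j)"
    "transfer z v (p + int (fib (j + 2))) (fib (j + 2)) = fib_matrix z (of_real l) (Suc j)"
proof -
  let ?y = "\<lambda>p::int. of_int p * rot + \<theta>"
  have y_add: "?y (p + int n) = ?y p + real n * rot" for p n by (simp add: algebra_simps)
  obtain n where n: "n \<le> 3 * fib (j + 3)" "?y p0 + real n * rot \<in> base (Suc j) - base (Suc (Suc j))"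
    using base_diff_hit[of j "?y p0"] by blast
  define p where "p = p0 + int n"
  have yp: "?y p \<in> base (Suc j) - base (Suc (Suc j))" using n unfolding p_def y_add by simp
  then have "?y (p + int (fib (j + 2))) \<in> base (Suc (Suc j))"
    using base_diff_return[OF yp] unfolding y_add by simp
  then have "?y (p + int (fib (j + 2))) \<in> base (Suc j)" using base_Suc_subset[of "Suc j"] by blast
  then have "transfer z v (p + int (fib (j + 2))) (fib (j + 2)) = fib_matrix z (of_real l) (Suc j)"
    using transfer_base[where l = l and \<theta> = \<theta> and z = z and j = j] by (simp add: v_def)
  moreover have "transfer z v p (fib (j + 2)) = fib_matrix z (of_real l) (Suc j)"
    using transfer_base[where l = l and \<theta> = \<theta> and z = z and j = j] yp by (simp add: v_def)
  moreover have "int n \<le> 3 * int (fib (j + 3))" using n(1) by linarith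
  ultimately show ?thesis using that[of p] by (simp add: p_def)
qed

section \<open>The wave function in coordinates\<close>

lemma bounded_linear_ell2_nth: "bounded_linear (\<lambda>x. ell2_nth x n)"
  by (rule bounded_linear_intro[where K = 1])
    (simp_all add: plus_ell2.rep_eq scaleR_ell2.rep_eq scaleR_conv_of_real cmod_ell2_nth_le)

definition ham_coeff :: "real \<Rightarrow> real \<Rightarrow> nat \<Rightarrow> int \<Rightarrow> complex" where
  "ham_coeff l \<theta> k n = ell2_nth ((fib_hamiltonian l \<theta> ^^ k) (delta 0)) n"

lemma ham_coeff_0: "ham_coeff l \<theta> 0 n = (if n = 0 then 1 else 0)"
  by (simp add: ham_coeff_def delta.rep_eq)

lemma ham_coeff_Suc:
  "ham_coeff l \<theta> (Suc k) n = ham_coeff l \<theta> k (n + 1) + ham_coeff l \<theta> k (n - 1)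
     + of_real (fib_potential l \<theta> n) * ham_coeff l \<theta> k n"
  by (simp add: ham_coeff_def fib_hamiltonian.rep_eq)

lemma ham_coeff_support: "int k < \<bar>n\<bar> \<Longrightarrow> ham_coeff l \<theta> k n = 0"
  by (induction k arbitrary: n) (auto simp: ham_coeff_0 ham_coeff_Suc)

lemma cmod_ham_coeff_le: "cmod (ham_coeff l \<theta> k n) \<le> (2 + \<bar>l\<bar>) ^ k"
proof (induction k arbitrary: n)
  case (Suc k)
  have "cmod (of_real (fib_potential l \<theta> n) * ham_coeff l \<theta> k n) \<le> \<bar>l\<bar> * (2 + \<bar>l\<bar>) ^ k"
    unfolding norm_mult norm_of_real by (intro mult_mono Suc abs_fib_potential_le) auto
  then have "cmod (ham_coeff l \<theta> (Suc k) n) \<le> (2 + \<bar>l\<bar>) ^ k + (2 + \<bar>l\<bar>) ^ k + \<bar>l\<bar> * (2 + \<bar>l\<bar>) ^ k"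
    unfolding ham_coeff_Suc by (intro norm_triangle_le add_mono Suc)
  then show ?case by (simp add: algebra_simps)
qed (simp add: ham_coeff_0)

lemma summable_ham_coeff: "summable (\<lambda>k. ham_coeff l \<theta> k n / fact k * w ^ k)"
proof (rule summable_comparison_test')
  show "summable (\<lambda>k. inverse (fact k) * ((2 + \<bar>l\<bar>) * cmod w) ^ k)" by (rule summable_exp)
  show "norm (ham_coeff l \<theta> k n / fact k * w ^ k) \<le> inverse (fact k) * ((2 + \<bar>l\<bar>) * cmod w) ^ k" for k
  proof -
    have "norm (ham_coeff l \<theta> k n / fact k * w ^ k) = cmod (ham_coeff l \<theta> k n) * (inverse (fact k) * cmod w ^ k)"
      by (simp add: norm_mult norm_inverse norm_power divide_inverse)
    also have "\<dots> \<le> (2 + \<bar>l\<bar>) ^ k * (inverse (fact k) * cmod w ^ k)"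
      by (intro mult_right_mono cmod_ham_coeff_le) simp
    finally show ?thesis by (simp add: power_mult_distrib mult_ac)
  qed
qed

definition wave :: "real \<Rightarrow> real \<Rightarrow> real \<Rightarrow> int \<Rightarrow> complex" where
  "wave l \<theta> t n = ell2_nth (evolution (fib_hamiltonian l \<theta>) t (delta 0)) n"

lemma wave_series: "wave l \<theta> t n = (\<Sum>k. ham_coeff l \<theta> k n / fact k * (- \<i> * of_real t) ^ k)"
proof -
  have "wave l \<theta> t n = (\<Sum>k. ell2_nth (((- \<i> * of_real t) ^ k / fact k) *\<^sub>C (fib_hamiltonian l \<theta> ^^ k) (delta 0)) n)"
    unfolding wave_def evolution_def
    by (rule bounded_linear.suminf[OF bounded_linear_ell2_nth])
      (rule summable_evolution[OF bounded_linear_fib_hamiltonian])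
  then show ?thesis by (simp add: scaleC.rep_eq ham_coeff_def mult.commute)
qed

lemma wave_0: "wave l \<theta> 0 n = (if n = 0 then 1 else 0)"
proof -
  have "wave l \<theta> 0 n = (\<Sum>k. ham_coeff l \<theta> k n / fact k * 0 ^ k)" by (simp add: wave_series)
  then show ?thesis by (simp only: powser_zero) (simp add: ham_coeff_0)
qed

lemma wave_deriv:
  "((\<lambda>t. wave l \<theta> t n) has_vector_derivative
     - \<i> * (wave l \<theta> t (n + 1) + wave l \<theta> t (n - 1) + of_real (fib_potential l \<theta> n) * wave l \<theta> t n)) (at t)"
proof -
  define F where "F = (\<lambda>n w. \<Sum>k. ham_coeff l \<theta> k n / fact k * w ^ k)"
  let ?w = "- \<i> * complex_of_real t"
  have d: "diffs (\<lambda>k. ham_coeff l \<theta> k n / fact k) k = ham_coeff l \<theta> (Suc k) n / fact k" for k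
    unfolding diffs_def fact_Suc by (simp del: of_nat_Suc)
  have eq: "(\<Sum>k. ham_coeff l \<theta> (Suc k) n / fact k * w ^ k)
      = F (n + 1) w + F (n - 1) w + of_real (fib_potential l \<theta> n) * F n w" for w
  proof (rule sums_unique[symmetric])
    have F: "(\<lambda>k. ham_coeff l \<theta> k n / fact k * w ^ k) sums F n w" for n
      unfolding F_def by (rule summable_sums[OF summable_ham_coeff])
    show "(\<lambda>k. ham_coeff l \<theta> (Suc k) n / fact k * w ^ k) sums
        (F (n + 1) w + F (n - 1) w + of_real (fib_potential l \<theta> n) * F n w)"
      using sums_add[OF sums_add[OF F F] sums_mult[OF F]]
      by (simp add: ham_coeff_Suc add_divide_distrib distrib_right mult.assoc)
  qed
  have "(F n has_field_derivative (\<Sum>k. diffs (\<lambda>k. ham_coeff l \<theta> k n / fact k) k * ?w ^ k)) (at ?w)"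
    unfolding F_def by (rule termdiffs_strong_converges_everywhere[OF summable_ham_coeff])
  then have "(F n has_field_derivative
      F (n + 1) ?w + F (n - 1) ?w + of_real (fib_potential l \<theta> n) * F n ?w) (at ?w)"
    by (simp only: d eq)
  moreover have "((\<lambda>t. - \<i> * complex_of_real t) has_vector_derivative - \<i>) (at t)"
    by (auto intro!: derivative_eq_intros)
  ultimately have "(F n \<circ> (\<lambda>t. - \<i> * complex_of_real t) has_vector_derivative
     - \<i> * (F (n + 1) ?w + F (n - 1) ?w + of_real (fib_potential l \<theta> n) * F n ?w)) (at t)"
    by (intro field_vector_diff_chain_at)
  then show ?thesis by (simp add: wave_series F_def o_def)
qed

text \<open>The Hamiltonian moves mass by at most one site, so only powers \<open>k\<close> of at
  least the modulus of \<open>n\<close> contribute. For these a factor \<open>exp k\<close> times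
  \<open>exp (- \<bar>n\<bar>)\<close> may be inserted for free.\<close>

lemma wave_decay: "cmod (wave l \<theta> t n) \<le> exp (exp 1 * (2 + \<bar>l\<bar>) * \<bar>t\<bar> - \<bar>real_of_int n\<bar>)"
proof -
  let ?x = "exp 1 * (2 + \<bar>l\<bar>) * \<bar>t\<bar>"
  have s: "summable (\<lambda>k. exp (- \<bar>real_of_int n\<bar>) * (inverse (fact k) * ?x ^ k))"
    by (intro summable_mult summable_exp)
  have le: "norm (ham_coeff l \<theta> k n / fact k * (- \<i> * of_real t) ^ k)
      \<le> exp (- \<bar>real_of_int n\<bar>) * (inverse (fact k) * ?x ^ k)" for k
  proof (cases "int k < \<bar>n\<bar>")
    case True
    then show ?thesis by (simp add: ham_coeff_support)
  next
    case False
    then have nk: "\<bar>real_of_int n\<bar> \<le> real k" by linarith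
    have "norm (ham_coeff l \<theta> k n / fact k * (- \<i> * of_real t) ^ k)
        = cmod (ham_coeff l \<theta> k n) * (inverse (fact k) * \<bar>t\<bar> ^ k)"
      by (simp add: norm_mult norm_inverse norm_power divide_inverse)
    also have "\<dots> \<le> (2 + \<bar>l\<bar>) ^ k * (inverse (fact k) * \<bar>t\<bar> ^ k)"
      by (intro mult_right_mono cmod_ham_coeff_le) simp
    also have "\<dots> = 1 * (inverse (fact k) * ((2 + \<bar>l\<bar>) * \<bar>t\<bar>) ^ k)"
      by (simp add: power_mult_distrib mult_ac)
    also have "\<dots> \<le> (exp (- \<bar>real_of_int n\<bar>) * exp (real k)) * (inverse (fact k) * ((2 + \<bar>l\<bar>) * \<bar>t\<bar>) ^ k)"
      using nk by (intro mult_right_mono) (auto simp: exp_add[symmetric])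
    also have "exp (real k) = exp 1 ^ k" using exp_of_nat_mult[of k "1::real"] by simp
    also have "(exp (- \<bar>real_of_int n\<bar>) * exp 1 ^ k) * (inverse (fact k) * ((2 + \<bar>l\<bar>) * \<bar>t\<bar>) ^ k)
       = exp (- \<bar>real_of_int n\<bar>) * (inverse (fact k) * ?x ^ k)"
      by (simp add: power_mult_distrib mult_ac)
    finally show ?thesis .
  qed
  have "cmod (wave l \<theta> t n) \<le> (\<Sum>k. exp (- \<bar>real_of_int n\<bar>) * (inverse (fact k) * ?x ^ k))"
    unfolding wave_series by (rule norm_suminf_le[OF le s])
  also have "\<dots> = exp (- \<bar>real_of_int n\<bar>) * (\<Sum>k. inverse (fact k) * ?x ^ k)"
    by (rule suminf_mult[OF summable_exp])
  also have "(\<Sum>k. inverse (fact k) * ?x ^ k) = exp ?x"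
    by (simp add: exp_def)
  finally show ?thesis by (simp add: exp_add[symmetric])
qed

section \<open>Mass of the wave function\<close>

lemma sum_telescope_symmetric:
  fixes f :: "int \<Rightarrow> real"
  shows "(\<Sum>n\<in>{- int M..int M}. f n - f (n - 1)) = f (int M) - f (- int M - 1)"
proof (induction M)
  case (Suc M)
  have "{- int (Suc M)..int (Suc M)} = {- int M..int M} \<union> {- int M - 1, int M + 1}" by auto
  moreover have "(\<Sum>n\<in>{- int M..int M} \<union> {- int M - 1, int M + 1}. f n - f (n - 1))
      = (\<Sum>n\<in>{- int M..int M}. f n - f (n - 1)) + (\<Sum>n\<in>{- int M - 1, int M + 1}. f n - f (n - 1))"
    by (rule sum.union_disjoint) auto
  ultimately show ?case using Suc.IH by (simp add: algebra_simps)
qed simp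

text \<open>The mass in a window around 0 changes only by the currents \<open>J\<close> through its
  two ends. At fixed \<open>t\<close> these are exponentially small in the window size
  \<open>M\<close>, and \<open>M\<close> tends to infinity.\<close>

lemma sum_wave_le_1:
  assumes t: "t \<ge> 0" and F: "finite F"
  shows "(\<Sum>n\<in>F. (cmod (wave l \<theta> t n))\<^sup>2) \<le> 1"
proof -
  define C where "C = exp 1 * (2 + \<bar>l\<bar>)"
  have C: "C \<ge> 0" by (simp add: C_def)
  define g where "g = (\<lambda>M t. \<Sum>n\<in>{- int M..int M}. (cmod (wave l \<theta> t n))\<^sup>2)"
  define J where "J = (\<lambda>t n. 2 * Im (cnj (wave l \<theta> t n) * wave l \<theta> t (n + 1)))"
  have sq: "((\<lambda>t. (cmod (wave l \<theta> t n))\<^sup>2) has_real_derivative J t n - J t (n - 1)) (at t)" for t n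
  proof -
    let ?D = "- \<i> * (wave l \<theta> t (n + 1) + wave l \<theta> t (n - 1) + of_real (fib_potential l \<theta> n) * wave l \<theta> t n)"
    have "((\<lambda>t. inner (wave l \<theta> t n) (wave l \<theta> t n)) has_vector_derivative
        inner (wave l \<theta> t n) ?D + inner ?D (wave l \<theta> t n)) (at t)"
      by (rule bounded_bilinear.has_vector_derivative[OF bounded_bilinear_inner wave_deriv wave_deriv])
    moreover have "inner (wave l \<theta> t n) ?D + inner ?D (wave l \<theta> t n) = J t n - J t (n - 1)"
      by (simp add: inner_complex_def J_def algebra_simps)
    ultimately show ?thesis
      by (simp add: power2_norm_eq_inner has_real_derivative_iff_has_vector_derivative)
  qed
  have gd: "(g M has_real_derivative J t (int M) - J t (- int M - 1)) (at t)" for M t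
  proof -
    have "(g M has_real_derivative (\<Sum>n\<in>{- int M..int M}. J t n - J t (n - 1))) (at t)"
      unfolding g_def by (rule DERIV_sum) (rule sq)
    then show ?thesis by (simp only: sum_telescope_symmetric)
  qed
  have J: "\<bar>J s n\<bar> \<le> 2 * exp (2 * C * t - (\<bar>real_of_int n\<bar> + \<bar>real_of_int (n + 1)\<bar>))"
    if "0 \<le> s" "s \<le> t" for s n
  proof -
    have w: "cmod (wave l \<theta> s n) \<le> exp (C * t - \<bar>real_of_int n\<bar>)" for n
    proof -
      have "C * \<bar>s\<bar> \<le> C * t" using that C by (intro mult_left_mono) auto
      then show ?thesis
        by (intro order_trans[OF wave_decay]) (simp add: C_def)
    qed
    have "\<bar>J s n\<bar> \<le> 2 * (cmod (wave l \<theta> s n) * cmod (wave l \<theta> s (n + 1)))"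
      unfolding J_def abs_mult using abs_Im_le_cmod[of "cnj (wave l \<theta> s n) * wave l \<theta> s (n + 1)"]
      by (simp add: norm_mult)
    also have "\<dots> \<le> 2 * (exp (C * t - \<bar>real_of_int n\<bar>) * exp (C * t - \<bar>real_of_int (n + 1)\<bar>))"
      by (intro mult_left_mono mult_mono w) auto
    finally show ?thesis by (simp add: exp_add[symmetric] algebra_simps)
  qed
  have g0: "g M 0 = 1" for M
  proof -
    have "g M 0 = (\<Sum>n\<in>{- int M..int M}. if n = 0 then 1 else 0)"
      unfolding g_def by (intro sum.cong) (auto simp: wave_0)
    then show ?thesis by simp
  qed
  have gb: "g M t \<le> 1 + t * (4 * exp (2 * C * t)) * exp (- real M)" for M
  proof (cases "t = 0")
    case False
    then have "0 < t" using t by simp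
    from MVT2[OF this, of "g M" "\<lambda>t. J t (int M) - J t (- int M - 1)"] gd
    obtain s where s: "0 < s" "s < t" "g M t - g M 0 = t * (J s (int M) - J s (- int M - 1))" by auto
    have e: "exp (2 * C * t - r) \<le> exp (2 * C * t) * exp (- real M)" if "r \<ge> real M" for r
      using that by (simp add: exp_add[symmetric])
    have "\<bar>J s (int M)\<bar> \<le> 2 * (exp (2 * C * t) * exp (- real M))"
      by (rule order_trans[OF J]) (use s in \<open>auto intro!: e\<close>)
    moreover have "\<bar>J s (- int M - 1)\<bar> \<le> 2 * (exp (2 * C * t) * exp (- real M))"
      by (rule order_trans[OF J]) (use s in \<open>auto intro!: e\<close>)
    ultimately have "J s (int M) - J s (- int M - 1) \<le> 4 * (exp (2 * C * t) * exp (- real M))" by linarith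
    then have "t * (J s (int M) - J s (- int M - 1)) \<le> t * (4 * (exp (2 * C * t) * exp (- real M)))"
      using t by (rule mult_left_mono)
    then show ?thesis using s(3) g0[of M] by (simp add: mult_ac)
  qed (simp add: g0)
  have lim: "(\<lambda>M. 1 + t * (4 * exp (2 * C * t)) * exp (- real M)) \<longlonglongrightarrow> 1 + t * (4 * exp (2 * C * t)) * 0"
    by (intro tendsto_intros filterlim_compose[OF exp_at_bot])
      (rule filterlim_compose[OF filterlim_uminus_at_bot_at_top filterlim_real_sequentially])
  obtain M0 where M0: "F \<subseteq> {- int M0..int M0}"
  proof -
    have "F \<subseteq> {- int (nat (Max (abs ` (insert 0 F))))..int (nat (Max (abs ` (insert 0 F))))}"
    proof
      fix x assume "x \<in> F"
      then have "\<bar>x\<bar> \<le> Max (abs ` insert 0 F)" using F by (intro Max_ge) auto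
      then show "x \<in> {- int (nat (Max (abs ` (insert 0 F))))..int (nat (Max (abs ` (insert 0 F))))}" by auto
    qed
    then show ?thesis using that by blast
  qed
  have "(\<Sum>n\<in>F. (cmod (wave l \<theta> t n))\<^sup>2) \<le> 1 + t * (4 * exp (2 * C * t)) * exp (- real M)" if "M \<ge> M0" for M
  proof -
    have "(\<Sum>n\<in>F. (cmod (wave l \<theta> t n))\<^sup>2) \<le> g M t"
      unfolding g_def by (rule sum_mono2) (use M0 that in force)+
    then show ?thesis using gb[of M] by linarith
  qed
  then show ?thesis
    using LIMSEQ_le_const[OF lim, of "\<Sum>n\<in>F. (cmod (wave l \<theta> t n))\<^sup>2"] by auto
qed

lemma cmod_wave_le_1: "t \<ge> 0 \<Longrightarrow> cmod (wave l \<theta> t n) \<le> 1"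
  using sum_wave_le_1[of t "{n}" l \<theta>] by (simp add: power_le_one_iff abs_square_le_1)

lemma position_prob_eq: "position_prob (fib_hamiltonian l \<theta>) t n = (cmod (wave l \<theta> t n))\<^sup>2"
proof -
  have "cinner x (delta n) = cnj (ell2_nth x n)" for x
  proof -
    have "cinner x (delta n) = (\<Sum>\<^sub>\<infinity>m\<in>{n}. cnj (ell2_nth x m) * ell2_nth (delta n) m)"
      unfolding cinner_def by (rule infsum_cong_neutral) (auto simp: delta.rep_eq)
    then show ?thesis by (simp add: delta.rep_eq)
  qed
  then show ?thesis by (simp add: position_prob_def wave_def)
qed

section \<open>The Laplace transform of a wave function\<close>

text \<open>These are the only facts about the evolution that the Laplace argument uses:
  \<open>le_1\<close> makes the transform converge, \<open>decay\<close> sends it to 0 at infinity,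
  and \<open>potential_le\<close> bounds the time derivative.\<close>

locale wave_function =
  fixes \<psi> :: "real \<Rightarrow> int \<Rightarrow> complex" and V :: "int \<Rightarrow> real" and C K :: real
  assumes deriv: "((\<lambda>t. \<psi> t n) has_vector_derivative
      - \<i> * (\<psi> t (n + 1) + \<psi> t (n - 1) + of_real (V n) * \<psi> t n)) (at t)"
    and init: "\<psi> 0 n = (if n = 0 then 1 else 0)"
    and le_1: "t \<ge> 0 \<Longrightarrow> cmod (\<psi> t n) \<le> 1"
    and decay: "t \<ge> 0 \<Longrightarrow> cmod (\<psi> t n) \<le> exp (C * t - \<bar>real_of_int n\<bar>)"
    and potential_le: "\<bar>V n\<bar> \<le> K"
begin

lemma isCont_psi: "isCont (\<lambda>t. \<psi> t n) t"
  using deriv by (rule has_vector_derivative_continuous)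

lemma measurable_psi [measurable]: "(\<lambda>t. \<psi> t n) \<in> borel_measurable borel"
  by (intro borel_measurable_continuous_onI) (auto simp: continuous_on_eq_continuous_at isCont_psi)

text \<open>In the upper half plane this is \<open>- \<i>\<close> times the Green function of
  \<open>H - z\<close> between sites 0 and \<open>n\<close>. Defining it as an integral avoids
  constructing the resolvent.\<close>

definition laplace :: "complex \<Rightarrow> int \<Rightarrow> complex" where
  "laplace z n = (LBINT s:{0<..}. exp (\<i> * z * of_real s) * \<psi> s n)"

lemma cmod_exp_laplace: "cmod (exp (\<i> * z * of_real s)) = exp (- Im z * s)"
  by (simp add: norm_exp_eq_Re)

lemma set_integrable_exp:
  fixes e :: real
  assumes "e > 0"
  shows "set_integrable lborel {0<..} (\<lambda>s. exp (- e * s))" "(LBINT s:{0<..}. exp (- e * s)) = 1 / e"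
proof -
  show "set_integrable lborel {0<..} (\<lambda>s. exp (- e * s))"
    using integrable_I0i_exp_mscale[OF assms] by (simp add: mult.commute)
  show "(LBINT s:{0<..}. exp (- e * s)) = 1 / e"
    using LBINT_I0i_exp_mscale[OF assms] interval_integral_to_infinity_eq[where a = 0 and f = "\<lambda>s. exp (- e * s)"]
    by (simp add: mult.commute zero_ereal_def)
qed

lemma set_integrable_laplace:
  assumes "Im z > 0"
  shows "set_integrable lborel {0<..} (\<lambda>s. exp (\<i> * z * of_real s) * \<psi> s n)"
proof (rule set_integrable_bound[OF set_integrable_exp(1)[OF assms]])
  show "AE s in lborel. s \<in> {0<..} \<longrightarrow> norm (exp (\<i> * z * of_real s) * \<psi> s n) \<le> norm (exp (- Im z * s))"
    using le_1 by (auto simp: norm_mult cmod_exp_laplace mult_le_cancel_left1)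
qed (auto simp: set_borel_measurable_def)

lemma cmod_laplace_le:
  assumes "Im z > 0"
  shows "cmod (laplace z n) \<le> 1 / Im z"
proof -
  have "cmod (laplace z n) \<le> (LBINT s:{0<..}. cmod (exp (\<i> * z * of_real s) * \<psi> s n))"
    unfolding laplace_def by (rule set_integral_norm_bound[OF set_integrable_laplace[OF assms]])
  also have "\<dots> \<le> (LBINT s:{0<..}. exp (- Im z * s))"
    by (rule set_integral_mono[OF set_integrable_norm[OF set_integrable_laplace[OF assms]]
        set_integrable_exp(1)[OF assms]])
      (use le_1 in \<open>auto simp: norm_mult cmod_exp_laplace mult_le_cancel_left1\<close>)
  also have "\<dots> = 1 / Im z" by (rule set_integrable_exp(2)[OF assms])
  finally show ?thesis .
qed

text \<open>The spatial decay is not uniform in time, so dominated convergence is used: pointwise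
  decay in \<open>s\<close>, with the exponential damping as majorant.\<close>

lemma laplace_tendsto_0:
  fixes f :: "nat \<Rightarrow> int"
  assumes z: "Im z > 0" and f: "\<And>i. \<bar>f i\<bar> = int i"
  shows "(\<lambda>i. laplace z (f i)) \<longlonglongrightarrow> 0"
proof -
  have "(\<lambda>i. LBINT s. indicator {0<..} s *\<^sub>R (exp (\<i> * z * of_real s) * \<psi> s (f i)))
      \<longlonglongrightarrow> (LBINT (s::real). 0 :: complex)"
  proof (rule integral_dominated_convergence[where w = "\<lambda>s. indicator {0<..} s *\<^sub>R exp (- Im z * s)"])
    show "integrable lborel (\<lambda>s. indicator {0<..} s *\<^sub>R exp (- Im z * s))"
      using set_integrable_exp(1)[OF z] by (simp add: set_integrable_def)
    show "AE s in lborel. (\<lambda>i. indicator {0<..} s *\<^sub>R (exp (\<i> * z * of_real s) * \<psi> s (f i))) \<longlonglongrightarrow> 0"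
    proof (rule AE_I2)
      fix s :: real
      show "(\<lambda>i. indicator {0<..} s *\<^sub>R (exp (\<i> * z * of_real s) * \<psi> s (f i))) \<longlonglongrightarrow> 0"
      proof (cases "s > 0")
        case True
        have "(\<lambda>i. exp (C * s - real i)) \<longlonglongrightarrow> 0" by real_asymp
        moreover have "cmod (\<psi> s (f i)) \<le> exp (C * s - real i)" for i
        proof -
          have "\<bar>real_of_int (f i)\<bar> = real i" using f[of i] by linarith
          then show ?thesis using decay[of s "f i"] True by simp
        qed
        ultimately have "(\<lambda>i. \<psi> s (f i)) \<longlonglongrightarrow> 0"
          by (intro Lim_null_comparison[of "\<lambda>i. \<psi> s (f i)"]) auto
        then show ?thesis by (auto intro!: tendsto_eq_intros)
      qed simp
    qed
    show "AE s in lborel. norm (indicator {0<..} s *\<^sub>R (exp (\<i> * z * of_real s) * \<psi> s (f i)))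
        \<le> indicator {0<..} s *\<^sub>R exp (- Im z * s)" for i
      using le_1 by (auto simp: norm_mult cmod_exp_laplace mult_le_cancel_left1 indicator_def)
  qed auto
  then show ?thesis by (simp add: laplace_def set_lebesgue_integral_def)
qed

text \<open>The derivative of the damped wave function is integrated over time; the initial value
  supplies the source at the origin.\<close>

lemma laplace_equation:
  assumes z: "Im z > 0"
  shows "laplace z (n + 1) + laplace z (n - 1) + of_real (V n) * laplace z n - z * laplace z n
    = - \<i> * (if n = 0 then 1 else 0)"
proof -
  let ?e = "\<lambda>s. exp (\<i> * z * complex_of_real s)"
  let ?f = "\<lambda>s. \<i> * z * (?e s * \<psi> s n)
      - \<i> * (?e s * \<psi> s (n + 1) + ?e s * \<psi> s (n - 1) + of_real (V n) * (?e s * \<psi> s n))"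
  note int = set_integrable_laplace[OF z]
  have ints: "set_integrable lborel {0<..} ?f"
    by (intro set_integral_diff set_integral_add set_integrable_mult_right int)
  have "(LBINT s=0..\<infinity>. ?f s) = 0 - \<psi> 0 n"
  proof (rule interval_integral_FTC_integrable[where F = "\<lambda>s. ?e s * \<psi> s n"])
    show "((\<lambda>s. ?e s * \<psi> s n) has_vector_derivative ?f s) (at s)" for s
    proof -
      have "((\<lambda>s. \<i> * z * complex_of_real s) has_vector_derivative \<i> * z) (at s)"
        by (auto intro!: derivative_eq_intros)
      from field_vector_diff_chain_at[OF this, of exp "?e s"]
      have "(?e has_vector_derivative \<i> * z * ?e s) (at s)"
        by (simp add: o_def DERIV_exp)
      from has_vector_derivative_mult[OF this deriv[of n s]]
      show ?thesis by (simp add: algebra_simps)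
    qed
    show "isCont ?f s" for s
      by (intro continuous_intros isCont_psi)
    show "set_integrable lborel (einterval 0 \<infinity>) ?f"
      using ints by (simp add: einterval_def greaterThan_def zero_ereal_def)
    have "((\<lambda>s. ?e s * \<psi> s n) \<longlongrightarrow> ?e 0 * \<psi> 0 n) (at_right 0)"
      by (intro tendsto_intros isCont_psi[unfolded isCont_def, THEN tendsto_mono[OF at_le, rotated]]) auto
    then show "(((\<lambda>s. ?e s * \<psi> s n) \<circ> real_of_ereal) \<longlongrightarrow> \<psi> 0 n) (at_right 0)"
      unfolding zero_ereal_def ereal_tendsto_simps by simp
    have "((\<lambda>s. exp (- Im z * s)) \<longlongrightarrow> 0) at_top" using z by real_asymp
    then have "((\<lambda>s. ?e s * \<psi> s n) \<longlongrightarrow> 0) at_top"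
      by (rule Lim_null_comparison[rotated])
        (use le_1 in \<open>auto simp: norm_mult cmod_exp_laplace mult_le_cancel_left1
          intro!: eventually_at_top_linorderI[of 0]\<close>)
    then show "(((\<lambda>s. ?e s * \<psi> s n) \<circ> real_of_ereal) \<longlongrightarrow> 0) (at_left \<infinity>)"
      unfolding ereal_tendsto_simps by simp
  qed simp
  moreover have "(LBINT s=0..\<infinity>. ?f s) = (LBINT s:{0<..}. ?f s)"
    using interval_integral_to_infinity_eq[where a = 0 and f = ?f] by (simp add: zero_ereal_def)
  moreover have "(LBINT s:{0<..}. ?f s) = \<i> * z * laplace z n
      - \<i> * (laplace z (n + 1) + laplace z (n - 1) + of_real (V n) * laplace z n)"
    unfolding laplace_def
    by (simp add: int set_integral_diff set_integral_add set_integrable_mult_right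
        set_integral_mult_right set_integrable_mult_right_iff)
  ultimately have "\<i> * z * laplace z n
      - \<i> * (laplace z (n + 1) + laplace z (n - 1) + of_real (V n) * laplace z n) = - (if n = 0 then 1 else 0)"
    by (simp add: init)
  from arg_cong[OF this, of "\<lambda>x. \<i> * x"] show ?thesis by (simp add: algebra_simps)
qed

text \<open>
  \<open>exp (- \<epsilon> s) \<psi> s\<close> averaged against a Gaussian around \<open>t\<close> of width \<open>1 / R\<close> is an average of the
  Laplace transform along the line \<open>Im z = \<epsilon>\<close>.
\<close>

lemma laplace_gaussian:
  assumes e: "e > 0" and R: "R > 0"
  shows "(CLINT x|std_normal_distribution. iexp (- (t * R * x)) * laplace (Complex (R * x) e) n)
    = (LBINT s:{0<..}. of_real (exp (- e * s) * exp (- (R * (s - t))\<^sup>2 / 2)) * \<psi> s n)"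
proof -
  interpret N: prob_space std_normal_distribution by (rule prob_space_normal_density) simp
  have N1: "N.prob UNIV = 1" using N.prob_space by simp
  interpret P: pair_sigma_finite lborel std_normal_distribution ..
  define f :: "real \<times> real \<Rightarrow> complex" where
    "f = (\<lambda>(s, x). indicator {0<..} s *\<^sub>R (of_real (exp (- e * s)) * \<psi> s n * iexp (R * (s - t) * x)))"
  have f_meas: "f \<in> borel_measurable (lborel \<Otimes>\<^sub>M std_normal_distribution)"
    unfolding f_def by measurable
  have cf: "cmod (f (s, x)) \<le> indicator {0<..} s *\<^sub>R exp (- e * s)" for s x
    using le_1[of s n] by (auto simp: f_def norm_mult indicator_def mult_le_cancel_left1)
  have slice: "integrable std_normal_distribution (\<lambda>x. f (s, x))" for s
  proof (rule N.integrable_const_bound[where B = "exp (- e * s)"])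
    show "AE x in std_normal_distribution. cmod (f (s, x)) \<le> exp (- e * s)"
      using cf[of s] by (auto intro!: AE_I2 order_trans[OF cf] simp: indicator_def)
    show "(\<lambda>x. f (s, x)) \<in> borel_measurable std_normal_distribution"
      by (rule measurable_compose[OF measurable_Pair1' f_meas]) simp
  qed
  have "integrable (lborel \<Otimes>\<^sub>M std_normal_distribution) f"
  proof (rule P.Fubini_integrable[OF f_meas])
    show "integrable lborel (\<lambda>s. LINT x|std_normal_distribution. cmod (f (s, x)))"
    proof (rule Bochner_Integration.integrable_bound)
      show "integrable lborel (\<lambda>s. indicator {0<..} s *\<^sub>R exp (- e * s))"
        using set_integrable_exp(1)[OF e] by (simp add: set_integrable_def)
      show "(\<lambda>s. LINT x|std_normal_distribution. cmod (f (s, x))) \<in> borel_measurable lborel"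
        using f_meas by measurable
      have "norm (LINT x|std_normal_distribution. cmod (f (s, x))) \<le> indicator {0<..} s *\<^sub>R exp (- e * s)" for s
      proof -
        have "(LINT x|std_normal_distribution. cmod (f (s, x)))
            \<le> (LINT x|std_normal_distribution. indicator {0<..} s *\<^sub>R exp (- e * s))"
          by (intro integral_mono integrable_norm slice cf) simp
        moreover have "0 \<le> (LINT x|std_normal_distribution. cmod (f (s, x)))" by simp
        ultimately show ?thesis by (simp add: N1)
      qed
      then show "AE s in lborel. norm (LINT x|std_normal_distribution. cmod (f (s, x)))
          \<le> norm (indicator {0<..} s *\<^sub>R exp (- e * s))" by (intro AE_I2) (auto simp: indicator_def)
    qed
    show "AE s in lborel. integrable std_normal_distribution (\<lambda>x. f (s, x))" using slice by simp
  qed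
  then have fub: "(LINT x|std_normal_distribution. LINT s|lborel. f (s, x))
      = (LINT s|lborel. LINT x|std_normal_distribution. f (s, x))"
    using P.Fubini_integral[of "\<lambda>s x. f (s, x)"] by simp
  have "(LINT s|lborel. f (s, x)) = iexp (- (t * R * x)) * laplace (Complex (R * x) e) n" for x
  proof -
    have "f (s, x) = indicator {0<..} s *\<^sub>R (iexp (- (t * R * x)) *
        (exp (\<i> * Complex (R * x) e * of_real s) * \<psi> s n))" for s
    proof -
      have "of_real (exp (- e * s)) * iexp (R * (s - t) * x)
          = iexp (- (t * R * x)) * exp (\<i> * Complex (R * x) e * of_real s)"
        unfolding exp_of_real[symmetric] exp_add[symmetric]
        by (intro arg_cong[of _ _ exp]) (simp add: complex_eq_iff algebra_simps)
      then show ?thesis unfolding f_def by (simp add: mult.assoc[symmetric])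
    qed
    then show ?thesis
      unfolding laplace_def by (simp add: set_lebesgue_integral_def[symmetric])
  qed
  moreover have "(LINT x|std_normal_distribution. f (s, x))
     = indicator {0<..} s *\<^sub>R (of_real (exp (- e * s) * exp (- (R * (s - t))\<^sup>2 / 2)) * \<psi> s n)" for s
  proof -
    \<comment> \<open>The inner integral is the characteristic function of the normal law, which
      produces the Gaussian weight in \<open>s\<close>.\<close>
    have "(LINT x|std_normal_distribution. f (s, x))
      = indicator {0<..} s *\<^sub>R (of_real (exp (- e * s)) * \<psi> s n * char std_normal_distribution (R * (s - t)))"
      unfolding f_def char_def by (simp add: N.integrable_const_bound)
    then show ?thesis by (simp add: char_std_normal_distribution mult_ac)
  qed
  ultimately show ?thesis using fub by (simp add: set_lebesgue_integral_def)
qed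

lemma damped_psi_lipschitz:
  assumes e: "e \<ge> 0" and s: "s \<ge> 0" "t \<ge> 0"
  shows "cmod (of_real (exp (- e * s)) * \<psi> s n - of_real (exp (- e * t)) * \<psi> t n) \<le> (e + K + 2) * \<bar>s - t\<bar>"
proof -
  let ?d = "\<lambda>s. of_real (exp (- e * s)) * (- \<i> * (\<psi> s (n + 1) + \<psi> s (n - 1) + of_real (V n) * \<psi> s n))
      + of_real (- e * exp (- e * s)) * \<psi> s n"
  have K: "K \<ge> 0" using potential_le[of 0] by linarith
  have "norm (of_real (exp (- e * s)) * \<psi> s n - of_real (exp (- e * t)) * \<psi> t n) \<le> (e + K + 2) * norm (s - t)"
  proof (rule differentiable_bound[where S = "{0..}" and f' = "\<lambda>s h. h *\<^sub>R ?d s"])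
    fix r :: real assume r: "r \<in> {0..}"
    have "((\<lambda>s. of_real (exp (- e * s)) :: complex) has_vector_derivative of_real (- e * exp (- e * r))) (at r)"
      by (auto intro!: derivative_eq_intros)
    from has_vector_derivative_mult[OF this deriv[of n r], unfolded has_vector_derivative_def]
    show "((\<lambda>s. of_real (exp (- e * s)) * \<psi> s n) has_derivative (\<lambda>h. h *\<^sub>R ?d r)) (at r within {0..})"
      by (rule has_derivative_at_withinI)
    have ex: "exp (- e * r) \<le> 1" using e r by simp
    have "cmod (of_real (V n) * \<psi> r n) \<le> K * 1"
      unfolding norm_mult norm_of_real using r K by (intro mult_mono potential_le le_1) auto
    then have "cmod (\<psi> r (n + 1) + \<psi> r (n - 1) + of_real (V n) * \<psi> r n) \<le> 1 + 1 + K * 1"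
      using r by (intro norm_triangle_le add_mono le_1) auto
    then have "cmod (of_real (exp (- e * r)) * (- \<i> * (\<psi> r (n + 1) + \<psi> r (n - 1) + of_real (V n) * \<psi> r n)))
        \<le> 1 * (2 + K)"
      unfolding norm_mult using ex by (intro mult_mono) auto
    moreover have "cmod (of_real (- e * exp (- e * r)) * \<psi> r n) \<le> e * 1 * 1"
      unfolding norm_mult norm_of_real abs_mult using ex e r le_1[of r n] by (intro mult_mono) auto
    ultimately have "cmod (?d r) \<le> 1 * (2 + K) + e * 1 * 1"
      by (intro norm_triangle_le add_mono)
    then have "cmod (?d r) \<le> e + K + 2" by (simp only: mult_1 mult_1_right add_ac)
    then show "onorm (\<lambda>h. h *\<^sub>R ?d r) \<le> e + K + 2"
    proof (intro onorm_bound)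
      show "norm (h *\<^sub>R ?d r) \<le> (e + K + 2) * norm h" for h
        unfolding norm_scaleR mult.commute[of "e + K + 2"] real_norm_def
        by (rule mult_left_mono) (fact, simp)
    qed (use e K in simp)
  qed (use s in auto)
  then show ?thesis by simp
qed

text \<open>The damped wave function differs from its Gaussian average by at most a Lipschitz
  constant times the mean deviation, which is of order \<open>1 / R\<close>. By
  \<open>laplace_gaussian\<close> the average is at most \<open>R * B\<close>.\<close>

lemma psi_le_of_laplace_le:
  assumes e: "e > 0" and R: "R > 0" and t: "t \<ge> 1"
    and B: "\<And>E. cmod (laplace (Complex E e) n) \<le> B"
  shows "exp (- e * t) * cmod (\<psi> t n) \<le> R * B + (e + K + 3) / R"
proof -
  interpret N: prob_space std_normal_distribution by (rule prob_space_normal_density) simp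
  have N1: "N.prob UNIV = 1" using N.prob_space by simp
  define h where "h = (\<lambda>s. indicator {0<..} s *\<^sub>R (of_real (exp (- e * s)) * \<psi> s n))"
  define \<rho> where "\<rho> = normal_density t (1 / R)"
  define L where "L = e + K + 3"
  have K: "K \<ge> 0" using potential_le[of 0] by linarith
  have hm [measurable]: "h \<in> borel_measurable borel" unfolding h_def by measurable
  have h1: "cmod (h s) \<le> 1" for s
  proof (cases "s > 0")
    case True
    have "exp (- e * s) * cmod (\<psi> s n) \<le> 1 * 1" using True e le_1[of s n] by (intro mult_mono) auto
    then show ?thesis using True by (simp add: h_def norm_mult)
  qed (simp add: h_def)
  have lip: "cmod (h t - h s) \<le> L * \<bar>s - t\<bar>" for s
  proof (cases "s > 0")
    case True
    have "cmod (h s - h t) \<le> (e + K + 2) * \<bar>s - t\<bar>"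
      using damped_psi_lipschitz[of e s t n] True e t by (simp add: h_def)
    also have "\<dots> \<le> L * \<bar>s - t\<bar>" by (intro mult_right_mono) (auto simp: L_def)
    finally show ?thesis by (simp add: norm_minus_commute)
  next
    case False
    \<comment> \<open>\<open>h\<close> jumps at 0, but from \<open>t \<ge> 1\<close> every
      \<open>s \<le> 0\<close> has distance at least 1, which pays for the jump.\<close>
    have "1 * 1 \<le> L * \<bar>s - t\<bar>" using False t e K by (intro mult_mono) (auto simp: L_def)
    then show ?thesis using h1[of t] False by (simp add: h_def)
  qed
  have \<rho>: "integrable lborel \<rho>" "(LBINT s. \<rho> s) = 1" "\<And>s. \<rho> s \<ge> 0" "\<rho> \<in> borel_measurable borel"
    using R by (auto simp: \<rho>_def)
  have \<rho>h: "integrable lborel (\<lambda>s. \<rho> s *\<^sub>R h s)"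
    by (rule Bochner_Integration.integrable_bound[OF \<rho>(1)])
      (use \<rho> h1 in \<open>auto intro!: AE_I2 mult_left_le\<close>)
  have \<rho>d: "integrable lborel (\<lambda>s. \<rho> s * \<bar>s - t\<bar>)"
    "(LBINT s. \<rho> s * \<bar>s - t\<bar>) = sqrt (2 / pi) / R"
    using integrable_normal_moment_abs[of "1/R" t 1] integral_normal_moment_abs_odd[of "1/R" t 0] R
    by (simp_all add: \<rho>_def)
  have avg: "cmod (LBINT s. \<rho> s *\<^sub>R h s) \<le> R * B"
  proof -
    let ?G = "CLINT x|std_normal_distribution. iexp (- (t * R * x)) * laplace (Complex (R * x) e) n"
    have "\<rho> s *\<^sub>R h s = (R / sqrt (2 * pi)) *\<^sub>R (indicator {0<..} s *\<^sub>R
        (of_real (exp (- e * s) * exp (- (R * (s - t))\<^sup>2 / 2)) * \<psi> s n))" for s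
      using R by (simp add: \<rho>_def normal_density_def h_def scaleR_conv_of_real real_sqrt_mult
        real_sqrt_divide power_mult_distrib power_divide mult_ac)
    then have "(LBINT s. \<rho> s *\<^sub>R h s) = (R / sqrt (2 * pi)) *\<^sub>R ?G"
      unfolding laplace_gaussian[OF e R] set_lebesgue_integral_def
      by (simp only: integral_scaleR_right)
    moreover have "cmod ?G \<le> B"
    proof -
      have B0: "B \<ge> 0" using B[of 0] norm_ge_zero order_trans by blast
      show ?thesis
      \<comment> \<open>A nonintegrable function has integral 0 by convention, so the bound holds in
        either case.\<close>
      proof (cases "integrable std_normal_distribution (\<lambda>x. iexp (- (t * R * x)) * laplace (Complex (R * x) e) n)")
        case True
        have "cmod ?G \<le> (LINT x|std_normal_distribution. B)"
          by (rule Bochner_Integration.integral_norm_bound_integral[OF True]) (use B in \<open>auto simp: norm_mult\<close>)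
        then show ?thesis by (simp add: N1)
      qed (simp add: not_integrable_integral_eq B0)
    qed
    moreover have "R / sqrt (2 * pi) \<le> R"
    proof -
      have "1 \<le> sqrt (2 * pi)" using pi_gt3 by simp
      then show ?thesis using R by (simp add: divide_le_eq mult_le_cancel_left1)
    qed
    ultimately show ?thesis
    proof -
      assume eq: "(LBINT s. \<rho> s *\<^sub>R h s) = (R / sqrt (2 * pi)) *\<^sub>R ?G" and "cmod ?G \<le> B"
        and "R / sqrt (2 * pi) \<le> R"
      then have "\<bar>R / sqrt (2 * pi)\<bar> * cmod ?G \<le> R * B"
        using R by (intro mult_mono) auto
      then show ?thesis unfolding eq norm_scaleR .
    qed
  qed
  have "h t = (LBINT s. \<rho> s *\<^sub>R h t)" using \<rho> by simp
  also have "\<dots> = (LBINT s. \<rho> s *\<^sub>R h s) + (LBINT s. \<rho> s *\<^sub>R (h t - h s))"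
    using \<rho>h \<rho> by (subst Bochner_Integration.integral_add[symmetric]) (auto simp: scaleR_diff_right)
  finally have "cmod (h t) \<le> R * B + cmod (LBINT s. \<rho> s *\<^sub>R (h t - h s))"
    using avg norm_triangle_ineq by (metis (no_types, lifting) add_right_mono order_trans)
  also have "cmod (LBINT s. \<rho> s *\<^sub>R (h t - h s)) \<le> (LBINT s. L * (\<rho> s * \<bar>s - t\<bar>))"
  proof (rule Bochner_Integration.integral_norm_bound_integral)
    show "integrable lborel (\<lambda>s. \<rho> s *\<^sub>R (h t - h s))"
      using \<rho>h \<rho> by (simp add: scaleR_diff_right)
    show "norm (\<rho> s *\<^sub>R (h t - h s)) \<le> L * (\<rho> s * \<bar>s - t\<bar>)" for s
      using mult_left_mono[OF lip \<rho>(3)[of s]] \<rho>(3)[of s] by (simp add: mult_ac)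
  qed (use \<rho>d in simp)
  also have "\<dots> = L * (sqrt (2 / pi) / R)" using \<rho>d by simp
  also have "\<dots> \<le> L / R"
  proof -
    have "sqrt (2 / pi) \<le> 1" using pi_gt3 by simp
    then have "L * sqrt (2 / pi) \<le> L * 1" using e K by (intro mult_left_mono) (auto simp: L_def)
    then show ?thesis using R by (simp add: divide_right_mono)
  qed
  finally show ?thesis using t by (simp add: h_def norm_mult L_def)
qed

end

section \<open>Decay of solutions across a square\<close>

lemma current_solution_step:
  assumes "u (n + 1) + u (n - 1) + of_real (V n) * u n - z * u n = (0 :: complex)"
  shows "current (u (n + 1), u n) = current (u n, u (n - 1)) + Im z * (cmod (u n))\<^sup>2"
proof -
  have "(u (n + 1), u n) = mat_app (site_matrix z (of_real (V n))) (u n, u (n - 1))"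
    using assms by (simp add: mat_app_def site_matrix_def algebra_simps add_eq_0_iff)
  then show ?thesis using current_site_matrix[of z "V n" "(u n, u (n - 1))"] by simp
qed

lemma abs_current_le: "\<bar>current (a, b)\<bar> \<le> cmod a * cmod b"
  unfolding current_def using abs_Im_le_cmod[of "a * cnj b"] by (simp add: norm_mult)

text \<open>The current increases to the right and tends to 0, so it is nonpositive from
  \<open>m\<close> on. Its increment at \<open>n\<close> therefore cannot exceed the modulus of its
  value at \<open>m\<close>.\<close>

lemma solution_tail_right:
  fixes u :: "int \<Rightarrow> complex" and m n :: int
  assumes eq: "\<And>n. n \<ge> m \<Longrightarrow> u (n + 1) + u (n - 1) + of_real (V n) * u n - z * u n = 0"
    and z: "Im z \<ge> 0" and lim: "(\<lambda>i. u (int i)) \<longlonglongrightarrow> 0" and n: "n \<ge> m"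
  shows "Im z * (cmod (u n))\<^sup>2 \<le> cmod (u m) * cmod (u (m - 1))"
proof -
  define w where "w = (\<lambda>n. current (u n, u (n - 1)))"
  have step: "w (n + 1) = w n + Im z * (cmod (u n))\<^sup>2" if "n \<ge> m" for n
    unfolding w_def using current_solution_step[of u n V z] eq[OF that] by simp
  have mono: "w a \<le> w b" if "m \<le> a" "a \<le> b" for a b
    using that(2,1)
  proof (induction b rule: int_ge_induct)
    case (step b)
    have "w b \<le> w (b + 1)" using \<open>m \<le> a\<close> step z by (subst \<open>\<And>n. n \<ge> m \<Longrightarrow> w (n + 1) = _\<close>) auto
    then show ?case using step by simp
  qed simp
  have "(\<lambda>i. u (int (Suc i))) \<longlonglongrightarrow> 0" using lim by (rule LIMSEQ_Suc)
  then have "(\<lambda>i. cmod (u (int (Suc i))) * cmod (u (int i))) \<longlonglongrightarrow> 0 * 0"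
    using lim by (intro tendsto_mult) (auto intro: tendsto_norm_zero)
  moreover have "\<bar>w (int (Suc i))\<bar> \<le> cmod (u (int (Suc i))) * cmod (u (int i))" for i
    unfolding w_def using abs_current_le[of "u (int (Suc i))" "u (int i)"] by simp
  ultimately have w0: "(\<lambda>i. w (int (Suc i))) \<longlonglongrightarrow> 0"
    by (intro Lim_null_comparison[of "\<lambda>i. w (int (Suc i))"]) (auto intro!: always_eventually)
  have "w (n + 1) \<le> 0"
  proof (rule LIMSEQ_le_const[OF w0])
    have "w (n + 1) \<le> w (int (Suc i))" if "i \<ge> nat (n + 1)" for i
      by (rule mono) (use that n in auto)
    then show "\<exists>N. \<forall>i\<ge>N. w (n + 1) \<le> w (int (Suc i))" by blast
  qed
  then have "Im z * (cmod (u n))\<^sup>2 \<le> - w n" using step[OF n] by simp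
  also have "\<dots> \<le> - w m" using mono[of m n] n by simp
  also have "\<dots> \<le> cmod (u m) * cmod (u (m - 1))"
    unfolding w_def using abs_current_le[of "u m" "u (m - 1)"] by linarith
  finally show ?thesis .
qed

text \<open>Reflection at the origin exchanges the roles of the two sites \<open>m\<close> and
  \<open>m - 1\<close> at the cut.\<close>

lemma solution_tail_left:
  fixes u :: "int \<Rightarrow> complex" and m n :: int
  assumes eq: "\<And>n. n < m \<Longrightarrow> u (n + 1) + u (n - 1) + of_real (V n) * u n - z * u n = 0"
    and z: "Im z \<ge> 0" and lim: "(\<lambda>i. u (- int i)) \<longlonglongrightarrow> 0" and n: "n < m"
  shows "Im z * (cmod (u n))\<^sup>2 \<le> cmod (u m) * cmod (u (m - 1))"
proof -
  define u' where "u' = (\<lambda>n. u (- n))"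
  have "Im z * (cmod (u' (- n)))\<^sup>2 \<le> cmod (u' (1 - m)) * cmod (u' (1 - m - 1))"
  proof (rule solution_tail_right[where V = "\<lambda>n. V (- n)"])
    show "u' (n + 1) + u' (n - 1) + of_real (V (- n)) * u' n - z * u' n = 0" if "n \<ge> 1 - m" for n
    proof -
      have a: "- (n - 1) = - n + 1" "- (n + 1) = - n - 1" by simp_all
      show ?thesis
        using eq[of "- n"] that unfolding u'_def a add.commute[of "u (- n - 1)" "u (- n + 1)"] by simp
    qed
  qed (use z lim n in \<open>auto simp: u'_def\<close>)
  then show ?thesis by (simp add: u'_def mult.commute)
qed

lemma transfer_solution:
  fixes u :: "int \<Rightarrow> complex"
  assumes "\<And>n. p \<le> n \<Longrightarrow> n < p + int L \<Longrightarrow> u (n + 1) + u (n - 1) + of_real (V n) * u n - z * u n = 0"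
  shows "mat_app (transfer z V p L) (u p, u (p - 1)) = (u (p + int L), u (p + int L - 1))"
  using assms
proof (induction L)
  case (Suc L)
  have IH: "mat_app (transfer z V p L) (u p, u (p - 1)) = (u (p + int L), u (p + int L - 1))"
    by (rule Suc.IH) (use Suc.prems in auto)
  have "u (p + int L + 1) + u (p + int L - 1) + of_real (V (p + int L)) * u (p + int L) - z * u (p + int L) = 0"
    by (rule Suc.prems) auto
  then show ?case
    by (simp add: mat_app_mult IH) (simp add: mat_app_def site_matrix_def algebra_simps add_eq_0_iff)
qed simp

text \<open>Cayley-Hamilton expresses the trace times the vector at the centre as the sum of those
  at the two ends. Both components are kept because the tail bounds involve their product.\<close>

lemma square_solution_bound:
  fixes u :: "int \<Rightarrow> complex"
  assumes eq: "\<And>n. p \<le> n \<Longrightarrow> n < p + 2 * int L \<Longrightarrow> u (n + 1) + u (n - 1) + of_real (V n) * u n - z * u n = 0"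
    and sq: "transfer z V p L = A" "transfer z V (p + int L) L = A" and det: "mat_det A = 1"
    and B: "\<And>n. cmod (u n) \<le> B" and T: "T > 0" "cmod (mat_trace A) \<ge> T"
  shows "cmod (u (p + int L)) \<le> 2 * B / T" "cmod (u (p + int L - 1)) \<le> 2 * B / T"
proof -
  let ?U = "(u p, u (p - 1))"
  have 1: "mat_app A ?U = (u (p + int L), u (p + int L - 1))"
    using transfer_solution[of p L u V z] eq sq(1) by simp
  have 2: "mat_app A (u (p + int L), u (p + int L - 1)) = (u (p + int L + int L), u (p + int L + int L - 1))"
    using transfer_solution[of "p + int L" L u V z] eq sq(2) by simp
  have "mat_trace A * u (p + int L) = u p + u (p + int L + int L)"
    "mat_trace A * u (p + int L - 1) = u (p - 1) + u (p + int L + int L - 1)"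
    using cayley_hamilton[OF det, of ?U] unfolding 1 2 by simp_all
  moreover have *: "cmod y \<le> 2 * B / T" if "mat_trace A * y = u a + u b" for y a b
  proof -
    have "T * cmod y \<le> cmod (mat_trace A) * cmod y" using T by (intro mult_right_mono) auto
    also have "\<dots> = cmod (u a + u b)" by (simp add: that flip: norm_mult)
    also have "\<dots> \<le> B + B" by (intro norm_triangle_le add_mono B)
    finally show ?thesis using T by (simp add: field_simps)
  qed
  ultimately show "cmod (u (p + int L)) \<le> 2 * B / T" "cmod (u (p + int L - 1)) \<le> 2 * B / T"
    by blast+
qed

section \<open>Tails of the Fibonacci wave function\<close>

lemma wave_function_wave:
  "wave_function (wave l \<theta>) (fib_potential l \<theta>) (exp 1 * (2 + \<bar>l\<bar>)) \<bar>l\<bar>"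
proof
  show "((\<lambda>t. wave l \<theta> t n) has_vector_derivative
     - \<i> * (wave l \<theta> t (n + 1) + wave l \<theta> t (n - 1) + of_real (fib_potential l \<theta> n) * wave l \<theta> t n)) (at t)" for n t
    by (rule wave_deriv)
  show "wave l \<theta> 0 n = (if n = 0 then 1 else 0)" for n by (rule wave_0)
  show "cmod (wave l \<theta> t n) \<le> 1" if "t \<ge> 0" for t n using that by (rule cmod_wave_le_1)
  show "cmod (wave l \<theta> t n) \<le> exp (exp 1 * (2 + \<bar>l\<bar>) * t - \<bar>real_of_int n\<bar>)" if "t \<ge> 0" for t n
    using wave_decay[of l \<theta> t n] that by simp
qed (rule abs_fib_potential_le)

text \<open>The hypothesis at \<open>k\<close> passes to \<open>k + 1\<close>, which supplies the
  two consecutive large traces; \<open>m\<close> further levels yield the superexponential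
  gain.\<close>

lemma trace_poly_growth_off_axis:
  assumes l: "l \<ge> 8" and z: "\<bar>Im z\<bar> * sqrt (l - 4) powr (real k - 1) > 21/10"
  shows "cmod (poly (trace_poly (of_real l) (Suc (Suc k) + m)) z) \<ge> (11/10) ^ fib (Suc m)"
proof (rule trace_growth(2))
  have "sqrt (l - 4) powr (real k - 1) \<le> sqrt (l - 4) powr (real (Suc k) - 1)"
    using l by (intro powr_mono) auto
  then have "\<bar>Im z\<bar> * sqrt (l - 4) powr (real k - 1) \<le> \<bar>Im z\<bar> * sqrt (l - 4) powr (real (Suc k) - 1)"
    by (rule mult_left_mono) simp
  then show "cmod (poly (trace_poly (of_real l) (Suc (Suc k))) z) > 21/10"
    using z by (intro trace_poly_large_off_axis[OF l]) linarith
  show "cmod (poly (trace_poly (of_real l) (Suc k)) z) > 21/10"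
    by (rule trace_poly_large_off_axis[OF l z])
qed simp_all

lemma laplace_wave_tail:
  assumes l: "l \<ge> 8" and z: "Im z > 0" "Im z * sqrt (l - 4) powr (real k - 1) > 21/10"
    and n: "\<bar>n\<bar> > 5 * int (fib (k + m + 3))"
  defines "T \<equiv> (11/10) ^ fib (Suc m) :: real"
  shows "Im z * (cmod (wave_function.laplace (wave l \<theta>) z n))\<^sup>2 \<le> (2 * (1 / Im z) / T)\<^sup>2"
proof -
  interpret W: wave_function "wave l \<theta>" "fib_potential l \<theta>" "exp 1 * (2 + \<bar>l\<bar>)" "\<bar>l\<bar>"
    by (rule wave_function_wave)
  define u where "u = W.laplace z"
  define L where "L = fib (k + m + 2)"
  define F where "F = fib (k + m + 3)"
  define A where "A = fib_matrix z (of_real l) (Suc (k + m))"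
  have LF: "L \<le> F" unfolding L_def F_def by (rule fib_mono) simp
  have T: "T > 0" "cmod (mat_trace A) \<ge> T"
    using trace_poly_growth_off_axis[OF l, of z k m] z
    by (simp_all add: T_def A_def mat_trace_fib_matrix)
  have eq: "u (n + 1) + u (n - 1) + of_real (fib_potential l \<theta> n) * u n - z * u n = 0" if "n \<noteq> 0" for n
    using W.laplace_equation[OF z(1), of n] that by (simp add: u_def)
  have B: "cmod (u n) \<le> 1 / Im z" for n unfolding u_def by (rule W.cmod_laplace_le[OF z(1)])
  have fin: "Im z * (cmod (u n))\<^sup>2 \<le> (2 * (1 / Im z) / T)\<^sup>2"
    if "cmod (u q) \<le> 2 * (1 / Im z) / T" "cmod (u (q - 1)) \<le> 2 * (1 / Im z) / T"
      "Im z * (cmod (u n))\<^sup>2 \<le> cmod (u q) * cmod (u (q - 1))" for q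
  proof -
    have "cmod (u q) * cmod (u (q - 1)) \<le> (2 * (1 / Im z) / T) * (2 * (1 / Im z) / T)"
      using that T z by (intro mult_mono) auto
    then show ?thesis using that(3) by (simp add: power2_eq_square)
  qed
  have "Im z * (cmod (u n))\<^sup>2 \<le> (2 * (1 / Im z) / T)\<^sup>2"
  proof (cases "n > 0")
    case True
    \<comment> \<open>The search starts at 1 to avoid the source at the origin; the centre of the
      square is at most \<open>1 + 4 * F\<close>, hence not beyond \<open>n\<close>.\<close>
    obtain p where p: "1 \<le> p" "p \<le> 1 + 3 * int F"
      "transfer z (fib_potential l \<theta>) p L = A" "transfer z (fib_potential l \<theta>) (p + int L) L = A"
      using fib_potential_square[of 1 "k + m" z l \<theta>] unfolding F_def L_def A_def by blast
    have sq: "cmod (u (p + int L)) \<le> 2 * (1 / Im z) / T" "cmod (u (p + int L - 1)) \<le> 2 * (1 / Im z) / T"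
      by (rule square_solution_bound[OF _ p(3,4) _ B T]; use p eq in \<open>auto simp: A_def mat_det_fib_matrix\<close>)+
    have "Im z * (cmod (u n))\<^sup>2 \<le> cmod (u (p + int L)) * cmod (u (p + int L - 1))"
    proof (rule solution_tail_right)
      show "u (n + 1) + u (n - 1) + of_real (fib_potential l \<theta> n) * u n - z * u n = 0" if "n \<ge> p + int L" for n
        by (rule eq) (use that p in auto)
      show "(\<lambda>i. u (int i)) \<longlonglongrightarrow> 0" unfolding u_def by (rule W.laplace_tendsto_0[OF z(1)]) simp
      show "p + int L \<le> n" using p n True LF by (simp add: F_def)
    qed (use z in simp)
    then show ?thesis by (rule fin[OF sq])
  next
    case False
    \<comment> \<open>Starting at \<open>- 5 * F\<close> leaves room for the whole square: it begins
      at or before \<open>- 2 * F\<close>, so the two words of length at most \<open>F\<close> end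
      before the origin.\<close>
    obtain p where p: "- 5 * int F \<le> p" "p \<le> - 5 * int F + 3 * int F"
      "transfer z (fib_potential l \<theta>) p L = A" "transfer z (fib_potential l \<theta>) (p + int L) L = A"
      using fib_potential_square[of "- 5 * int F" "k + m" z l \<theta>] unfolding F_def L_def A_def by blast
    have LF': "int L \<le> int F" using LF by simp
    have sq: "cmod (u (p + int L)) \<le> 2 * (1 / Im z) / T" "cmod (u (p + int L - 1)) \<le> 2 * (1 / Im z) / T"
      by (rule square_solution_bound[OF _ p(3,4) _ B T]; use p eq LF' in \<open>auto simp: A_def mat_det_fib_matrix\<close>)+
    have Lp: "int L > 0" using fib_neq_0_nat[of "k + m + 2"] unfolding L_def by linarith
    have "Im z * (cmod (u n))\<^sup>2 \<le> cmod (u (p + int L)) * cmod (u (p + int L - 1))"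
    proof (rule solution_tail_left)
      show "u (n + 1) + u (n - 1) + of_real (fib_potential l \<theta> n) * u n - z * u n = 0" if "n < p + int L" for n
        by (rule eq) (use that p LF' Lp in auto)
      show "(\<lambda>i. u (- int i)) \<longlonglongrightarrow> 0" unfolding u_def by (rule W.laplace_tendsto_0[OF z(1)]) simp
      show "n < p + int L" using p n False Lp by (simp add: F_def)
    qed (use z in simp)
    then show ?thesis by (rule fin[OF sq])
  qed
  then show ?thesis by (simp add: u_def)
qed

text \<open>On the line \<open>Im z = 1 / t\<close> the damping costs only the factor
  \<open>exp 1\<close>. The averaging parameter \<open>sqrt T\<close> balances the two error terms,
  so the square root of the trace growth survives.\<close>

lemma wave_tail:
  assumes l: "l \<ge> 8" and t: "t \<ge> 1" and k: "sqrt (l - 4) powr (real k - 1) > 21/10 * t"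
    and n: "\<bar>n\<bar> > 5 * int (fib (k + m + 3))"
  shows "cmod (wave l \<theta> t n) \<le> exp 1 * (l + 6) * t\<^sup>2 / sqrt ((11/10) ^ fib (Suc m))"
proof -
  interpret W: wave_function "wave l \<theta>" "fib_potential l \<theta>" "exp 1 * (2 + \<bar>l\<bar>)" "\<bar>l\<bar>"
    by (rule wave_function_wave)
  define T where "T = (11/10 :: real) ^ fib (Suc m)"
  have T: "T > 0" by (simp add: T_def)
  define e where "e = 1 / t"
  have e: "e > 0" using t by (simp add: e_def)
  have B: "cmod (W.laplace (Complex E e) n) \<le> 2 * t\<^sup>2 / T" for E
  proof -
    have ek: "e * sqrt (l - 4) powr (real k - 1) > 21/10"
      using k t by (simp add: e_def field_simps)
    have "e * (cmod (W.laplace (Complex E e) n))\<^sup>2 \<le> (2 * t / T)\<^sup>2"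
      using laplace_wave_tail[OF l, where z = "Complex E e" and k = k and n = n and m = m and \<theta> = \<theta>] ek e n t by (simp add: T_def e_def)
    then have "(cmod (W.laplace (Complex E e) n))\<^sup>2 \<le> t * (2 * t / T)\<^sup>2"
      using t by (simp add: e_def field_simps)
    also have "\<dots> \<le> t\<^sup>2 * (2 * t / T)\<^sup>2"
      using t by (intro mult_right_mono) (auto simp: power2_eq_square)
    also have "\<dots> = (2 * t\<^sup>2 / T)\<^sup>2" by (simp add: power2_eq_square)
    finally show ?thesis by (rule power2_le_imp_le) (use T in simp)
  qed
  have s: "sqrt T > 0" "sqrt T * sqrt T = T" using T by auto
  have "exp (- e * t) * cmod (wave l \<theta> t n) \<le> sqrt T * (2 * t\<^sup>2 / T) + (e + \<bar>l\<bar> + 3) / sqrt T"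
    by (rule W.psi_le_of_laplace_le[OF e s(1) t B])
  also have "sqrt T * (2 * t\<^sup>2 / T) = 2 * t\<^sup>2 / sqrt T"
    using s T by (simp add: field_simps)
  also have "2 * t\<^sup>2 / sqrt T + (e + \<bar>l\<bar> + 3) / sqrt T = (2 * t\<^sup>2 + e + \<bar>l\<bar> + 3) / sqrt T"
    by (simp add: add_divide_distrib)
  also have "\<dots> \<le> ((l + 6) * t\<^sup>2) / sqrt T"
  proof (rule divide_right_mono)
    have "e \<le> 1" using t by (simp add: e_def)
    moreover have "1 \<le> t\<^sup>2" using t by simp
    then have "(l + 4) * 1 \<le> (l + 4) * t\<^sup>2" using l by (intro mult_left_mono) auto
    ultimately show "2 * t\<^sup>2 + e + \<bar>l\<bar> + 3 \<le> (l + 6) * t\<^sup>2" using l by (simp add: algebra_simps)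
  qed (use s in simp)
  finally have "exp 1 * (exp (- e * t) * cmod (wave l \<theta> t n)) \<le> exp 1 * (((l + 6) * t\<^sup>2) / sqrt T)"
    by (rule mult_left_mono) simp
  moreover have "exp (- e * t) = exp (- 1)" using t by (simp add: e_def)
  moreover have "exp 1 * (exp (- 1) * x) = x" for x :: real
    by (simp add: mult.assoc[symmetric] exp_add[symmetric])
  ultimately show ?thesis by (simp only: T_def mult.assoc times_divide_eq_right)
qed

section \<open>Superpolynomial decay outside the ball of radius \<open>t powr \<alpha>\<close>\<close>

lemma fib_le_golden_power: "real (fib n) \<le> golden ^ n"
proof (induction n rule: fib.induct)
  case (3 n)
  have "golden ^ Suc (Suc n) = golden ^ Suc n + golden ^ n"
    using arg_cong[OF golden_square, of "\<lambda>x. golden ^ n * x"]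
    by (simp add: power2_eq_square algebra_simps)
  then show ?case using 3 by simp
qed (use golden_bounds in auto)

lemma golden_power_le_fib: "golden ^ n \<le> real (fib (Suc n)) * golden"
proof (induction n rule: fib.induct)
  case (3 n)
  have "golden ^ Suc (Suc n) = golden ^ Suc n + golden ^ n"
    using arg_cong[OF golden_square, of "\<lambda>x. golden ^ n * x"]
    by (simp add: power2_eq_square algebra_simps)
  then show ?case using 3 by (simp add: algebra_simps)
qed (use golden_bounds in auto)

text \<open>The traces grow with base \<open>l - 4\<close>, while \<open>alpha_bound\<close> is
  stated with \<open>S_l\<close>; the upper bound passes from one to the other, and the lower bound
  makes its logarithm positive.\<close>

lemma S_l_bounds:
  assumes "l \<ge> 8"
  shows "S_l l \<ge> 3" "S_l l \<le> l - 4"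
proof -
  have a: "4 * 4 \<le> (l - 4) * (l - 4)" using assms by (intro mult_mono) auto
  then have "sqrt 4 \<le> sqrt ((l - 4)\<^sup>2 - 12)" by (intro real_sqrt_le_mono) (simp add: power2_eq_square)
  then show "S_l l \<ge> 3" using assms by (simp add: S_l_def)
  have "sqrt ((l - 4)\<^sup>2 - 12) \<le> sqrt ((l - 4)\<^sup>2)" by (intro real_sqrt_le_mono) simp
  then show "S_l l \<le> l - 4" using assms by (simp add: S_l_def)
qed

lemma alpha_bound_pos:
  assumes "l \<ge> 8"
  shows "alpha_bound l > 0"
proof -
  have "S_l l > 1" using S_l_bounds(1)[OF assms] by linarith
  then show ?thesis using golden_bounds by (simp add: alpha_bound_def)
qed

text \<open>The level \<open>k\<close> is taken just large enough for \<open>wave_tail\<close>,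
  which makes \<open>golden ^ k\<close> of order \<open>t powr a\<close>. The extra levels
  \<open>m\<close> spend half of the gap between \<open>\<alpha>\<close> and \<open>a\<close>: the
  square stays within radius \<open>t powr \<alpha> - 1\<close>, and the trace is exponentially
  large in a power of \<open>t\<close>.\<close>

lemma wave_fast_decay:
  assumes l: "l \<ge> 8" and \<alpha>: "\<alpha> > alpha_bound l"
  obtains \<delta> c :: real where "\<delta> > 0" "c > 0"
    "eventually (\<lambda>t. \<forall>n. \<bar>real_of_int n\<bar> \<ge> t powr \<alpha> - 1 \<longrightarrow>
       cmod (wave l \<theta> t n) \<le> exp 1 * (l + 6) * t\<^sup>2 * exp (- c * t powr \<delta>)) at_top"
proof -
  define a where "a = alpha_bound l"
  define \<delta> where "\<delta> = (\<alpha> - a) / 2"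
  define S where "S = S_l l"
  \<comment> \<open>The 2 comes from the square root in \<open>wave_tail\<close>; one factor
    \<open>golden\<close> comes from rounding \<open>m\<close> down, the other from
    \<open>golden_power_le_fib\<close>.\<close>
  define c where "c = ln (11/10) / (2 * golden * golden)"
  \<comment> \<open>The sixth power collects the rounding in \<open>k\<close> and the 3 in
    \<open>k + m + 3\<close>; \<open>3 powr a\<close> comes from replacing \<open>21/10 * t\<close>
    by \<open>3 * t\<close>.\<close>
  define D where "D = 5 * golden ^ 6 * 3 powr a"
  have \<delta>: "\<delta> > 0" using \<alpha> by (simp add: \<delta>_def a_def)
  have c: "c > 0" using golden_bounds by (simp add: c_def)
  have S: "S \<ge> 3" "S \<le> l - 4" "ln S > 0" using S_l_bounds[OF l] by (auto simp: S_def)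
  have g: "golden > 1" "ln golden > 0" using golden_bounds by auto
  have D: "D > 0" using g by (simp add: D_def)
  have ev: "eventually (\<lambda>t. D * t powr (a + \<delta>) < t powr \<alpha> - 1) at_top"
  proof -
    have "\<alpha> = a + \<delta> + \<delta>" by (simp add: \<delta>_def)
    moreover have "eventually (\<lambda>t. D * t powr (a + \<delta>) < t powr (a + \<delta> + \<delta>) - 1) at_top"
    proof -
      have a\<delta>: "a + \<delta> > 0" using \<delta> alpha_bound_pos[OF l] by (simp add: a_def)
      have "eventually (\<lambda>t::real. D + 1 < t powr \<delta>) at_top" using \<delta> by real_asymp
      moreover have "eventually (\<lambda>t::real. 1 < t powr (a + \<delta>)) at_top" using a\<delta> by real_asymp
      ultimately show ?thesis
      proof eventually_elim
        case (elim t)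
        have "t powr (a + \<delta>) * (D + 1) < t powr (a + \<delta>) * t powr \<delta>"
          using elim by (intro mult_strict_left_mono) auto
        then show ?case
          using elim unfolding powr_add[of t "a + \<delta>" \<delta>] distrib_left
          by (simp add: mult.commute[of D])
      qed
    qed
    ultimately show ?thesis by simp
  qed
  have "eventually (\<lambda>t. \<forall>n. \<bar>real_of_int n\<bar> \<ge> t powr \<alpha> - 1 \<longrightarrow>
       cmod (wave l \<theta> t n) \<le> exp 1 * (l + 6) * t\<^sup>2 * exp (- c * t powr \<delta>)) at_top"
    using ev eventually_ge_at_top[of 1]
  proof eventually_elim
    case (elim t)
    then have t: "t \<ge> 1" by simp
    define x where "x = 2 * ln (3 * t) / ln S"
    define k where "k = nat \<lceil>x\<rceil> + 2"
    define m where "m = nat \<lfloor>\<delta> * ln t / ln golden\<rfloor>"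
    have x0: "x \<ge> 0" using t S by (simp add: x_def)
    have kx: "real k \<le> x + 3" "real k - 1 \<ge> x" using x0 by (simp_all add: k_def) linarith+
    have m0: "\<delta> * ln t / ln golden \<ge> 0" using t \<delta> g by simp
    have mx: "real m \<le> \<delta> * ln t / ln golden" "\<delta> * ln t / ln golden \<le> real m + 1"
      using m0 by (simp_all add: m_def)
    have gp: "golden powr y = exp (y * ln golden)" for y using g by (simp add: powr_def)
    have "21/10 * t < 3 * t" using t by simp
    also have "3 * t = exp (x * (ln S / 2))" using t S by (simp add: x_def)
    also have "\<dots> = sqrt S powr x" using S by (simp add: powr_def ln_sqrt mult.commute)
    also have "\<dots> \<le> sqrt S powr (real k - 1)" using S kx by (intro powr_mono) auto
    also have "\<dots> \<le> sqrt (l - 4) powr (real k - 1)"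
      using S x0 kx by (intro powr_mono2) auto
    finally have k: "sqrt (l - 4) powr (real k - 1) > 21/10 * t" .
    have gx: "golden powr x = (3 * t) powr a"
      unfolding gp using t by (simp add: powr_def x_def a_def alpha_bound_def S_def)
    have gm: "golden powr real m \<le> t powr \<delta>" "t powr \<delta> \<le> golden powr (real m + 1)"
    proof -
      have "golden powr real m \<le> golden powr (\<delta> * ln t / ln golden)"
        "golden powr (\<delta> * ln t / ln golden) \<le> golden powr (real m + 1)"
        using mx g by (auto intro!: powr_mono)
      moreover have "golden powr (\<delta> * ln t / ln golden) = t powr \<delta>"
        unfolding gp using t g by (simp add: powr_def)
      ultimately show "golden powr real m \<le> t powr \<delta>" "t powr \<delta> \<le> golden powr (real m + 1)" by auto
    qed
    have "5 * real (fib (k + m + 3)) \<le> 5 * golden ^ (k + m + 3)"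
      using fib_le_golden_power[of "k + m + 3"] by simp
    also have "golden ^ (k + m + 3) = golden powr (real k + real m + 3)"
      using g by (simp add: powr_realpow[symmetric])
    also have "\<dots> \<le> golden powr (6 + x + real m)" using g kx by (intro powr_mono) auto
    also have "\<dots> = golden ^ 6 * (3 * t) powr a * golden powr real m"
      using g by (simp add: powr_add gx)
    also have "\<dots> \<le> golden ^ 6 * (3 * t) powr a * t powr \<delta>"
      using g gm by (intro mult_left_mono) auto
    also have "5 * (golden ^ 6 * (3 * t) powr a * t powr \<delta>) = D * t powr (a + \<delta>)"
      using t by (simp add: D_def powr_mult powr_add)
    finally have F: "5 * real (fib (k + m + 3)) < t powr \<alpha> - 1" using elim by simp
    have T: "sqrt ((11/10) ^ fib (Suc m)) \<ge> exp (c * t powr \<delta>)"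
    proof -
      have "t powr \<delta> \<le> golden ^ m * golden" using gm g by (simp add: powr_add powr_realpow)
      also have "\<dots> \<le> (real (fib (Suc m)) * golden) * golden"
        using golden_power_le_fib[of m] g by (intro mult_right_mono) auto
      finally have "c * t powr \<delta> \<le> c * ((real (fib (Suc m)) * golden) * golden)"
        using c by (intro mult_left_mono) auto
      also have "\<dots> = real (fib (Suc m)) * (ln (11/10) / 2)" using g by (simp add: c_def)
      finally have "exp (c * t powr \<delta>) \<le> exp (real (fib (Suc m)) * (ln (11/10) / 2))" by simp
      also have "\<dots> = sqrt ((11/10) powr real (fib (Suc m)))"
        by (simp add: powr_def powr_half_sqrt[symmetric] mult_ac)
      finally show ?thesis by (simp add: powr_realpow)
    qed
    show ?case
    proof (intro allI impI)
      fix n :: int assume n: "\<bar>real_of_int n\<bar> \<ge> t powr \<alpha> - 1"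
      have "\<bar>n\<bar> > 5 * int (fib (k + m + 3))" using F n by linarith
      from wave_tail[OF l t k this]
      have "cmod (wave l \<theta> t n) \<le> exp 1 * (l + 6) * t\<^sup>2 / sqrt ((11/10) ^ fib (Suc m))" .
      also have "\<dots> \<le> exp 1 * (l + 6) * t\<^sup>2 / exp (c * t powr \<delta>)"
        using T l by (intro divide_left_mono) auto
      also have "\<dots> = exp 1 * (l + 6) * t\<^sup>2 * exp (- c * t powr \<delta>)"
        by (simp add: exp_minus divide_inverse)
      finally show "cmod (wave l \<theta> t n) \<le> exp 1 * (l + 6) * t\<^sup>2 * exp (- c * t powr \<delta>)" .
    qed
  qed
  then show ?thesis using that \<delta> c by blast
qed

text \<open>Up to distance \<open>2 * C * t\<close> the weights are polynomial in \<open>t\<close>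
  and lose against \<open>wave_fast_decay\<close>; farther out \<open>wave_decay\<close> is
  exponentially small in the distance. The denominator makes the bound summable over all
  sites.\<close>

lemma wave_weighted_decay:
  assumes l: "l \<ge> 8" and \<alpha>: "\<alpha> > alpha_bound l" and p: "p > 0"
  shows "eventually (\<lambda>t. \<forall>n. \<bar>real_of_int n\<bar> \<ge> t powr \<alpha> - 1 \<longrightarrow>
    \<bar>real_of_int n\<bar> powr p * (cmod (wave l \<theta> t n))\<^sup>2 \<le> t powr (- r) / (1 + (real_of_int n)\<^sup>2)) at_top"
proof -
  obtain \<delta> c where \<delta>: "\<delta> > 0" and c: "c > 0"
    and fast: "eventually (\<lambda>t. \<forall>n. \<bar>real_of_int n\<bar> \<ge> t powr \<alpha> - 1 \<longrightarrow>
       cmod (wave l \<theta> t n) \<le> exp 1 * (l + 6) * t\<^sup>2 * exp (- c * t powr \<delta>)) at_top"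
    using wave_fast_decay[OF l \<alpha>] .
  define C where "C = exp 1 * (2 + \<bar>l\<bar>)"
  define D where "D = exp 1 * (l + 6)"
  have C: "C > 0" by (auto simp: C_def intro!: mult_pos_pos)
  have D: "D > 0" using l by (auto simp: D_def intro!: mult_pos_pos)
  have e1: "eventually (\<lambda>x::real. x powr p * (1 + x\<^sup>2) * exp (- 2 * (x / 2)) \<le> exp (- (x / 2))) at_top"
    using p by real_asymp
  then obtain X where X: "\<And>x. x \<ge> X \<Longrightarrow> x powr p * (1 + x\<^sup>2) * exp (- x) \<le> exp (- (x / 2))"
    unfolding eventually_at_top_linorder by auto
  have e2: "eventually (\<lambda>t::real. exp (- C * t) \<le> t powr (- r)) at_top"
    using C by real_asymp
  have e3: "eventually (\<lambda>t::real. (2 * C * t) powr p * (1 + (2 * C * t)\<^sup>2) * (D * t\<^sup>2 * exp (- c * t powr \<delta>))\<^sup>2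
      \<le> t powr (- r)) at_top"
    using C D c \<delta> p by real_asymp
  have e4: "eventually (\<lambda>t::real. 2 * C * t \<ge> X) at_top" using C by real_asymp
  show ?thesis
    using fast e2 e3 e4 eventually_ge_at_top[of 0]
  proof eventually_elim
    case (elim t)
    show ?case
    proof (intro allI impI)
      fix n :: int assume n: "\<bar>real_of_int n\<bar> \<ge> t powr \<alpha> - 1"
      let ?x = "\<bar>real_of_int n\<bar>" and ?w = "cmod (wave l \<theta> t n)"
      have "?x powr p * (1 + ?x\<^sup>2) * ?w\<^sup>2 \<le> t powr (- r)"
      proof (cases "?x \<le> 2 * C * t")
        case True
        have "?w \<le> D * t\<^sup>2 * exp (- c * t powr \<delta>)" using elim(1) n by (simp add: D_def)
        then have "?x powr p * (1 + ?x\<^sup>2) * ?w\<^sup>2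
            \<le> (2 * C * t) powr p * (1 + (2 * C * t)\<^sup>2) * (D * t\<^sup>2 * exp (- c * t powr \<delta>))\<^sup>2"
          using True p by (intro mult_mono powr_mono2 add_mono power_mono mult_nonneg_nonneg) auto
        then show ?thesis using elim by linarith
      next
        case False
        have "?w \<le> exp (C * t - ?x)" using wave_decay[of l \<theta> t n] elim by (simp add: C_def)
        also have "\<dots> \<le> exp (- (?x / 2))" using False by simp
        finally have "?w\<^sup>2 \<le> (exp (- (?x / 2)))\<^sup>2" by (intro power_mono) auto
        also have "\<dots> = exp (- ?x)" by (simp add: power2_eq_square exp_add[symmetric])
        finally have "?x powr p * (1 + ?x\<^sup>2) * ?w\<^sup>2 \<le> ?x powr p * (1 + ?x\<^sup>2) * exp (- ?x)"
          by (intro mult_left_mono) auto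
        also have "\<dots> \<le> exp (- (?x / 2))" by (rule X) (use False elim in linarith)
        also have "\<dots> \<le> exp (- C * t)" using False by simp
        finally show ?thesis using elim by linarith
      qed
      moreover have "1 + (real_of_int n)\<^sup>2 > 0" by (simp add: add_pos_nonneg)
      ultimately show "?x powr p * ?w\<^sup>2 \<le> t powr (- r) / (1 + (real_of_int n)\<^sup>2)"
        by (simp add: field_simps)
    qed
  qed
qed

text \<open>The induction needs the sharper bound \<open>5 - 4 / (M + 1)\<close>, an equality at
  \<open>M = 0\<close>, whose increments dominate the two new terms.\<close>

lemma sum_inverse_squares_le:
  fixes F :: "int set"
  assumes "finite F"
  shows "(\<Sum>n\<in>F. 1 / (1 + (real_of_int n)\<^sup>2)) \<le> 5"
proof -
  have step: "2 / (1 + x\<^sup>2) \<le> 4 / x - 4 / (x + 1)" if "x \<ge> 1" for x :: real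
  proof -
    have "4 / x - 4 / (x + 1) = 4 / (x * (x + 1))" using that by (simp add: field_simps)
    moreover have "2 / (1 + x\<^sup>2) \<le> 4 / (x * (x + 1))"
    proof -
      have "(x - 1)\<^sup>2 + 1 + x \<ge> 0" using that by (intro add_nonneg_nonneg) auto
      then have "x * (x + 1) \<le> 2 * (1 + x\<^sup>2)" using that by (simp add: power2_eq_square algebra_simps)
      then show ?thesis using that by (simp add: divide_simps add_pos_nonneg)
    qed
    ultimately show ?thesis by simp
  qed
  have sym: "(\<Sum>n\<in>{- int M..int M}. 1 / (1 + (real_of_int n)\<^sup>2)) \<le> 5 - 4 / (real M + 1)" for M
  proof (induction M)
    case (Suc M)
    have "{- int (Suc M)..int (Suc M)} = {- int M..int M} \<union> {- int M - 1, int M + 1}" by auto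
    moreover have "(\<Sum>n\<in>{- int M..int M} \<union> {- int M - 1, int M + 1}. 1 / (1 + (real_of_int n)\<^sup>2))
        = (\<Sum>n\<in>{- int M..int M}. 1 / (1 + (real_of_int n)\<^sup>2))
          + (\<Sum>n\<in>{- int M - 1, int M + 1}. 1 / (1 + (real_of_int n)\<^sup>2))"
      by (rule sum.union_disjoint) auto
    moreover have "(\<Sum>n\<in>{- int M - 1, int M + 1}. 1 / (1 + (real_of_int n)\<^sup>2)) = 2 / (1 + (real M + 1)\<^sup>2)"
    proof -
      have "(real_of_int (- int M - 1))\<^sup>2 = (real M + 1)\<^sup>2" "(real_of_int (int M + 1))\<^sup>2 = (real M + 1)\<^sup>2"
        by (simp_all add: power2_eq_square algebra_simps)
      then show ?thesis by (subst sum.insert) auto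
    qed
    ultimately show ?case using Suc.IH step[of "real M + 1"] by (simp add: algebra_simps)
  qed simp
  define M where "M = nat (Max (abs ` insert 0 F))"
  have "F \<subseteq> {- int M..int M}"
  proof
    fix x assume "x \<in> F"
    then have "\<bar>x\<bar> \<le> Max (abs ` insert 0 F)" using assms by (intro Max_ge) auto
    then show "x \<in> {- int M..int M}" by (auto simp: M_def)
  qed
  then have "(\<Sum>n\<in>F. 1 / (1 + (real_of_int n)\<^sup>2)) \<le> (\<Sum>n\<in>{- int M..int M}. 1 / (1 + (real_of_int n)\<^sup>2))"
    by (intro sum_mono2) (auto simp: add_nonneg_nonneg)
  also have "\<dots> \<le> 5 - 4 / (real M + 1)" by (rule sym)
  also have "\<dots> \<le> 5" by simp
  finally show ?thesis .
qed

section \<open>Transport exponents\<close>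

lemma infsum_ennreal_le:
  fixes f :: "'a \<Rightarrow> real"
  assumes "\<And>F. finite F \<Longrightarrow> F \<subseteq> A \<Longrightarrow> sum f F \<le> c" and "\<And>x. x \<in> A \<Longrightarrow> f x \<ge> 0"
  shows "(\<Sum>\<^sub>\<infinity>x\<in>A. ennreal (f x)) \<le> ennreal c"
proof (rule infsum_le_finite_sums)
  show "(\<lambda>x. ennreal (f x)) summable_on A" by (rule nonneg_summable_on_complete) simp
  show "(\<Sum>x\<in>F. ennreal (f x)) \<le> ennreal c" if "finite F" "F \<subseteq> A" for F
    using that assms by (subst sum_ennreal) (auto intro!: ennreal_leI)
qed

lemma elog_le:
  assumes "x \<le> ennreal c" "c > 0"
  shows "elog x \<le> ereal (ln c)"
proof -
  have top: "x \<noteq> \<infinity>" using assms(1) by (auto simp: top_unique)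
  show ?thesis
  proof (cases "x = 0")
    case False
    have "enn2real x \<le> c" using enn2real_mono[OF assms(1)] assms(2) by simp
    moreover have "enn2real x > 0" using False top by (simp add: enn2real_positive_iff less_top zero_less_iff_neq_zero)
    ultimately show ?thesis using False top assms(2) by (simp add: elog_def)
  qed (simp add: elog_def)
qed

lemma elog_div_le:
  assumes "x \<le> ennreal c" "c > 0" "d > 0" "ln c \<le> y * d"
  shows "elog x / ereal d \<le> ereal y"
proof -
  have "elog x / ereal d \<le> ereal (ln c) / ereal d"
    using elog_le[OF assms(1,2)] assms(3) by (intro ereal_divide_right_mono) auto
  also have "\<dots> \<le> ereal y" using assms(3,4) by (simp add: divide_le_eq)
  finally show ?thesis .
qed

lemma S_plus_eq_infinity:
  assumes l: "l \<ge> 8" and \<alpha>: "\<alpha> > alpha_bound l"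
  shows "S_plus (fib_hamiltonian l \<theta>) \<alpha> = \<infinity>"
proof -
  let ?f = "\<lambda>t::real. elog (outside_prob (fib_hamiltonian l \<theta>) (t powr \<alpha> - 1) t) / ereal (ln t)"
  have \<alpha>0: "\<alpha> > 0" using alpha_bound_pos[OF l] \<alpha> by linarith
  have "Limsup at_top ?f \<le> ereal (- r)" for r :: real
  proof (rule Limsup_bounded)
    have "eventually (\<lambda>t::real. t powr \<alpha> \<ge> 2) at_top" using \<alpha>0 by real_asymp
    then show "eventually (\<lambda>t. ?f t \<le> ereal (- r)) at_top"
      using wave_weighted_decay[OF l \<alpha> zero_less_one, of \<theta> "r + 1"] eventually_ge_at_top[of 10]
    proof eventually_elim
      case (elim t)
      define d where "d = t powr (- (r + 1))"
      have sum_le: "(\<Sum>n\<in>F. position_prob (fib_hamiltonian l \<theta>) t n) \<le> d * 5"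
        if F: "finite F" "F \<subseteq> {n. \<bar>real_of_int n\<bar> \<ge> t powr \<alpha> - 1}" for F
      proof -
        have "(\<Sum>n\<in>F. position_prob (fib_hamiltonian l \<theta>) t n) \<le> (\<Sum>n\<in>F. d * (1 / (1 + (real_of_int n)\<^sup>2)))"
        proof (rule sum_mono)
          fix n assume "n \<in> F"
          then have n: "\<bar>real_of_int n\<bar> \<ge> t powr \<alpha> - 1" using F by auto
          \<comment> \<open>From \<open>t powr \<alpha> \<ge> 2\<close> the site satisfies
            \<open>\<bar>n\<bar> \<ge> 1\<close>, so the weight with exponent 1 can be
            inserted.\<close>
          then have "1 * (cmod (wave l \<theta> t n))\<^sup>2 \<le> \<bar>real_of_int n\<bar> * (cmod (wave l \<theta> t n))\<^sup>2"
            using elim(1) by (intro mult_right_mono) auto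
          also have "\<dots> \<le> d * (1 / (1 + (real_of_int n)\<^sup>2))" using elim n by (simp add: d_def)
          finally show "position_prob (fib_hamiltonian l \<theta>) t n \<le> d * (1 / (1 + (real_of_int n)\<^sup>2))"
            by (simp add: position_prob_eq)
        qed
        also have "\<dots> \<le> d * 5"
          unfolding sum_distrib_left[symmetric]
          by (intro mult_left_mono sum_inverse_squares_le F) (simp add: d_def)
        finally show ?thesis .
      qed
      have "outside_prob (fib_hamiltonian l \<theta>) (t powr \<alpha> - 1) t \<le> ennreal (d * 5) + ennreal (d * 5)"
        unfolding outside_prob_def
        by (intro add_mono infsum_ennreal_le sum_le) (auto simp: position_prob_eq)
      also have "\<dots> = ennreal (d * 10)" by (subst ennreal_plus[symmetric]) (auto simp: d_def)
      finally have P: "outside_prob (fib_hamiltonian l \<theta>) (t powr \<alpha> - 1) t \<le> ennreal (d * 10)" .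
      \<comment> \<open>The extra 1 in the exponent \<open>r + 1\<close> absorbs the constant 10,
        since \<open>t \<ge> 10\<close>.\<close>
      have "ln (d * 10) = - (r + 1) * ln t + ln 10" using elim by (simp add: d_def ln_mult ln_powr)
      also have "\<dots> \<le> - r * ln t" using elim by (simp add: algebra_simps)
      finally show ?case
        by (intro elog_div_le[OF P]) (use elim in \<open>auto simp: d_def\<close>)
    qed
  qed
  then have "Limsup at_top ?f = - \<infinity>"
    by (metis ereal_bot minus_minus uminus_ereal.simps(1))
  then show ?thesis unfolding S_plus_def by simp
qed

text \<open>Inside radius \<open>t powr \<alpha>\<close> the total mass 1 bounds the sum; outside,
  the weighted decay contributes at most 5, and 1 + 5 gives the constant.\<close>

lemma moment_le:
  assumes l: "l \<ge> 8" and \<alpha>: "\<alpha> > alpha_bound l" and p: "p > 0"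
  shows "eventually (\<lambda>t. moment (fib_hamiltonian l \<theta>) p t \<le> ennreal (6 * t powr (\<alpha> * p))) at_top"
proof -
  have \<alpha>0: "\<alpha> > 0" using alpha_bound_pos[OF l] \<alpha> by linarith
  show ?thesis
    using wave_weighted_decay[OF l \<alpha> p, of \<theta> 0] eventually_ge_at_top[of 1]
  proof eventually_elim
    case (elim t)
    have tp: "1 \<le> t powr (\<alpha> * p)" using elim \<alpha>0 p by (simp add: ge_one_powr_ge_zero)
    show ?case
      unfolding moment_def
    proof (rule infsum_ennreal_le)
      fix F :: "int set" assume F: "finite F" "F \<subseteq> UNIV"
      have "(\<Sum>n\<in>F. \<bar>real_of_int n\<bar> powr p * position_prob (fib_hamiltonian l \<theta>) t n)
          \<le> (\<Sum>n\<in>F. t powr (\<alpha> * p) * (cmod (wave l \<theta> t n))\<^sup>2 + 1 / (1 + (real_of_int n)\<^sup>2))"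
        unfolding position_prob_eq
      proof (rule sum_mono)
        fix n
        have pos: "0 \<le> 1 / (1 + (real_of_int n)\<^sup>2)" by (simp add: add_nonneg_nonneg)
        show "\<bar>real_of_int n\<bar> powr p * (cmod (wave l \<theta> t n))\<^sup>2
            \<le> t powr (\<alpha> * p) * (cmod (wave l \<theta> t n))\<^sup>2 + 1 / (1 + (real_of_int n)\<^sup>2)"
        proof (cases "\<bar>real_of_int n\<bar> \<ge> t powr \<alpha> - 1")
          case True
          then have "\<bar>real_of_int n\<bar> powr p * (cmod (wave l \<theta> t n))\<^sup>2 \<le> 1 / (1 + (real_of_int n)\<^sup>2)"
            using elim by simp
          then show ?thesis by (simp add: add_increasing)
        next
          case False
          then have "\<bar>real_of_int n\<bar> powr p \<le> (t powr \<alpha>) powr p" using p by (intro powr_mono2) auto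
          then have "\<bar>real_of_int n\<bar> powr p * (cmod (wave l \<theta> t n))\<^sup>2 \<le> t powr (\<alpha> * p) * (cmod (wave l \<theta> t n))\<^sup>2"
            by (intro mult_right_mono) (auto simp: powr_powr)
          then show ?thesis using pos by linarith
        qed
      qed
      also have "\<dots> = t powr (\<alpha> * p) * (\<Sum>n\<in>F. (cmod (wave l \<theta> t n))\<^sup>2) + (\<Sum>n\<in>F. 1 / (1 + (real_of_int n)\<^sup>2))"
        by (simp add: sum.distrib sum_distrib_left)
      also have "\<dots> \<le> t powr (\<alpha> * p) * 1 + 5"
        by (intro add_mono mult_left_mono sum_wave_le_1 sum_inverse_squares_le F) (use elim in auto)
      finally show "(\<Sum>n\<in>F. \<bar>real_of_int n\<bar> powr p * position_prob (fib_hamiltonian l \<theta>) t n) \<le> 6 * t powr (\<alpha> * p)"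
        using tp by linarith
    qed (simp add: position_prob_eq)
  qed
qed

lemma beta_plus_le:
  assumes l: "l \<ge> 8" and \<alpha>: "\<alpha> > alpha_bound l" and p: "p > 0" and e: "e > 0"
  shows "beta_plus (fib_hamiltonian l \<theta>) p \<le> ereal (\<alpha> + e)"
  unfolding beta_plus_def
proof (rule Limsup_bounded)
  have "eventually (\<lambda>t::real. ln 6 \<le> e * p * ln t) at_top" using p e by real_asymp
  then show "eventually (\<lambda>t. elog (moment (fib_hamiltonian l \<theta>) p t) / ereal (p * ln t) \<le> ereal (\<alpha> + e)) at_top"
    using moment_le[OF l \<alpha> p, of \<theta>] eventually_gt_at_top[of 1]
  proof eventually_elim
    case (elim t)
    have "ln (6 * t powr (\<alpha> * p)) = ln 6 + \<alpha> * p * ln t" using elim by (simp add: ln_mult ln_powr)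
    also have "\<dots> \<le> (\<alpha> + e) * (p * ln t)" using elim by (simp add: algebra_simps)
    finally show ?case by (intro elog_div_le[OF elim(2)]) (use elim p in auto)
  qed
qed

theorem theorem2:
  fixes l \<theta> :: real
  assumes "l \<ge> 8" and "0 \<le> \<theta>" and "\<theta> < 1"
  shows "alpha_u_plus (fib_hamiltonian l \<theta>) \<le> ereal (alpha_bound l)
    \<and> (\<forall>p>0. beta_plus (fib_hamiltonian l \<theta>) p \<le> ereal (alpha_bound l))"
proof (intro conjI allI impI)
  show "alpha_u_plus (fib_hamiltonian l \<theta>) \<le> ereal (alpha_bound l)"
    unfolding alpha_u_plus_def
  proof (rule Sup_least)
    fix x assume "x \<in> ereal ` {\<alpha>. 0 \<le> \<alpha> \<and> S_plus (fib_hamiltonian l \<theta>) \<alpha> < \<infinity>}"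
    then obtain \<alpha> where "x = ereal \<alpha>" "S_plus (fib_hamiltonian l \<theta>) \<alpha> \<noteq> \<infinity>" by auto
    then show "x \<le> ereal (alpha_bound l)" using S_plus_eq_infinity[OF assms(1)] by force
  qed
next
  fix p :: real assume p: "p > 0"
  show "beta_plus (fib_hamiltonian l \<theta>) p \<le> ereal (alpha_bound l)"
  proof (rule ereal_le_epsilon2)
    fix e :: real assume e: "e > 0"
    \<comment> \<open>One half of \<open>e\<close> lifts the exponent strictly above
      \<open>alpha_bound l\<close>, the other absorbs the constant in
      \<open>moment_le\<close>.\<close>
    have "beta_plus (fib_hamiltonian l \<theta>) p \<le> ereal ((alpha_bound l + e / 2) + e / 2)"
      by (rule beta_plus_le) (use assms p e in auto)
    then show "beta_plus (fib_hamiltonian l \<theta>) p \<le> ereal (alpha_bound l) + ereal e"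
      by (simp add: add.commute)
  qed
qed

end
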